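(* Let $K>N$ and let $\mathbf{M}=\mathbf{Y}^*\mathbf{Y}$, where $\mathbf{Y}$ is a $K\times N$ random matrix with entries $\mathbf{Y}_{i,j}=\mathbf{Y}_{i,j}^R+\sqrt{-1}\,\mathbf{Y}_{i,j}^I$. (i) Let $X=(\mathbf{Y}_{i,j}^R,\mathbf{Y}_{i,j}^I)_{1\le i\le K,1\le j\le N}$ be a random vector in $\mathbb{R}^{2KN}$ with joint law $\mathbb{P}^{K,N}\sim ID(\beta,0,\nu)$ such that $\mathbb{E}^{K,N}[e^{t\|X\|}]<+\infty$ for some $t>0$. Let $T=\sup\{t>0:\mathbb{E}^{K,N}[e^{t\|X\|}]<+\infty\}$ and let $h^{-1}$ be the inverse of $$h(s)=\int_{\mathbb{R}^{2KN}}\|u\|(e^{s\|u\|}-1)\nu(du),\qquad 0<s<T.$$ Then $$\mathbb{P}^{K,N}\big(\lambda_{max}(\mathbf{M}^{1/2})-\mathbb{E}^{K,N}[\lambda_{max}(\mathbf{M}^{1/2})]\ge\delta\big)\le e^{-\int_0^{\delta/\sqrt2}h^{-1}(s)\,ds},$$ for all $0<\delta<h(T^-)$. (ii) Let $X=(\mathbf{Y}_{i,j}^R,\mathbf{Y}_{i,j}^I)_{1\le i\le K,1\le j\le N}$ be an $\alpha$-stable random vector, $0<\alpha<2$, with Lévy measure $\nu$ given by $\nu(B)=\int_{S^{2KN-1}}\sigma(d\xi)\int_0^{+\infty}\mathbf{1}_B(r\xi)\,dr/r^{1+\alpha}$ for Borel $B\subset\mathbb{R}^{2KN}$. Then, for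 any median $m(\lambda_{max}(\mathbf{M}^{1/2}))$ of $\lambda_{max}(\mathbf{M}^{1/2})$, $$\mathbb{P}^{K,N}\big(\lambda_{max}(\mathbf{M}^{1/2})-m(\lambda_{max}(\mathbf{M}^{1/2}))\ge\delta\big)\le C(\alpha)(\sqrt2)^\alpha\frac{\sigma(S^{2KN-1})}{\delta^\alpha},$$ whenever $\delta>\sqrt2\,[2\sigma(S^{2KN-1})C(\alpha)]^{1/\alpha}$, where $C(\alpha)=4^\alpha(2-\alpha+e\alpha)/\big(\alpha(2-\alpha)\big)$.
   Context: $\mathbf{M}^{1/2}$ is the unique positive semi-definite square root of $\mathbf{M}=\mathbf{Y}^*\mathbf{Y}$ and $\lambda_{max}$ denotes the largest eigenvalue. $\mathbb{P}^{K,N}$ is the joint law of $(\mathbf{Y}_{i,j}^R,\mathbf{Y}_{i,j}^I)_{1\le i\le K,1\le j\le N}$ on $\mathbb{R}^{2KN}$ and $\mathbb{E}^{K,N}$ the corresponding expectation. $\|\cdot\|$ is the Euclidean norm. $h(T^-)$ is the left limit of $h$ at $T$. $X\sim ID(\beta,0,\nu)$ in $\mathbb{R}^d$ means $\mathbb{E}e^{i\langle t,X\rangle}=\exp\{i\langle t,\beta\rangle+\int_{\mathbb{R}^d}(e^{i\langle t,u\rangle}-1-i\langle t,u\rangle\mathbf{1}_{\|u\|\le1})\nu(du)\}$, where $\beta\in\mathbb{R}^d$ and the Lévy measure $\nu\not\equiv0$ is a positive Borel measure without atom at the origin with $\int(1\wedge\|u\|^2)\nu(du)<\infty$. An $\alpha$-stable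 vector is such an $X$ whose Lévy measure has the form displayed in (ii), with $\sigma$ a finite positive measure on the unit sphere. *)

theory Defs
  imports "HOL-Probability.Probability"
begin

section \<open>Matrices\<close>

text \<open>A \<open>K \<times> N\<close> complex matrix has type \<open>complex ^ 'n ^ 'k\<close> with
  \<open>K = CARD('k)\<close> rows and \<open>N = CARD('n)\<close> columns.\<close>

definition conj_transpose :: "complex ^ 'n ^ 'k \<Rightarrow> complex ^ 'k ^ 'n" where
  "conj_transpose A = (\<chi> i j. cnj (A $ j $ i))"

definition gram :: "complex ^ 'n ^ 'k \<Rightarrow> complex ^ 'n ^ 'n" where
  "gram Y = conj_transpose Y ** Y"

definition is_eigenvalue :: "complex ^ 'n ^ 'n \<Rightarrow> complex \<Rightarrow> bool" where
  "is_eigenvalue A c \<longleftrightarrow> (\<exists>v. v \<noteq> 0 \<and> A *v v = c *s v)"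

definition pos_semidef :: "complex ^ 'n ^ 'n \<Rightarrow> bool" where
  "pos_semidef A \<longleftrightarrow>
     conj_transpose A = A \<and> (\<forall>v. 0 \<le> Re (\<Sum>i\<in>UNIV. cnj (v $ i) * (A *v v) $ i))"

text \<open>Meaningful for positive semi-definite \<open>A\<close>, where the root exists and is unique.\<close>
definition mat_sqrt :: "complex ^ 'n ^ 'n \<Rightarrow> complex ^ 'n ^ 'n" where
  "mat_sqrt A = (THE S. pos_semidef S \<and> S ** S = A)"

text \<open>Meaningful for Hermitian \<open>A\<close>, all of whose eigenvalues are real.\<close>
definition lambda_max :: "complex ^ 'n ^ 'n \<Rightarrow> real" where
  "lambda_max A = Max {x. is_eigenvalue A (complex_of_real x)}"

text \<open>The vector \<open>(Y\<^sup>R\<^sub>i\<^sub>j, Y\<^sup>I\<^sub>i\<^sub>j)\<close> of real and imaginary parts of all entries.  The index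
  type has \<open>2KN\<close> elements: \<open>Inl (i, j)\<close> is the coordinate of the real part and
  \<open>Inr (i, j)\<close> that of the imaginary part.\<close>
definition entry_vector :: "complex ^ 'n ^ 'k \<Rightarrow> real ^ ('k \<times> 'n + 'k \<times> 'n)" where
  "entry_vector Y =
     (\<chi> p. case p of Inl (i, j) \<Rightarrow> Re (Y $ i $ j) | Inr (i, j) \<Rightarrow> Im (Y $ i $ j))"

section \<open>Infinitely divisible and stable laws\<close>

definition levy_measure :: "'a::euclidean_space measure \<Rightarrow> bool" where
  "levy_measure \<nu> \<longleftrightarrow>
     sets \<nu> = sets borel \<and> emeasure \<nu> UNIV \<noteq> 0 \<and> emeasure \<nu> {0} = 0 \<and>
     (\<integral>\<^sup>+u. ennreal (min 1 ((norm u)\<^sup>2)) \<partial>\<nu>) < \<infinity>"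

text \<open>\<open>has_ID_law \<mu> \<beta> \<nu>\<close> says that the probability law \<open>\<mu>\<close> is \<open>ID(\<beta>, 0, \<nu>)\<close>.\<close>
definition has_ID_law ::
    "'a::euclidean_space measure \<Rightarrow> 'a \<Rightarrow> 'a measure \<Rightarrow> bool" where
  "has_ID_law \<mu> \<beta> \<nu> \<longleftrightarrow> levy_measure \<nu> \<and>
     (\<forall>t. (LINT x|\<mu>. iexp (t \<bullet> x)) =
        exp (\<i> * complex_of_real (t \<bullet> \<beta>) +
          (LINT u|\<nu>. iexp (t \<bullet> u) - 1
             - \<i> * complex_of_real (t \<bullet> u * indicator (cball 0 1) u))))"

definition stable_levy_form ::
    "real \<Rightarrow> 'a::euclidean_space measure \<Rightarrow> 'a measure \<Rightarrow> bool" where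
  "stable_levy_form \<alpha> \<sigma> \<nu> \<longleftrightarrow>
     finite_measure \<sigma> \<and> sets \<sigma> = sets (restrict_space borel (sphere 0 1)) \<and>
     (\<forall>B\<in>sets borel. emeasure \<nu> B =
        (\<integral>\<^sup>+\<xi>. (\<integral>\<^sup>+r\<in>{0<..}. indicator B (r *\<^sub>R \<xi>) * ennreal (1 / r powr (1 + \<alpha>)) \<partial>lborel) \<partial>\<sigma>))"

definition has_stable_law ::
    "'a::euclidean_space measure \<Rightarrow> real \<Rightarrow> 'a measure \<Rightarrow> bool" where
  "has_stable_law \<mu> \<alpha> \<sigma> \<longleftrightarrow> (\<exists>\<beta> \<nu>. has_ID_law \<mu> \<beta> \<nu> \<and> stable_levy_form \<alpha> \<sigma> \<nu>)"

section \<open>The functions in the bounds\<close>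

definition exp_moment :: "'a::euclidean_space measure \<Rightarrow> real \<Rightarrow> ennreal" where
  "exp_moment \<mu> t = (\<integral>\<^sup>+x. ennreal (exp (t * norm x)) \<partial>\<mu>)"

text \<open>May be \<open>\<infinity>\<close>.\<close>
definition exp_moment_sup :: "'a::euclidean_space measure \<Rightarrow> ereal" where
  "exp_moment_sup \<mu> = Sup (ereal ` {t. 0 < t \<and> exp_moment \<mu> t < \<infinity>})"

definition levy_h :: "'a::euclidean_space measure \<Rightarrow> real \<Rightarrow> real" where
  "levy_h \<nu> s = (LINT u|\<nu>. norm u * (exp (s * norm u) - 1))"

definition levy_h_inv :: "'a::euclidean_space measure \<Rightarrow> ereal \<Rightarrow> real \<Rightarrow> real" where
  "levy_h_inv \<nu> T = the_inv_into {s. 0 < s \<and> ereal s < T} (levy_h \<nu>)"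

text \<open>The left limit \<open>f(T\<^sup>-)\<close>, where both \<open>T\<close> and the limit may be \<open>\<infinity>\<close>.\<close>
definition left_limit :: "(real \<Rightarrow> real) \<Rightarrow> ereal \<Rightarrow> ereal" where
  "left_limit f T = Lim (at_left T) (\<lambda>s. ereal (f (real_of_ereal s)))"

definition is_median :: "'w measure \<Rightarrow> ('w \<Rightarrow> real) \<Rightarrow> real \<Rightarrow> bool" where
  "is_median \<Omega> Z m \<longleftrightarrow>
     1/2 \<le> measure \<Omega> {\<omega> \<in> space \<Omega>. Z \<omega> \<le> m} \<and>
     1/2 \<le> measure \<Omega> {\<omega> \<in> space \<Omega>. m \<le> Z \<omega>}"

definition stable_const :: "real \<Rightarrow> real" where
  "stable_const \<alpha> = 4 powr \<alpha> * (2 - \<alpha> + exp 1 * \<alpha>) / (\<alpha> * (2 - \<alpha>))"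

end

(* The largest eigenvalue of M^(1/2) is the operator norm of Y, hence a 1-Lipschitz function f of X;
  the factor sqrt 2 in the bounds is slack.

  An ID(beta, 0, nu) law is a weak limit of sums of m iid vectors, each equal to 0 with probability
  1 - lam/m and otherwise distributed as nu restricted to {norm u >= eps} and normalised, where lam
  is the mass of the restriction.  Conditioning on all but one summand gives for such a sum
    E exp(s (f - E f)) <= exp (m E phi(s norm xi)) <= exp (integral of phi(s norm u) nu(du)),
  with phi(x) = exp x - 1 - x, a bound which does not depend on m and eps and survives the limit.

  (i) h is the derivative of the exponent on the right, so optimising the Chernoff bound over s
  yields the Legendre transform of the exponent, which is the integral of the inverse of h.

  (ii) Jumps longer than R are discarded; they occur with probability at most nu(norm u > R).  For
  the remaining sum the Chernoff bound gives deviations above R from the mean with probability at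
  most e v, where v R^2 is the integral of (norm u)^2 over norm u <= R.  With R proportional to delta
  both terms together are below 1/2, so that the median lies within R of the truncated mean. *)
theory Submission
  imports Defs
begin

section \<open>The largest eigenvalue of the square root of a Gram matrix\<close>

text \<open>Weak convergence of the approximating sums controls only bounded uniformly continuous
  functions. Hence exponential moments are taken of clamped functions, the clamping being undone by
  Fatou's lemma, and in (ii) events are replaced by Lipschitz ramps, whose widths must fit between
  the levels involved. A stable law may have no mean, and its long jumps can be singled out only
  while they are still summands. So in (ii) truncation and centring happen inside each approximating
  sum; the truncated means are never shown to converge, it is enough that the median bounds them for
  large \<open>n\<close>. Origin of \<open>C(\<alpha>)\<close>: with \<open>\<Sigma>\<close> the
  mass of \<open>\<sigma>\<close>, jumps beyond \<open>R\<close> have mass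
  \<open>\<Sigma> R^(-\<alpha>) / \<alpha>\<close>, and
  \<open>v = \<Sigma> R^(-\<alpha>) / (2 - \<alpha>)\<close>, so the two terms add up to
  \<open>\<Sigma> R^(-\<alpha>) (1/\<alpha> + e/(2 - \<alpha>))\<close>. Any \<open>R\<close> with
  \<open>3 * R \<le> \<delta>\<close> would do; \<open>R = \<delta> / (4 * sqrt 2)\<close>
  reproduces the stated constant, and the lower bound on \<open>\<delta>\<close> says exactly that
  the sum is below 1/2.\<close>

definition self_adjoint :: "('a::euclidean_space \<Rightarrow> 'a) \<Rightarrow> bool" where
  "self_adjoint T \<longleftrightarrow> linear T \<and> (\<forall>x y. T x \<bullet> y = x \<bullet> T y)"

definition orthonormal_eigenbasis :: "('a::euclidean_space \<Rightarrow> 'a) \<Rightarrow> 'a set \<Rightarrow> bool" where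
  "orthonormal_eigenbasis T B \<longleftrightarrow> finite B \<and> (\<forall>b\<in>B. norm b = 1) \<and> pairwise orthogonal B \<and>
     (\<forall>b\<in>B. T b = (b \<bullet> T b) *\<^sub>R b) \<and> (\<forall>x. x = (\<Sum>b\<in>B. (x \<bullet> b) *\<^sub>R b))"

lemma quadratic_nonneg_imp_linear_zero:
  fixes a c :: real
  assumes "\<And>t. 0 \<le> 2 * t * a + t\<^sup>2 * c" and "0 \<le> c"
  shows "a = 0"
proof (rule ccontr)
  assume "a \<noteq> 0"
  \<comment> \<open>The quadratic is smallest at \<open>- a / c\<close>; dividing by
    \<open>c + 1\<close> instead covers \<open>c = 0\<close> as well and still gives a negative
    value.\<close>
  have "2 * (- a / (c + 1)) * a + (- a / (c + 1))\<^sup>2 * c = - (a\<^sup>2 * (c + 2)) / (c + 1)\<^sup>2"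
    using assms(2) by (simp add: divide_simps power2_eq_square) (simp add: algebra_simps)
  moreover have "\<dots> < 0"
    using \<open>a \<noteq> 0\<close> assms(2) by (intro divide_neg_pos) (auto simp: zero_less_mult_iff)
  ultimately show False using assms(1)[of "- a / (c + 1)"] by linarith
qed

text \<open>A maximiser \<open>x\<close> of the Rayleigh quotient on the unit sphere of
  \<open>W\<close> works. The form \<open>l * (y \<bullet> y) - y \<bullet> T y\<close> is
  nonnegative on \<open>W\<close> and vanishes at \<open>x\<close>, so its first variation there is
  zero along every direction in \<open>W\<close>. Invariance of \<open>W\<close> admits the
  direction \<open>d = l *\<^sub>R x - T x\<close>, which gives
  \<open>d \<bullet> d = 0\<close>.\<close>

lemma self_adjoint_eigenvector_in_subspace:
  fixes T :: "'a::euclidean_space \<Rightarrow> 'a"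
  assumes T: "self_adjoint T" and W: "subspace W" "W \<noteq> {0}" and inv: "\<And>x. x \<in> W \<Longrightarrow> T x \<in> W"
  obtains x where "x \<in> W" "norm x = 1" "T x = (x \<bullet> T x) *\<^sub>R x"
proof -
  have lin: "linear T" and adj: "\<And>x y. T x \<bullet> y = x \<bullet> T y"
    using T by (auto simp: self_adjoint_def)
  interpret T: linear T by fact
  let ?S = "W \<inter> sphere 0 1"
  obtain w where w: "w \<in> W" "w \<noteq> 0"
    using W subspace_0 by blast
  then have "(1 / norm w) *\<^sub>R w \<in> ?S"
    using W by (auto simp: subspace_scale)
  moreover have "compact ?S"
    using closed_subspace[OF W(1)] by (simp add: closed_Int_compact)
  moreover have "continuous_on ?S (\<lambda>x. x \<bullet> T x)"
    by (intro continuous_intros linear_continuous_on_compose[OF _ lin])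
  ultimately obtain x where x: "x \<in> ?S" and max: "\<And>y. y \<in> ?S \<Longrightarrow> y \<bullet> T y \<le> x \<bullet> T x"
    using continuous_attains_sup[of ?S "\<lambda>x. x \<bullet> T x"] by blast
  define l where "l = x \<bullet> T x"
  have nx: "norm x = 1" "x \<in> W" "x \<bullet> x = 1" using x by (auto simp: norm_eq_1)
  have q: "y \<bullet> T y \<le> l * (y \<bullet> y)" if "y \<in> W" for y
  proof (cases "y = 0")
    case False
    have "(1 / norm y) *\<^sub>R y \<in> ?S" using that False W by (auto simp: subspace_scale)
    from max[OF this] have "(y \<bullet> T y) / (norm y * norm y) \<le> l"
      using False by (simp add: T.scaleR l_def field_simps)
    then show ?thesis
      using False by (simp add: field_simps dot_square_norm power2_eq_square)
  qed (simp add: T.zero)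
  define d where "d = l *\<^sub>R x - T x"
  have dW: "d \<in> W" unfolding d_def using nx W inv by (intro subspace_diff subspace_scale) auto
  have "d \<bullet> d = 0"
  proof (rule quadratic_nonneg_imp_linear_zero)
    fix t :: real
    have "x + t *\<^sub>R d \<in> W" using nx dW W by (intro subspace_add subspace_scale) auto
    from q[OF this] have "0 \<le> l * ((x + t *\<^sub>R d) \<bullet> (x + t *\<^sub>R d)) - (x + t *\<^sub>R d) \<bullet> T (x + t *\<^sub>R d)"
      by simp
    also have "\<dots> = 2 * t * (d \<bullet> d) + t\<^sup>2 * (l * (d \<bullet> d) - d \<bullet> T d)"
    proof -
      have e: "d \<bullet> T x = l * (x \<bullet> d) - d \<bullet> d"
        by (subst (2) d_def) (simp add: inner_simps inner_commute)
      have e': "x \<bullet> T d = d \<bullet> T x" using adj[of x d] by (simp add: inner_commute)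
      show ?thesis
        by (simp add: T.add T.scaleR inner_simps e' e nx l_def[symmetric] power2_eq_square)
           (simp add: algebra_simps inner_commute)
    qed
    finally show "0 \<le> 2 * t * (d \<bullet> d) + t\<^sup>2 * (l * (d \<bullet> d) - d \<bullet> T d)" .
  next
    show "0 \<le> l * (d \<bullet> d) - d \<bullet> T d" using q[OF dW] by simp
  qed
  then have "T x = (x \<bullet> T x) *\<^sub>R x" by (simp add: d_def l_def)
  with nx that show thesis by blast
qed

text \<open>Take an orthonormal set of eigenvectors of greatest cardinality. Its orthogonal
  complement is invariant by self-adjointness, so unless it is trivial it contains a further unit
  eigenvector, against maximality.\<close>

theorem self_adjoint_spectral:
  fixes T :: "'a::euclidean_space \<Rightarrow> 'a"
  assumes T: "self_adjoint T"
  obtains B where "orthonormal_eigenbasis T B"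
proof -
  have lin: "linear T" and adj: "\<And>x y. T x \<bullet> y = x \<bullet> T y"
    using T by (auto simp: self_adjoint_def)
  define P where "P = (\<lambda>B. (\<forall>b\<in>B. norm b = 1) \<and> pairwise orthogonal B \<and>
     (\<forall>b\<in>B. T b = (b \<bullet> T b) *\<^sub>R b))"
  have fin: "finite B \<and> card B < Suc DIM('a)" if "P B" for B
    using that pairwise_orthogonal_independent[of B] independent_bound[of B]
    by (force simp: P_def)
  have "P {}" by (simp add: P_def)
  then obtain B where B: "P B" and max: "\<And>C. P C \<Longrightarrow> card C \<le> card B"
    using ex_has_greatest_nat[of P "{}" card "Suc DIM('a)"] fin by (metis less_imp_le)
  note BP = B[unfolded P_def]
  define W where "W = {x. \<forall>b\<in>B. x \<bullet> b = 0}"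
  have W: "subspace W" by (auto simp: W_def subspace_def inner_simps)
  have inv: "T x \<in> W" if "x \<in> W" for x
    unfolding W_def
  proof (safe)
    fix b assume "b \<in> B"
    then have "T b = (b \<bullet> T b) *\<^sub>R b" "x \<bullet> b = 0" using BP that by (auto simp: W_def)
    then show "T x \<bullet> b = 0" by (metis adj inner_scaleR_right mult_zero_right)
  qed
  have W0: "W = {0}"
  proof (rule ccontr)
    assume "W \<noteq> {0}"
    then obtain x where x: "x \<in> W" "norm x = 1" "T x = (x \<bullet> T x) *\<^sub>R x"
      using self_adjoint_eigenvector_in_subspace[OF T W _ inv] by blast
    have "x \<notin> B" using x by (force simp: W_def)
    have "P (insert x B)" using BP x
      by (auto simp: P_def pairwise_insert W_def orthogonal_def inner_commute)
    then have "card (insert x B) \<le> card B" by (rule max)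
    then show False using \<open>x \<notin> B\<close> fin[OF B] by simp
  qed
  have "x = (\<Sum>b\<in>B. (x \<bullet> b) *\<^sub>R b)" for x
  proof -
    have "(\<Sum>b\<in>B. (x \<bullet> b) *\<^sub>R b) \<bullet> c = x \<bullet> c" if "c \<in> B" for c
    proof -
      have "(\<Sum>b\<in>B. (x \<bullet> b) *\<^sub>R b) \<bullet> c = (\<Sum>b\<in>B. (x \<bullet> b) * (b \<bullet> c))"
        by (simp add: inner_sum_left)
      also have "\<dots> = (\<Sum>b\<in>B. if b = c then x \<bullet> c else 0)"
        using BP that by (intro sum.cong) (auto simp: pairwise_def orthogonal_def norm_eq_1)
      also have "\<dots> = x \<bullet> c" using that fin[OF B] by simp
      finally show ?thesis .
    qed
    then have "x - (\<Sum>b\<in>B. (x \<bullet> b) *\<^sub>R b) \<in> W" by (simp add: W_def inner_simps)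
    with W0 show ?thesis by simp
  qed
  then have "orthonormal_eigenbasis T B" using BP fin[OF B]
    by (auto simp: orthonormal_eigenbasis_def)
  then show thesis using that by blast
qed

text \<open>Compare on an eigenbasis of \<open>R\<close>. If \<open>R b = m b\<close>, then
  \<open>d = S b - m b\<close> satisfies \<open>S d = - m d\<close>, which positivity of
  \<open>S\<close> forbids for \<open>m > 0\<close> unless \<open>d = 0\<close>; for
  \<open>m = 0\<close>, \<open>S b \<bullet> S b = b \<bullet> S (S b) = 0\<close>.\<close>

lemma self_adjoint_nonneg_sqrt_unique:
  fixes S :: "'a::euclidean_space \<Rightarrow> 'a"
  assumes S: "self_adjoint S" "\<And>x. 0 \<le> x \<bullet> S x" and R: "self_adjoint R" "\<And>x. 0 \<le> x \<bullet> R x"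
    and eq: "\<And>x. S (S x) = R (R x)"
  shows "S = R"
proof -
  obtain B where B: "orthonormal_eigenbasis R B" using self_adjoint_spectral[OF R(1)] .
  note BP = B[unfolded orthonormal_eigenbasis_def]
  interpret S: linear S using S by (simp add: self_adjoint_def)
  interpret R: linear R using R by (simp add: self_adjoint_def)
  have b: "S b = R b" if "b \<in> B" for b
  proof -
    define m where "m = b \<bullet> R b"
    have m: "R b = m *\<^sub>R b" "0 \<le> m" using BP that R by (auto simp: m_def)
    have SS: "S (S b) = (m * m) *\<^sub>R b" by (simp add: eq m(1) R.scaleR)
    show ?thesis
    proof (cases "m = 0")
      case True
      then have "S b \<bullet> S b = 0" using S(1) SS by (simp add: self_adjoint_def)
      then show ?thesis using m True by simp
    next
      case False
      define d where "d = S b - m *\<^sub>R b"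
      have "S d = - m *\<^sub>R d" by (simp add: d_def S.diff S.scaleR SS algebra_simps)
      then have "d \<bullet> S d = - m * (d \<bullet> d)" by simp
      then have "m * (d \<bullet> d) \<le> 0" using S(2)[of d] by simp
      then have "d \<bullet> d \<le> 0" using m False by (simp add: mult_le_0_iff)
      then have "d = 0" using inner_ge_zero[of d] by (metis antisym inner_eq_zero_iff)
      then show ?thesis using m by (simp add: d_def)
    qed
  qed
  show ?thesis
  proof
    fix x
    have x: "x = (\<Sum>b\<in>B. (x \<bullet> b) *\<^sub>R b)" using BP by blast
    show "S x = R x"
      by (subst (1 2) x) (simp add: S.sum R.sum S.scaleR R.scaleR b)
  qed
qed

lemma self_adjoint_nonneg_sqrt_exists:
  fixes T :: "'a::euclidean_space \<Rightarrow> 'a"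
  assumes T: "self_adjoint T" "\<And>x. 0 \<le> x \<bullet> T x"
  obtains S where "self_adjoint S" "\<And>x. 0 \<le> x \<bullet> S x" "\<And>x. S (S x) = T x"
proof -
  obtain B where B: "orthonormal_eigenbasis T B" using self_adjoint_spectral[OF T(1)] .
  note BP = B[unfolded orthonormal_eigenbasis_def]
  interpret T: linear T using T by (simp add: self_adjoint_def)
  define c where "c b = sqrt (b \<bullet> T b)" for b
  define S where "S x = (\<Sum>b\<in>B. (c b * (x \<bullet> b)) *\<^sub>R b)" for x
  have lin: "linear S"
    by (rule linearI) (simp_all add: S_def inner_simps algebra_simps scaleR_sum_right sum.distrib)
  interpret S: linear S by fact
  have Sb: "S b = c b *\<^sub>R b" if "b \<in> B" for b
  proof -
    have "S b = (\<Sum>a\<in>B. if a = b then c b *\<^sub>R b else 0)"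
      unfolding S_def using BP that
      by (intro sum.cong) (auto simp: pairwise_def orthogonal_def norm_eq_1)
    then show ?thesis using that BP by simp
  qed
  show thesis
  proof
    show "self_adjoint S"
      unfolding self_adjoint_def
      by (auto simp: lin S_def inner_sum_left inner_sum_right inner_commute intro!: sum.cong)
    show "0 \<le> x \<bullet> S x" for x
    proof -
      have "x \<bullet> S x = (\<Sum>b\<in>B. c b * (x \<bullet> b)\<^sup>2)"
        by (simp add: S_def inner_sum_right power2_eq_square mult.assoc)
      then show ?thesis using T(2) by (auto simp: c_def intro!: sum_nonneg)
    qed
    show "S (S x) = T x" for x
    proof -
      have x: "x = (\<Sum>b\<in>B. (x \<bullet> b) *\<^sub>R b)" using BP by blast
      have "S (S x) = (\<Sum>b\<in>B. (x \<bullet> b) *\<^sub>R S (S b))"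
        by (subst x) (simp add: S.sum S.scaleR)
      also have "\<dots> = (\<Sum>b\<in>B. (x \<bullet> b) *\<^sub>R T b)"
      proof (intro sum.cong refl)
        fix b assume b: "b \<in> B"
        have "S (S b) = (c b * c b) *\<^sub>R b" by (simp add: Sb[OF b] S.scaleR)
        also have "\<dots> = (b \<bullet> T b) *\<^sub>R b" using T(2)[of b] by (simp add: c_def)
        also have "\<dots> = T b" using BP b by metis
        finally show "(x \<bullet> b) *\<^sub>R S (S b) = (x \<bullet> b) *\<^sub>R T b" by simp
      qed
      also have "\<dots> = T x"
        by (subst (2) x) (simp add: T.sum T.scaleR)
      finally show ?thesis .
    qed
  qed
qed

section \<open>Complex matrices as operators on a real Euclidean space\<close>

lemma inner_complex_vec: "u \<bullet> v = Re (\<Sum>i\<in>UNIV. cnj (u $ i) * v $ i)"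
  for u v :: "complex ^ 'n"
  by (simp add: inner_vec_def inner_complex_def)

lemma conj_transpose_adjoint:
  fixes A :: "complex ^ 'n ^ 'k"
  shows "(conj_transpose A *v x) \<bullet> y = x \<bullet> (A *v y)"
proof -
  have "(\<Sum>i\<in>UNIV. cnj ((conj_transpose A *v x) $ i) * y $ i) =
      (\<Sum>i\<in>UNIV. \<Sum>j\<in>UNIV. A $ j $ i * cnj (x $ j) * y $ i)"
    by (simp add: matrix_vector_mult_def conj_transpose_def sum_distrib_right)
  also have "\<dots> = (\<Sum>j\<in>UNIV. \<Sum>i\<in>UNIV. A $ j $ i * cnj (x $ j) * y $ i)"
    by (rule sum.swap)
  also have "\<dots> = (\<Sum>j\<in>UNIV. cnj (x $ j) * (A *v y) $ j)"
    by (simp add: matrix_vector_mult_def sum_distrib_left mult_ac)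
  finally show ?thesis by (simp only: inner_complex_vec)
qed

lemma linear_matrix_vector_mult_complex: "linear ((*v) (A :: complex ^ 'n ^ 'k))"
  by (rule linearI)
    (simp_all add: vec_eq_iff matrix_vector_mult_def scaleR_sum_right distrib_left sum.distrib)

lemma hermitian_iff_self_adjoint:
  fixes A :: "complex ^ 'n ^ 'n"
  shows "conj_transpose A = A \<longleftrightarrow> self_adjoint ((*v) A)"
proof
  assume "conj_transpose A = A"
  then show "self_adjoint ((*v) A)"
    unfolding self_adjoint_def
    using linear_matrix_vector_mult_complex conj_transpose_adjoint by metis
next
  assume "self_adjoint ((*v) A)"
  then have "(conj_transpose A *v x) \<bullet> y = (A *v x) \<bullet> y" for x y
    by (simp add: self_adjoint_def conj_transpose_adjoint)
  then have "conj_transpose A *v x = A *v x" for x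
    using vector_eq_rdot by blast
  then show "conj_transpose A = A" by (simp add: matrix_eq)
qed

lemma pos_semidef_iff:
  fixes A :: "complex ^ 'n ^ 'n"
  shows "pos_semidef A \<longleftrightarrow> self_adjoint ((*v) A) \<and> (\<forall>v. 0 \<le> v \<bullet> (A *v v))"
  by (simp add: pos_semidef_def hermitian_iff_self_adjoint inner_complex_vec)

text \<open>Since \<open>c = Re c + \<i> * Im c\<close>, commuting with \<open>\<i>\<close> upgrades
  real linearity to complex linearity.\<close>

lemma matrix_of_complex_linear:
  fixes S :: "complex ^ 'n \<Rightarrow> complex ^ 'k"
  assumes "linear S" and "\<And>x. S (\<i> *s x) = \<i> *s S x"
  obtains A where "\<And>x. A *v x = S x"
proof -
  interpret S: linear S by fact
  have "S (c *s x) = c *s S x" for c x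
  proof -
    have c: "c *s x = Re c *\<^sub>R x + Im c *\<^sub>R (\<i> *s x)" for x :: "complex ^ 'm"
      by (simp add: vec_eq_iff complex_eq_iff)
    show ?thesis by (simp add: c S.add S.scaleR assms(2))
  qed
  then have "Vector_Spaces.linear (*s) (*s) S"
    by unfold_locales (auto simp: S.add vec_eq_iff algebra_simps)
  then show thesis using that[of "matrix S"] matrix_works by blast
qed

lemma pos_semidef_sqrt_unique:
  assumes "pos_semidef A" "pos_semidef B" "A ** A = B ** B"
  shows "A = B"
proof -
  have "(*v) A = (*v) B"
    using assms by (intro self_adjoint_nonneg_sqrt_unique)
      (auto simp: pos_semidef_iff matrix_vector_mul_assoc)
  then show ?thesis by (simp add: matrix_eq)
qed

text \<open>Complex linearity of the square root of the underlying real operator is a consequence of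
  uniqueness, since conjugation by multiplication with \<open>\<i>\<close> preserves the square.\<close>
lemma pos_semidef_sqrt_exists:
  fixes A :: "complex ^ 'n ^ 'n"
  assumes "pos_semidef A"
  obtains S where "pos_semidef S" "S ** S = A"
proof -
  have A: "self_adjoint ((*v) A)" "\<And>v. 0 \<le> v \<bullet> (A *v v)" using assms by (auto simp: pos_semidef_iff)
  obtain S where S: "self_adjoint S" "\<And>x. 0 \<le> x \<bullet> S x" "\<And>x. S (S x) = A *v x"
    using self_adjoint_nonneg_sqrt_exists[OF A] by blast
  interpret S: linear S using S by (simp add: self_adjoint_def)
  have adj: "\<And>x y. S x \<bullet> y = x \<bullet> S y" using S by (simp add: self_adjoint_def)
  define J where "J x = \<i> *s x" for x :: "complex ^ 'n"
  have "linear J"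
    by (rule linearI) (simp_all add: J_def vec_eq_iff algebra_simps)
  then interpret J: linear J .
  have JJ: "J (J x) = - x" for x by (simp add: J_def vec_eq_iff)
  have Jadj: "J x \<bullet> y = - (x \<bullet> J y)" for x y
    by (simp add: J_def inner_vec_def inner_complex_def flip: sum_negf)
  have JA: "A *v J x = J (A *v x)" for x
    by (simp add: J_def vec_eq_iff matrix_vector_mult_def sum_distrib_left mult_ac)
  \<comment> \<open>\<open>- J\<close> inverts \<open>J\<close>, so this is \<open>S\<close>
    conjugated by \<open>J\<close>; \<open>S = R\<close> then says that \<open>S\<close> commutes
    with \<open>J\<close>.\<close>
  define R where "R x = - J (S (J x))" for x
  have "linear R"
    by (rule linearI) (simp_all add: R_def J.add S.add J.scaleR S.scaleR)
  have "S = R"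
  proof (rule self_adjoint_nonneg_sqrt_unique[OF S(1,2)])
    have "R x \<bullet> y = x \<bullet> R y" for x y
      by (simp add: R_def Jadj adj)
    then show "self_adjoint R" using \<open>linear R\<close> by (simp add: self_adjoint_def)
    show "0 \<le> x \<bullet> R x" for x
    proof -
      have "x \<bullet> R x = J x \<bullet> S (J x)" by (simp add: R_def Jadj)
      then show ?thesis using S(2) by simp
    qed
    show "S (S x) = R (R x)" for x
      by (simp add: R_def J.neg S.neg JJ S(3) JA)
  qed
  have "S (J x) = J (S x)" for x
    by (subst (2) \<open>S = R\<close>) (simp add: R_def J.neg JJ)
  then obtain M where M: "\<And>x. M *v x = S x"
    using matrix_of_complex_linear[of S] S.linear_axioms by (auto simp: J_def)
  then have MS: "(*v) M = S" by auto
  show thesis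
  proof
    show "pos_semidef M" using S by (simp add: pos_semidef_iff MS)
    show "M ** M = A" by (simp add: matrix_eq M S(3) flip: matrix_vector_mul_assoc)
  qed
qed

lemma mat_sqrt_props:
  assumes "pos_semidef A"
  shows "pos_semidef (mat_sqrt A)" "mat_sqrt A ** mat_sqrt A = A"
proof -
  have "\<exists>!S. pos_semidef S \<and> S ** S = A"
    using pos_semidef_sqrt_exists[OF assms] pos_semidef_sqrt_unique by metis
  from theI'[OF this] show "pos_semidef (mat_sqrt A)" "mat_sqrt A ** mat_sqrt A = A"
    by (auto simp: mat_sqrt_def)
qed

lemma pos_semidef_gram: "pos_semidef (gram Y)"
proof -
  have "v \<bullet> (gram Y *v w) = (Y *v v) \<bullet> (Y *v w)" for v w
    by (metis conj_transpose_adjoint gram_def inner_commute matrix_vector_mul_assoc)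
  then show ?thesis
    by (auto simp: pos_semidef_iff self_adjoint_def linear_matrix_vector_mult_complex inner_commute)
qed

text \<open>\<open>norm Y\<close>, the norm of a vector of rows, is the Frobenius norm;
  Cauchy-Schwarz is applied row by row.\<close>

lemma norm_matrix_vector_mult_le:
  fixes Y :: "complex ^ 'n ^ 'k"
  shows "norm (Y *v v) \<le> norm Y * norm v"
proof -
  have "norm ((Y *v v) $ i) \<le> norm (Y $ i) * norm v" for i
  proof -
    have "norm ((Y *v v) $ i) \<le> (\<Sum>j\<in>UNIV. norm (Y $ i $ j) * norm (v $ j))"
      by (auto simp: matrix_vector_mult_def norm_mult intro!: sum_norm_le)
    also have "\<dots> \<le> norm (Y $ i) * norm v"
      using L2_set_mult_ineq[of "\<lambda>j. norm (Y $ i $ j)" "\<lambda>j. norm (v $ j)" UNIV]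
      by (simp add: norm_vec_def)
    finally show ?thesis .
  qed
  then have "norm (Y *v v) \<le> L2_set (\<lambda>i. norm (Y $ i) * norm v) UNIV"
    unfolding norm_vec_def[of "Y *v v"] by (intro L2_set_mono) auto
  also have "\<dots> = norm Y * norm v"
    by (simp add: norm_vec_def[of Y] L2_set_left_distrib)
  finally show ?thesis .
qed

text \<open>The root \<open>S\<close> satisfies \<open>norm (S *v v) = norm (Y *v v)\<close> because
  \<open>S ** S = gram Y\<close>. In an orthonormal eigenbasis of \<open>S\<close> the norm of
  \<open>S *v x\<close> is read off by Parseval, so the operator norm is the largest of the
  nonnegative eigenvalues.\<close>

lemma lambda_max_mat_sqrt_gram:
  fixes Y :: "complex ^ 'n ^ 'k"
  shows "lambda_max (mat_sqrt (gram Y)) = onorm ((*v) Y)"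
proof -
  define S where "S = mat_sqrt (gram Y)"
  have S: "self_adjoint ((*v) S)" "\<And>v. 0 \<le> v \<bullet> (S *v v)" "S ** S = gram Y"
    using mat_sqrt_props[OF pos_semidef_gram, of Y] by (auto simp: S_def pos_semidef_iff)
  have adj: "\<And>x y. (S *v x) \<bullet> y = x \<bullet> (S *v y)" using S by (simp add: self_adjoint_def)
  interpret S: linear "(*v) S" using S by (simp add: self_adjoint_def)
  have bl: "bounded_linear ((*v) Y)"
    by (simp add: linear_matrix_vector_mult_complex linear_linear)
  have n: "norm (Y *v v) = norm (S *v v)" for v
  proof -
    have "(Y *v v) \<bullet> (Y *v v) = v \<bullet> (gram Y *v v)"
      by (metis conj_transpose_adjoint gram_def inner_commute matrix_vector_mul_assoc)
    also have "\<dots> = (S *v v) \<bullet> (S *v v)"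
      by (simp add: adj flip: S(3) matrix_vector_mul_assoc)
    finally show ?thesis by (simp add: norm_eq)
  qed
  obtain B where B: "orthonormal_eigenbasis ((*v) S) B" using self_adjoint_spectral[OF S(1)] .
  note BP = B[unfolded orthonormal_eigenbasis_def]
  define c where "c b = b \<bullet> (S *v b)" for b
  have Sb: "S *v b = c b *\<^sub>R b" if "b \<in> B" for b using BP that by (auto simp: c_def)
  have Sx: "(S *v x) \<bullet> b = c b * (x \<bullet> b)" if "b \<in> B" for x b using Sb[OF that] by (simp add: adj)
  have sc: "complex_of_real r *s x = r *\<^sub>R x" for r and x :: "complex ^ 'n"
    by (simp add: vec_eq_iff complex_eq_iff)
  have Bn: "b \<noteq> 0" if "b \<in> B" for b using BP that by force
  define E where "E = {x. is_eigenvalue S (complex_of_real x)}"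
  \<comment> \<open>The basis is one of the underlying real space, so it has twice \<open>N\<close>
    vectors; only the set of their eigenvalues matters. Its finiteness also ensures that
    \<open>Max\<close> is meaningful.\<close>
  have E: "E = c ` B"
  proof (intro equalityI subsetI)
    fix x assume "x \<in> E"
    then obtain v where v: "v \<noteq> 0" "S *v v = x *\<^sub>R v" by (auto simp: E_def is_eigenvalue_def sc)
    have "\<exists>b\<in>B. v \<bullet> b \<noteq> 0"
    proof (rule ccontr)
      assume "\<not> ?thesis"
      then have "(\<Sum>b\<in>B. (v \<bullet> b) *\<^sub>R b) = 0" by simp
      then show False using v BP by metis
    qed
    then obtain b where b: "b \<in> B" "v \<bullet> b \<noteq> 0" by blast
    then have "x = c b" using Sx[OF b(1), of v] v by simp
    then show "x \<in> c ` B" using b by blast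
  next
    fix x assume "x \<in> c ` B"
    then show "x \<in> E" using Sb Bn by (auto simp: E_def is_eigenvalue_def sc)
  qed
  have "B \<noteq> {}"
  proof
    assume "B = {}"
    then have "\<And>x :: complex ^ 'n. x = 0" using BP by simp
    then show False by (metis one_neq_zero one_index zero_index)
  qed
  have finE: "finite E" "E \<noteq> {}" using E BP \<open>B \<noteq> {}\<close> by auto
  have cnn: "0 \<le> c b" for b using S(2) by (simp add: c_def)
  have parseval: "norm x ^ 2 = (\<Sum>b\<in>B. (x \<bullet> b)\<^sup>2)" for x
  proof -
    have "x \<bullet> x = x \<bullet> (\<Sum>b\<in>B. (x \<bullet> b) *\<^sub>R b)" using BP by metis
    then show ?thesis unfolding power2_norm_eq_inner by (simp add: inner_sum_right power2_eq_square)
  qed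
  have "Max E = onorm ((*v) Y)"
  proof (rule antisym)
    show "Max E \<le> onorm ((*v) Y)"
    proof (subst Max_le_iff[OF finE], safe)
      fix x assume "x \<in> E"
      then obtain b where b: "b \<in> B" "x = c b" using E by auto
      then have "norm (Y *v b) = x" using Sb BP cnn by (simp add: n)
      then show "x \<le> onorm ((*v) Y)" using onorm[OF bl, of b] BP b by simp
    qed
    have M: "c b \<le> Max E" if "b \<in> B" for b using finE E that by (intro Max_ge) auto
    have M0: "0 \<le> Max E" using M cnn \<open>B \<noteq> {}\<close> by (metis all_not_in_conv order_trans)
    show "onorm ((*v) Y) \<le> Max E"
    proof (rule onorm_le)
      fix x
      have "norm (S *v x) ^ 2 = (\<Sum>b\<in>B. (c b)\<^sup>2 * (x \<bullet> b)\<^sup>2)"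
        by (simp add: parseval Sx power_mult_distrib)
      also have "\<dots> \<le> (\<Sum>b\<in>B. (Max E)\<^sup>2 * (x \<bullet> b)\<^sup>2)"
        by (intro sum_mono mult_right_mono power_mono M cnn) auto
      also have "\<dots> = (Max E * norm x)\<^sup>2"
        by (simp add: parseval power_mult_distrib sum_distrib_left)
      finally show "norm (Y *v x) \<le> Max E * norm x"
        using M0 by (simp add: n power2_le_iff_abs_le abs_mult)
    qed
  qed
  then show ?thesis by (simp add: lambda_max_def E_def S_def)
qed

text \<open>The operator norm is subadditive and dominated by the Frobenius norm, which is the
  Euclidean norm of all real and imaginary parts together.\<close>

lemma onorm_matrix_lipschitz:
  fixes Y Z :: "complex ^ 'n ^ 'k"
  shows "\<bar>onorm ((*v) Y) - onorm ((*v) Z)\<bar> \<le> norm (Y - Z)"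
proof -
  have bl: "bounded_linear ((*v) Y)" for Y :: "complex ^ 'n ^ 'k"
    by (simp add: linear_matrix_vector_mult_complex linear_linear)
  have *: "onorm ((*v) Y) \<le> onorm ((*v) Z) + norm (Y - Z)" for Y Z :: "complex ^ 'n ^ 'k"
  proof -
    have "(*v) Y = (\<lambda>v. Z *v v + (Y - Z) *v v)"
      by (simp add: fun_eq_iff flip: matrix_vector_mult_add_rdistrib)
    then have "onorm ((*v) Y) \<le> onorm ((*v) Z) + onorm ((*v) (Y - Z))"
      using onorm_triangle[OF bl bl, of Z "Y - Z"] by simp
    also have "onorm ((*v) (Y - Z)) \<le> norm (Y - Z)"
      by (rule onorm_le) (rule norm_matrix_vector_mult_le)
    finally show ?thesis by simp
  qed
  show ?thesis using *[of Y Z] *[of Z Y] by (simp add: norm_minus_commute)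
qed

section \<open>The isometry between matrices and their entry vectors\<close>

lemma norm_entry_vector: "norm (entry_vector Y) = norm Y"
proof -
  have "(norm (entry_vector Y))\<^sup>2 = (\<Sum>p\<in>UNIV. (entry_vector Y $ p)\<^sup>2)"
    by (simp only: power2_norm_eq_inner inner_vec_def) (simp add: power2_eq_square)
  also have "\<dots> = (\<Sum>p\<in>UNIV. (Re (Y $ fst p $ snd p))\<^sup>2) + (\<Sum>p\<in>UNIV. (Im (Y $ fst p $ snd p))\<^sup>2)"
    by (subst UNIV_Plus_UNIV[symmetric], subst sum.Plus)
      (simp_all add: entry_vector_def case_prod_unfold)
  also have "\<dots> = (\<Sum>p\<in>UNIV. (norm (Y $ fst p $ snd p))\<^sup>2)"
    by (simp add: cmod_power2 sum.distrib)
  also have "\<dots> = (\<Sum>i\<in>UNIV. \<Sum>j\<in>UNIV. (norm (Y $ i $ j))\<^sup>2)"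
    by (simp add: sum.cartesian_product case_prod_unfold)
  also have "\<dots> = (norm Y)\<^sup>2"
    by (simp add: power2_norm_eq_inner inner_vec_def)
  finally show ?thesis by simp
qed

lemma entry_vector_diff: "entry_vector (Y - Z) = entry_vector Y - entry_vector Z"
  by (simp add: entry_vector_def vec_eq_iff split: sum.split)

lemma surj_entry_vector:
  "surj (entry_vector :: complex ^ 'n::finite ^ 'k::finite \<Rightarrow> _)"
  unfolding surj_def
proof
  fix x :: "real ^ ('k \<times> 'n + 'k \<times> 'n)"
  have "x = entry_vector (\<chi> i j. Complex (x $ Inl (i, j)) (x $ Inr (i, j)))"
    by (simp add: entry_vector_def vec_eq_iff split: sum.split)
  then show "\<exists>Y. x = entry_vector Y" by blast
qed

text \<open>\<open>entry_vector\<close> is an isometric bijection, so the eigenvalue transfers to a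
  function on the coordinate space. From here until the final theorem only a 1-Lipschitz function
  and the law of \<open>X\<close> matter.\<close>

lemma lambda_max_lipschitz_entry_vector:
  obtains f :: "real ^ ('k::finite \<times> 'n::finite + 'k \<times> 'n) \<Rightarrow> real" where
    "\<And>Y :: complex ^ 'n ^ 'k. lambda_max (mat_sqrt (gram Y)) = f (entry_vector Y)"
    "\<And>x y. \<bar>f x - f y\<bar> \<le> norm (x - y)"
proof -
  have inj: "Y = Z" if "entry_vector Y = entry_vector Z" for Y Z :: "complex ^ 'n ^ 'k"
    using norm_entry_vector[of "Y - Z"] that by (simp add: entry_vector_diff)
  define f where "f x = onorm ((*v) (inv entry_vector x :: complex ^ 'n ^ 'k))" for x
  have inv: "inv entry_vector (entry_vector Y) = Y" for Y :: "complex ^ 'n ^ 'k"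
    using inj by (meson injI inv_f_f)
  show thesis
  proof
    show "lambda_max (mat_sqrt (gram Y)) = f (entry_vector Y)" for Y :: "complex ^ 'n ^ 'k"
      by (simp add: f_def inv lambda_max_mat_sqrt_gram)
    show "\<bar>f x - f y\<bar> \<le> norm (x - y)" for x y
    proof -
      obtain Y Z :: "complex ^ 'n ^ 'k" where "x = entry_vector Y" "y = entry_vector Z"
        by (meson surjD surj_entry_vector)
      then show ?thesis
        using onorm_matrix_lipschitz[of Y Z]
        by (simp add: f_def inv norm_entry_vector flip: entry_vector_diff)
    qed
  qed
qed

section \<open>The continuity theorem for characteristic functions in Euclidean space\<close>

text \<open>The product form lets total mass and characteristic function factor into one-dimensional
  integrals.\<close>

definition gauss_density :: "'a::euclidean_space \<Rightarrow> real" where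
  "gauss_density x = (\<Prod>b\<in>Basis. std_normal_density (x \<bullet> b))"

definition gauss :: "'a::euclidean_space measure" where
  "gauss = density lborel (\<lambda>x. ennreal (gauss_density x))"

lemma gauss_density_eq:
  fixes x :: "'a::euclidean_space"
  shows "gauss_density x = (1 / sqrt (2 * pi)) ^ DIM('a) * exp (- (norm x)\<^sup>2 / 2)"
proof -
  have "(norm x)\<^sup>2 = (\<Sum>b\<in>Basis. (x \<bullet> b)\<^sup>2)"
    by (simp only: power2_norm_eq_inner euclidean_inner[of x x]) (simp add: power2_eq_square)
  then show ?thesis
    by (simp add: gauss_density_def std_normal_density_def prod_dividef exp_sum sum_divide_distrib sum_negf power_one_over
        flip: exp_sum)
qed

lemma gauss_density_nonneg [simp]: "0 \<le> gauss_density x"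
  by (simp add: gauss_density_def prod_nonneg)

lemma gauss_density_measurable [measurable]: "gauss_density \<in> borel_measurable borel"
  unfolding gauss_density_eq[abs_def] by measurable

lemma sets_gauss [simp, measurable_cong]: "sets gauss = sets borel"
  by (simp add: gauss_def)

lemma space_gauss [simp]: "space gauss = UNIV"
  by (simp add: gauss_def)

lemma prob_space_gauss: "prob_space (gauss :: 'a::euclidean_space measure)"
proof
  have "(\<integral>\<^sup>+(x::'a). ennreal (gauss_density x) \<partial>lborel) =
      (\<integral>\<^sup>+(x::'a). (\<Prod>b\<in>Basis. ennreal (std_normal_density (x \<bullet> b))) \<partial>lborel)"
    by (intro nn_integral_cong) (simp only: gauss_density_def, subst prod_ennreal, auto)
  also have "\<dots> = (\<Prod>b\<in>(Basis::'a set). \<integral>\<^sup>+x. ennreal (std_normal_density x) \<partial>lborel)"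
    by (rule nn_integral_lborel_prod) auto
  also have "\<dots> = 1"
  proof -
    have "emeasure std_normal_distribution (space std_normal_distribution) = 1"
      by (intro prob_space.emeasure_space_1 prob_space_normal_density) simp
    then show ?thesis by (simp add: emeasure_density)
  qed
  finally show "emeasure (gauss::'a measure) (space gauss) = 1"
    by (simp add: gauss_def emeasure_density)
qed

lemma measure_gauss_UNIV [simp]: "measure (gauss :: 'a::euclidean_space measure) UNIV = 1"
  using prob_space.prob_space[OF prob_space_gauss] by simp

lemma char_gauss:
  fixes t :: "'a::euclidean_space"
  shows "(LINT y|gauss. iexp (t \<bullet> y)) = complex_of_real (exp (- (norm t)\<^sup>2 / 2))"
proof -
  interpret product_sigma_finite "\<lambda>_::'a. lborel :: real measure"
    by unfold_locales
  let ?g = "\<lambda>(b::'a) r. complex_of_real (std_normal_density r) * iexp ((t \<bullet> b) * r)"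
  have int1: "integrable std_normal_distribution (\<lambda>r. iexp (s * r))" for s
  proof -
    interpret prob_space std_normal_distribution by (rule prob_space_normal_density) simp
    show ?thesis by (rule integrable_const_bound[of _ 1]) auto
  qed
  have i: "integrable lborel (?g b)" and e: "integral\<^sup>L lborel (?g b) = exp (- ((t \<bullet> b)^2) / 2)" for b
  proof -
    show "integrable lborel (?g b)"
      using int1[of "t \<bullet> b"] by (subst (asm) integrable_density) (auto simp: scaleR_conv_of_real)
    have "integral\<^sup>L lborel (?g b) = char std_normal_distribution (t \<bullet> b)"
      unfolding char_def by (subst integral_density) (auto simp: scaleR_conv_of_real)
    then show "integral\<^sup>L lborel (?g b) = exp (- ((t \<bullet> b)^2) / 2)"
      by (simp add: char_std_normal_distribution)
  qed
  have n: "(norm t)\<^sup>2 = (\<Sum>b\<in>Basis. (t \<bullet> b)\<^sup>2)"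
    by (simp only: power2_norm_eq_inner euclidean_inner[of t t]) (simp add: power2_eq_square)
  have "(LINT y|gauss. iexp (t \<bullet> y)) = (LINT y|lborel. complex_of_real (gauss_density y) * iexp (t \<bullet> y))"
    unfolding gauss_def by (subst integral_density) (auto simp: scaleR_conv_of_real)
  also have "\<dots> = (LINT f|(\<Pi>\<^sub>M b\<in>Basis. lborel). complex_of_real (gauss_density (\<Sum>b\<in>Basis. f b *\<^sub>R b :: 'a)) *
      iexp (t \<bullet> (\<Sum>b\<in>Basis. f b *\<^sub>R b)))"
    by (subst lborel_eq, subst integral_distr) auto
  also have "\<dots> = (LINT f|(\<Pi>\<^sub>M b\<in>Basis. lborel). (\<Prod>b\<in>Basis. ?g b (f b)))"
  proof (rule Bochner_Integration.integral_cong[OF refl])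
    fix f :: "'a \<Rightarrow> real"
    have "iexp (t \<bullet> (\<Sum>b\<in>Basis. f b *\<^sub>R b)) = (\<Prod>b\<in>Basis. iexp ((t \<bullet> b) * f b))"
      by (simp add: inner_sum_right sum_distrib_left exp_sum mult_ac)
    moreover have "gauss_density (\<Sum>b\<in>Basis. f b *\<^sub>R b :: 'a) = (\<Prod>b\<in>(Basis::'a set). std_normal_density (f b))"
      by (simp add: gauss_density_def)
    ultimately show "complex_of_real (gauss_density (\<Sum>b\<in>Basis. f b *\<^sub>R b :: 'a)) *
      iexp (t \<bullet> (\<Sum>b\<in>Basis. f b *\<^sub>R b)) = (\<Prod>b\<in>Basis. ?g b (f b))"
      by (simp add: prod.distrib)
  qed
  also have "\<dots> = (\<Prod>b\<in>Basis. integral\<^sup>L lborel (?g b))"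
    proof (rule product_integral_prod)
    show "integrable lborel (?g b)" for b by (rule i)
  qed simp
  also have "\<dots> = complex_of_real (exp (\<Sum>b\<in>Basis. - ((t \<bullet> b)^2) / 2))"
    unfolding exp_sum[OF finite_Basis] of_real_prod by (simp only: e)
  also have "\<dots> = complex_of_real (exp (- (norm t)\<^sup>2 / 2))"
    by (simp add: n sum_divide_distrib sum_negf)
  finally show ?thesis .
qed

text \<open>Up to a factor the Gaussian is its own Fourier transform. This is what later expresses a
  smoothed density through a characteristic function without an inversion formula.\<close>

lemma gauss_density_fourier:
  fixes x :: "'a::euclidean_space"
  shows "complex_of_real (gauss_density x) =
    (1 / sqrt (2 * pi)) ^ DIM('a) * (LINT y|gauss. iexp (x \<bullet> y))"
  by (simp add: gauss_density_eq char_gauss)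

lemma integrable_bounded_prob:
  fixes f :: "'a \<Rightarrow> 'b::{banach, second_countable_topology}"
  assumes "prob_space M" "f \<in> borel_measurable M" "\<And>x. norm (f x) \<le> B"
  shows "integrable M f"
proof -
  interpret prob_space M by fact
  show ?thesis using assms by (intro integrable_const_bound[of _ B]) auto
qed

text \<open>Scheffe: pointwise convergence of densities of equal mass is convergence in
  \<open>L^1\<close>, which a bounded \<open>g\<close> turns into convergence of integrals.\<close>

lemma scheffe_bounded:
  fixes g :: "'a \<Rightarrow> real" and q :: "'a \<Rightarrow> real"
  assumes q: "integrable M q" and qn: "\<And>n. integrable M (qn n)"
    and nn: "\<And>n x. 0 \<le> qn n x" "\<And>x. 0 \<le> q x"
    and lim: "\<And>x. (\<lambda>n. qn n x) \<longlonglongrightarrow> q x"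
    and mass: "\<And>n. integral\<^sup>L M (qn n) = integral\<^sup>L M q"
    and g: "g \<in> borel_measurable M" "\<And>x. \<bar>g x\<bar> \<le> B"
  shows "(\<lambda>n. LINT x|M. g x * qn n x) \<longlonglongrightarrow> (LINT x|M. g x * q x)"
proof -
  note [measurable] = borel_measurable_integrable[OF q] borel_measurable_integrable[OF qn] g(1)
  have B: "0 \<le> B" using g(2)[of undefined] by linarith
  have gi: "integrable M (\<lambda>x. g x * p x)" if "integrable M p" for p
    using that g(2) B
    by (intro Bochner_Integration.integrable_bound[of M "\<lambda>x. B * p x" "\<lambda>x. g x * p x"])
      (auto simp: abs_mult intro!: mult_right_mono)
  have "(\<integral>\<^sup>+x. norm (qn n x) \<partial>M) = (\<integral>\<^sup>+x. norm (q x) \<partial>M)" for n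
    using nn q qn mass by (simp add: nn_integral_eq_integral)
  then have "(\<lambda>n. \<integral>\<^sup>+x. norm (qn n x - q x) \<partial>M) \<longlonglongrightarrow> 0"
    using q lim by (intro Scheffe_lemma2) auto
  moreover have "(\<integral>\<^sup>+x. norm (qn n x - q x) \<partial>M) = ennreal (LINT x|M. \<bar>qn n x - q x\<bar>)" for n
    using q qn by (simp add: nn_integral_eq_integral)
  ultimately have "(\<lambda>n. LINT x|M. \<bar>qn n x - q x\<bar>) \<longlonglongrightarrow> 0"
    by (simp add: ennreal_tendsto_0_iff)
  then have "(\<lambda>n. B * (LINT x|M. \<bar>qn n x - q x\<bar>)) \<longlonglongrightarrow> B * 0"
    by (intro tendsto_intros)
  then have lim0: "(\<lambda>n. B * (LINT x|M. \<bar>qn n x - q x\<bar>)) \<longlonglongrightarrow> 0" by simp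
  have bound: "\<bar>(LINT x|M. g x * qn n x) - (LINT x|M. g x * q x)\<bar> \<le> B * (LINT x|M. \<bar>qn n x - q x\<bar>)" for n
  proof -
    have "(LINT x|M. g x * qn n x) - (LINT x|M. g x * q x) = (LINT x|M. g x * (qn n x - q x))"
      using gi[OF q] gi[OF qn] by (simp add: right_diff_distrib)
    also have "\<bar>\<dots>\<bar> \<le> (LINT x|M. \<bar>g x * (qn n x - q x)\<bar>)"
      using integral_norm_bound[of M "\<lambda>x. g x * (qn n x - q x)"] by simp
    also have "\<dots> \<le> (LINT x|M. B * \<bar>qn n x - q x\<bar>)"
      using q qn g(2)
      by (intro integral_mono integrable_mult_right integrable_abs integrable_diff gi)
        (auto simp: abs_mult intro!: mult_right_mono)
    finally show ?thesis by simp
  qed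
  have "(\<lambda>n. (LINT x|M. g x * qn n x) - (LINT x|M. g x * q x)) \<longlonglongrightarrow> 0"
    by (rule Lim_null_comparison[OF _ lim0]) (simp add: bound)
  then show ?thesis by (rule LIM_zero_cancel)
qed

text \<open>\<open>q\<close> is the density of the convolution of \<open>\<mu>\<close> with the
  standard Gaussian. Inserting the Fourier representation of the Gaussian and exchanging integrals
  shows that \<open>q\<close> depends on \<open>\<mu>\<close> only through its characteristic
  function.\<close>

lemma gauss_smoothing_density:
  fixes \<mu> :: "'a::euclidean_space measure"
  assumes \<mu>: "prob_space \<mu>" and [measurable_cong]: "sets \<mu> = sets borel"
  defines "q \<equiv> \<lambda>a. LINT x|\<mu>. gauss_density (a - x)"
  shows "integrable lborel q" "integral\<^sup>L lborel q = 1" "\<And>a. 0 \<le> q a"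
    and "\<And>a. complex_of_real (q a) =
      (1 / sqrt (2 * pi)) ^ DIM('a) * (LINT y|gauss. iexp (a \<bullet> y) * (LINT x|\<mu>. iexp (- y \<bullet> x)))"
    and "\<And>g B. g \<in> borel_measurable borel \<Longrightarrow> (\<And>x. \<bar>g x\<bar> \<le> B) \<Longrightarrow>
      (LINT x|\<mu>. LINT y|gauss. g (x + y)) = (LINT a|lborel. g a * q a)"
proof -
  interpret \<mu>: prob_space \<mu> by fact
  interpret G: prob_space "gauss :: 'a measure" by (rule prob_space_gauss)
  interpret P: pair_prob_space \<mu> "gauss :: 'a measure" ..
  interpret L: pair_sigma_finite \<mu> "lborel :: 'a measure" ..
  define c :: real where "c = (1 / sqrt (2 * pi)) ^ DIM('a)"
  have gb: "gauss_density x \<le> c" for x :: 'a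
    by (simp add: gauss_density_eq c_def mult_left_le)
  have trans: "(\<integral>\<^sup>+a. f a * ennreal (gauss_density (a - x)) \<partial>lborel) = (\<integral>\<^sup>+y. f (x + y) \<partial>gauss)"
    if [measurable]: "f \<in> borel_measurable borel" for f and x :: 'a
  proof -
    have "(\<integral>\<^sup>+y. f (x + y) \<partial>gauss) = (\<integral>\<^sup>+y. ennreal (gauss_density y) * f (x + y) \<partial>lborel)"
      unfolding gauss_def by (subst nn_integral_density) auto
    also have "\<dots> = (\<integral>\<^sup>+a. ennreal (gauss_density (a - x)) * f a \<partial>(distr lborel borel (\<lambda>y. x + y)))"
      by (subst nn_integral_distr) auto
    finally show ?thesis by (simp add: lborel_distr_plus mult.commute)
  qed
  have gm: "integrable \<mu> (\<lambda>x. gauss_density (a - x))" for a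
    using gb by (intro integrable_bounded_prob[OF \<mu>, of _ c]) auto
  have [measurable]: "q \<in> borel_measurable borel"
    unfolding q_def by measurable
  show q0: "0 \<le> q a" for a by (simp add: q_def)
  have eq: "ennreal (q a) = (\<integral>\<^sup>+x. ennreal (gauss_density (a - x)) \<partial>\<mu>)" for a
    unfolding q_def by (rule nn_integral_eq_integral[symmetric]) (auto simp: gm)
  have nn: "(\<integral>\<^sup>+a. f a * ennreal (q a) \<partial>lborel) = (\<integral>\<^sup>+x. \<integral>\<^sup>+y. f (x + y) \<partial>gauss \<partial>\<mu>)"
    if [measurable]: "f \<in> borel_measurable borel" for f :: "'a \<Rightarrow> ennreal"
  proof -
    have "(\<integral>\<^sup>+a. f a * ennreal (q a) \<partial>lborel) = (\<integral>\<^sup>+a. \<integral>\<^sup>+x. f a * ennreal (gauss_density (a - x)) \<partial>\<mu> \<partial>lborel)"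
      by (simp add: eq nn_integral_cmult)
    also have "\<dots> = (\<integral>\<^sup>+x. \<integral>\<^sup>+a. f a * ennreal (gauss_density (a - x)) \<partial>lborel \<partial>\<mu>)"
      by (rule L.Fubini') measurable
    finally show ?thesis by (simp add: trans)
  qed
  have q1: "(\<integral>\<^sup>+a. ennreal (q a) \<partial>lborel) = 1"
    using nn[of "\<lambda>_. 1"] \<mu>.emeasure_space_1 G.emeasure_space_1 by simp
  show qi: "integrable lborel q"
    using q1 q0 by (intro integrableI_bounded) auto
  show "integral\<^sup>L lborel q = 1"
    using q1 q0 by (subst integral_eq_nn_integral) auto
  show "complex_of_real (q a) =
      (1 / sqrt (2 * pi)) ^ DIM('a) * (LINT y|gauss. iexp (a \<bullet> y) * (LINT x|\<mu>. iexp (- y \<bullet> x)))" for a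
  proof -
    have "complex_of_real (q a) = (LINT x|\<mu>. c * (LINT y|gauss. iexp ((a - x) \<bullet> y)))"
      unfolding q_def by (simp add: gauss_density_fourier c_def flip: integral_complex_of_real)
    also have "\<dots> = c * (LINT x|\<mu>. (LINT y|gauss. iexp ((a - x) \<bullet> y)))"
      by simp
    also have "(LINT x|\<mu>. (LINT y|gauss. iexp ((a - x) \<bullet> y))) = (LINT y|gauss. (LINT x|\<mu>. iexp ((a - x) \<bullet> y)))"
    proof (rule P.Fubini_integral[symmetric])
      show "integrable (\<mu> \<Otimes>\<^sub>M gauss) (\<lambda>(x, y). iexp ((a - x) \<bullet> y))"
        by (rule integrable_bounded_prob[of _ _ 1]) (auto simp: P.prob_space_axioms split_beta')
    qed
    also have "\<dots> = (LINT y|gauss. iexp (a \<bullet> y) * (LINT x|\<mu>. iexp (- y \<bullet> x)))"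
    proof (rule Bochner_Integration.integral_cong[OF refl])
      fix y :: 'a
      have "iexp ((a - x) \<bullet> y) = iexp (a \<bullet> y) * iexp (- y \<bullet> x)" for x
        by (simp add: inner_diff_left inner_commute algebra_simps flip: exp_add)
      then show "(LINT x|\<mu>. iexp ((a - x) \<bullet> y)) = iexp (a \<bullet> y) * (LINT x|\<mu>. iexp (- y \<bullet> x))"
        by simp
    qed
    finally show ?thesis by (simp add: c_def)
  qed
  show "(LINT x|\<mu>. LINT y|gauss. g (x + y)) = (LINT a|lborel. g a * q a)"
    if [measurable]: "g \<in> borel_measurable borel" and g: "\<And>x. \<bar>g x\<bar> \<le> B" for g B
  proof -
    have B: "0 \<le> B" using g[of undefined] by linarith
    have gi: "integrable lborel (\<lambda>a. g a * q a)"
      using qi g B q0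
      by (intro Bochner_Integration.integrable_bound[of lborel "\<lambda>x. B * q x" "\<lambda>x. g x * q x"])
        (auto simp: abs_mult intro!: mult_right_mono)
    \<comment> \<open>Shifted to be nonnegative, so that the Tonelli identity \<open>nn\<close>
      applies.\<close>
    define g' where "g' x = g x + B" for x
    have g': "0 \<le> g' x" for x using g[of x] by (simp add: g'_def)
    have g'B: "\<bar>g' x\<bar> \<le> 2 * B" for x using g[of x] by (simp add: g'_def)
    have [measurable]: "g' \<in> borel_measurable borel" unfolding g'_def by measurable
    have i1: "integrable gauss (\<lambda>y. g' (x + y))" for x
      using g'B by (intro integrable_bounded_prob[OF prob_space_gauss, of _ "2 * B"]) auto
    have i1': "integrable gauss (\<lambda>y. g (x + y))" for x
      using g by (intro integrable_bounded_prob[OF prob_space_gauss, of _ "B"]) auto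
    have b: "\<bar>LINT y|gauss. g (x + y)\<bar> \<le> B" for x
    proof -
      have "\<bar>LINT y|gauss. g (x + y)\<bar> \<le> (LINT y|gauss. \<bar>g (x + y)\<bar>)"
        using integral_norm_bound[of gauss "\<lambda>y. g (x + y)"] by simp
      also have "\<dots> \<le> (LINT y|(gauss::'a measure). B)"
        using i1' g by (intro integral_mono) auto
      finally show ?thesis by (simp add: G.prob_space)
    qed
    have i2: "integrable \<mu> (\<lambda>x. LINT y|gauss. g (x + y))"
      using b by (intro integrable_bounded_prob[OF \<mu>, of _ B]) auto
    have "ennreal (LINT x|\<mu>. LINT y|gauss. g' (x + y)) = (\<integral>\<^sup>+x. ennreal (LINT y|gauss. g' (x + y)) \<partial>\<mu>)"
    proof (rule nn_integral_eq_integral[symmetric])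
      show "integrable \<mu> (\<lambda>x. LINT y|gauss. g' (x + y))"
        using i2 i1' by (simp add: g'_def)
      show "AE x in \<mu>. 0 \<le> (LINT y|gauss. g' (x + y))"
        using g' by (intro AE_I2 integral_nonneg_AE) auto
    qed
    also have "\<dots> = (\<integral>\<^sup>+x. \<integral>\<^sup>+y. ennreal (g' (x + y)) \<partial>gauss \<partial>\<mu>)"
      using i1 g' by (simp add: nn_integral_eq_integral)
    also have "\<dots> = (\<integral>\<^sup>+a. ennreal (g' a) * ennreal (q a) \<partial>lborel)"
      by (simp add: nn)
    also have "\<dots> = (\<integral>\<^sup>+a. ennreal (g' a * q a) \<partial>lborel)"
      by (simp add: ennreal_mult g' q0)
    also have "\<dots> = ennreal (LINT a|lborel. g' a * q a)"
    proof (rule nn_integral_eq_integral)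
      show "integrable lborel (\<lambda>a. g' a * q a)"
        using gi qi by (simp add: g'_def distrib_right)
      show "AE a in lborel. 0 \<le> g' a * q a" using g' q0 by simp
    qed
    finally have "(LINT x|\<mu>. LINT y|gauss. g' (x + y)) = (LINT a|lborel. g' a * q a)"
      using g' q0 by (subst (asm) ennreal_inj) (auto intro!: integral_nonneg_AE)
    moreover have "(LINT x|\<mu>. LINT y|gauss. g' (x + y)) = (LINT x|\<mu>. LINT y|gauss. g (x + y)) + B"
      using i1' i2 by (simp add: g'_def G.prob_space \<mu>.prob_space)
    moreover have "(LINT a|lborel. g' a * q a) = (LINT a|lborel. g a * q a) + B"
      using gi qi \<open>integral\<^sup>L lborel q = 1\<close> by (simp add: g'_def distrib_right)
    ultimately show ?thesis by simp
  qed
qed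

text \<open>Convergence of characteristic functions gives pointwise convergence of the smoothed
  densities, by dominated convergence under \<open>gauss\<close> with bound 1;
  \<open>scheffe_bounded\<close> does the rest, for test functions that are merely measurable and
  bounded.\<close>

lemma gauss_smoothing_tendsto:
  fixes \<mu> :: "'a::euclidean_space measure" and g :: "'a \<Rightarrow> real"
  assumes \<mu>: "prob_space \<mu>" "sets \<mu> = sets borel"
    and \<mu>n: "\<And>n. prob_space (\<mu>n n)" "\<And>n. sets (\<mu>n n) = sets borel"
    and char: "\<And>t. (\<lambda>n. LINT x|\<mu>n n. iexp (t \<bullet> x)) \<longlonglongrightarrow> (LINT x|\<mu>. iexp (t \<bullet> x))"
    and g: "g \<in> borel_measurable borel" "\<And>x. \<bar>g x\<bar> \<le> B"
  shows "(\<lambda>n. LINT x|\<mu>n n. LINT y|gauss. g (x + y)) \<longlonglongrightarrow> (LINT x|\<mu>. LINT y|gauss. g (x + y))"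
proof -
  define q :: "'a measure \<Rightarrow> 'a \<Rightarrow> real" where "q M a = (LINT x|M. gauss_density (a - x))" for M a
  note Q = gauss_smoothing_density[OF \<mu>, folded q_def]
  note Qn = gauss_smoothing_density[OF \<mu>n, folded q_def]
  interpret G: prob_space "gauss :: 'a measure" by (rule prob_space_gauss)
  have "(\<lambda>n. LINT a|lborel. g a * q (\<mu>n n) a) \<longlonglongrightarrow> (LINT a|lborel. g a * q \<mu> a)"
  proof (rule scheffe_bounded[OF Q(1) Qn(1)])
    show "(\<lambda>n. q (\<mu>n n) a) \<longlonglongrightarrow> q \<mu> a" for a
    proof -
      have "(\<lambda>n. complex_of_real (q (\<mu>n n) a)) \<longlonglongrightarrow> complex_of_real (q \<mu> a)"
        unfolding Q(4) Qn(4)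
      proof (intro tendsto_mult_left, rule integral_dominated_convergence[where w = "\<lambda>_. 1"])
        show "AE y in gauss. (\<lambda>n. iexp (a \<bullet> y) * (LINT x|\<mu>n n. iexp (- y \<bullet> x))) \<longlonglongrightarrow> iexp (a \<bullet> y) * (LINT x|\<mu>. iexp (- y \<bullet> x))"
          by (intro AE_I2 tendsto_mult_left char)
        have m: "(\<lambda>y. iexp (a \<bullet> y) * (LINT x|M. iexp (- y \<bullet> x))) \<in> borel_measurable gauss"
          if "prob_space M" and [measurable_cong]: "sets M = sets borel" for M
        proof -
          interpret prob_space M by fact
          show ?thesis by measurable
        qed
        show "(\<lambda>y. iexp (a \<bullet> y) * (LINT x|\<mu>. iexp (- y \<bullet> x))) \<in> borel_measurable gauss"
          "\<And>n. (\<lambda>y. iexp (a \<bullet> y) * (LINT x|\<mu>n n. iexp (- y \<bullet> x))) \<in> borel_measurable gauss"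
          using m \<mu> \<mu>n by auto
        show "AE y in gauss. norm (iexp (a \<bullet> y) * (LINT x|\<mu>n n. iexp (- y \<bullet> x))) \<le> 1" for n
        proof (rule AE_I2)
          fix y
          interpret prob_space "\<mu>n n" by fact
          have "norm (LINT x|\<mu>n n. iexp (- y \<bullet> x)) \<le> (LINT x|\<mu>n n. norm (iexp (- y \<bullet> x)))"
            by (rule integral_norm_bound)
          also have "\<dots> = 1" by (simp add: prob_space)
          finally show "norm (iexp (a \<bullet> y) * (LINT x|\<mu>n n. iexp (- y \<bullet> x))) \<le> 1"
            by (simp add: norm_mult)
        qed
      qed simp
      then show ?thesis by (simp add: tendsto_of_real_iff)
    qed
  qed (use Q Qn g in auto)
  then show ?thesis using Q(5)[OF g] Qn(5)[OF g] by simp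
qed

text \<open>A Gaussian perturbation of small scale \<open>s\<close> changes the integral of
  \<open>f\<close> by at most \<open>e\<close>, uniformly over all probability laws, because
  \<open>f\<close> is bounded and uniformly continuous. This uniformity takes the place of a
  tightness argument, and after the perturbation \<open>gauss_smoothing_tendsto\<close>
  applies.\<close>

theorem levy_continuity_euclidean:
  fixes \<mu> :: "'a::euclidean_space measure" and f :: "'a \<Rightarrow> real"
  assumes \<mu>: "prob_space \<mu>" and \<mu>S [measurable_cong]: "sets \<mu> = sets borel"
    and \<mu>n: "\<And>n. prob_space (\<mu>n n)" and \<mu>nS [measurable_cong]: "\<And>n. sets (\<mu>n n) = sets borel"
    and char: "\<And>t. (\<lambda>n. LINT x|\<mu>n n. iexp (t \<bullet> x)) \<longlonglongrightarrow> (LINT x|\<mu>. iexp (t \<bullet> x))"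
    and f: "uniformly_continuous_on UNIV f" "\<And>x. \<bar>f x\<bar> \<le> B"
  shows "(\<lambda>n. LINT x|\<mu>n n. f x) \<longlonglongrightarrow> (LINT x|\<mu>. f x)"
proof -
  interpret G: prob_space "gauss :: 'a measure" by (rule prob_space_gauss)
  have [measurable]: "f \<in> borel_measurable borel"
    using f(1) by (intro borel_measurable_continuous_onI uniformly_continuous_imp_continuous)
  have ex_pos: "\<exists>k>0. P k" if "eventually P sequentially" for P :: "nat \<Rightarrow> bool"
    using that unfolding eventually_sequentially by (metis le_SucI le_refl zero_less_Suc)
  have B: "0 \<le> B" using f(2)[of 0] by linarith
  have int: "integrable M (\<lambda>x. f x)" if "prob_space M" "sets M = sets borel" for M
    using that f by (intro integrable_bounded_prob[OF that(1), of _ B]) (auto simp: measurable_cong_sets[OF that(2) refl])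
  have approx: "\<exists>s>0. \<forall>M. prob_space M \<longrightarrow> sets M = sets borel \<longrightarrow>
      \<bar>(LINT x|M. LINT y|gauss. f (x + s *\<^sub>R y)) - (LINT x|M. f x)\<bar> \<le> e" if e: "0 < e" for e
  proof -
    obtain d where d: "d > 0" "\<And>x y. dist y x < d \<Longrightarrow> dist (f y) (f x) < e / 2"
      using f(1) e unfolding uniformly_continuous_on_def by (metis UNIV_I half_gt_zero)
    \<comment> \<open>With \<open>s = 1 / k\<close> the displacement \<open>s *\<^sub>R y\<close>
      reaches \<open>d\<close> only if \<open>k * d \<le> norm y\<close>. The Gaussian mass of that
      event, weighted by the largest possible change \<open>2 * B\<close> of \<open>f\<close>, tends
      to 0.\<close>
    have "(\<lambda>k. LINT y|(gauss :: 'a measure). 2 * B * indicator {y. real k * d \<le> norm y} y) \<longlonglongrightarrow> (LINT y|(gauss :: 'a measure). 0)"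
    proof (rule integral_dominated_convergence[where w = "\<lambda>_. 2 * B"])
      show "AE y in (gauss :: 'a measure). (\<lambda>k. 2 * B * indicator {y. real k * d \<le> norm y} y) \<longlonglongrightarrow> 0"
      proof (rule AE_I2)
        fix y :: 'a
        obtain k0 :: nat where k0: "norm y / d < k0" using reals_Archimedean2 by blast
        have "eventually (\<lambda>k. 2 * B * indicator {y. real k * d \<le> norm y} y = 0) sequentially"
          using eventually_ge_at_top[of k0]
        proof eventually_elim
          case (elim k)
          then have "norm y / d < real k" using k0 by linarith
          then show ?case using d(1) by (simp add: field_simps)
        qed
        then show "(\<lambda>k. 2 * B * indicator {y. real k * d \<le> norm y} y) \<longlonglongrightarrow> 0"
          by (rule tendsto_eventually)
      qed
    qed (auto simp: B indicator_def)
    then have "(\<lambda>k. LINT y|(gauss :: 'a measure). 2 * B * indicator {y. real k * d \<le> norm y} y) \<longlonglongrightarrow> 0"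
      by simp
    then have "eventually (\<lambda>k. (LINT y|(gauss :: 'a measure). 2 * B * indicator {y. real k * d \<le> norm y} y) < e / 2) sequentially"
      using e by (intro order_tendstoD) auto
    then obtain k where k: "k > 0" "(LINT y|(gauss :: 'a measure). 2 * B * indicator {y. real k * d \<le> norm y} y) < e / 2"
      using ex_pos by blast
    define s where "s = 1 / real k"
    have pt: "\<bar>f (x + s *\<^sub>R y) - f x\<bar> \<le> e / 2 + 2 * B * indicator {y. real k * d \<le> norm y} y" for x y
    proof (cases "real k * d \<le> norm y")
      case True
      have "\<bar>f (x + s *\<^sub>R y) - f x\<bar> \<le> 2 * B" using f(2)[of x] f(2)[of "x + s *\<^sub>R y"] by linarith
      then show ?thesis using True e by simp
    next
      case False
      then have "dist (x + s *\<^sub>R y) x < d" using k(1) by (simp add: s_def dist_norm field_simps)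
      then show ?thesis using d(2) False by (force simp: dist_real_def)
    qed
    have ig: "integrable gauss (\<lambda>y. f (x + s *\<^sub>R y))" for x
      using f by (intro integrable_bounded_prob[OF prob_space_gauss, of _ B]) auto
    have ind: "integrable (gauss :: 'a measure) (\<lambda>y. 2 * B * indicator {y. real k * d \<le> norm y} y)"
      using B by (intro integrable_bounded_prob[OF prob_space_gauss, of _ "2 * B"]) (auto simp: indicator_def)
    have px: "\<bar>(LINT y|gauss. f (x + s *\<^sub>R y)) - f x\<bar> \<le> e" for x
    proof -
      have "(LINT y|gauss. f (x + s *\<^sub>R y)) - f x = (LINT y|gauss. f (x + s *\<^sub>R y) - f x)"
        using ig by (simp add: G.prob_space)
      also have "\<bar>\<dots>\<bar> \<le> (LINT y|gauss. \<bar>f (x + s *\<^sub>R y) - f x\<bar>)"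
        using integral_norm_bound[of gauss "\<lambda>y. f (x + s *\<^sub>R y) - f x"] by simp
      also have "\<dots> \<le> (LINT y|(gauss::'a measure). e / 2 + 2 * B * indicator {y. real k * d \<le> norm y} y)"
        using ig ind pt by (intro integral_mono) auto
      also have "\<dots> = e / 2 + (LINT y|(gauss :: 'a measure). 2 * B * indicator {y. real k * d \<le> norm y} y)"
        using ind by (subst Bochner_Integration.integral_add) (auto simp: G.prob_space)
      finally show ?thesis using k(2) by simp
    qed
    show ?thesis
    proof (intro exI[of _ s] conjI allI impI)
      show "s > 0" using k by (simp add: s_def)
      fix M :: "'a measure" assume M: "prob_space M" and MS [measurable_cong]: "sets M = sets borel"
      interpret M: prob_space M by fact
      have fB: "\<bar>LINT y|gauss. f (x + s *\<^sub>R y)\<bar> \<le> B + e" for x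
        using px[of x] f(2)[of x] by linarith
      have i: "integrable M (\<lambda>x. LINT y|gauss. f (x + s *\<^sub>R y))"
        using fB by (intro integrable_bounded_prob[OF M, of _ "B + e"]) auto
      have "(LINT x|M. LINT y|gauss. f (x + s *\<^sub>R y)) - (LINT x|M. f x) =
          (LINT x|M. (LINT y|gauss. f (x + s *\<^sub>R y)) - f x)"
        using i int[OF M MS] by simp
      also have "\<bar>\<dots>\<bar> \<le> (LINT x|M. \<bar>(LINT y|gauss. f (x + s *\<^sub>R y)) - f x\<bar>)"
        using integral_norm_bound[of M "\<lambda>x. (LINT y|gauss. f (x + s *\<^sub>R y)) - f x"] by simp
      also have "\<dots> \<le> (LINT x|M. e)"
        using i int[OF M MS] px by (intro integral_mono) auto
      finally show "\<bar>(LINT x|M. LINT y|gauss. f (x + s *\<^sub>R y)) - (LINT x|M. f x)\<bar> \<le> e"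
        by (simp add: M.prob_space)
    qed
  qed
  have scaled: "(\<lambda>n. LINT x|\<mu>n n. LINT y|gauss. f (x + s *\<^sub>R y)) \<longlonglongrightarrow> (LINT x|\<mu>. LINT y|gauss. f (x + s *\<^sub>R y))"
    if s: "0 < s" for s
  proof -
    \<comment> \<open>Dividing the laws by \<open>s\<close> turns \<open>x + s *\<^sub>R y\<close>
      into \<open>s *\<^sub>R (x + y)\<close>, which reduces scale \<open>s\<close> to the standard
      Gaussian.\<close>
    define D where "D M = distr M borel (\<lambda>x::'a. (1 / s) *\<^sub>R x)" for M
    have [simp]: "sets (D M) = sets borel" for M by (simp add: D_def)
    have pD: "prob_space (D M)" if "prob_space M" "sets M = sets borel" for M
      unfolding D_def using that by (intro prob_space.prob_space_distr) (auto simp: measurable_cong_sets[OF that(2) refl])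
    have iD: "(LINT x|D M. h x) = (LINT x|M. h ((1 / s) *\<^sub>R x))"
      if [measurable]: "h \<in> borel_measurable borel" and "sets M = sets borel" for M and h :: "'a \<Rightarrow> 'b::{banach, second_countable_topology}"
      unfolding D_def using that by (intro integral_distr) (auto simp: measurable_cong_sets[OF that(2) refl])
    have "(\<lambda>n. LINT x|D (\<mu>n n). LINT y|gauss. f (s *\<^sub>R (x + y))) \<longlonglongrightarrow> (LINT x|D \<mu>. LINT y|gauss. f (s *\<^sub>R (x + y)))"
    proof (rule gauss_smoothing_tendsto)
      show "(\<lambda>n. LINT x|D (\<mu>n n). iexp (t \<bullet> x)) \<longlonglongrightarrow> (LINT x|D \<mu>. iexp (t \<bullet> x))" for t
      proof -
        have "(LINT x|D M. iexp (t \<bullet> x)) = (LINT x|M. iexp (((1 / s) *\<^sub>R t) \<bullet> x))" if "sets M = sets borel" for M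
          using that by (subst iD) auto
        then show ?thesis using char[of "(1 / s) *\<^sub>R t"] \<mu>S \<mu>nS by simp
      qed
    qed (use pD[OF \<mu> \<mu>S] pD[OF \<mu>n \<mu>nS] f in auto)
    moreover have "(LINT x|D M. LINT y|gauss. f (s *\<^sub>R (x + y))) = (LINT x|M. LINT y|gauss. f (x + s *\<^sub>R y))"
      if "sets M = sets borel" for M
      using that s by (subst iD) (auto simp: scaleR_add_right)
    ultimately show ?thesis using \<mu>S \<mu>nS by simp
  qed
  show ?thesis
  proof (rule LIMSEQ_I)
    fix r :: real assume r: "0 < r"
    then obtain s where s: "s > 0" and ap: "\<And>M. prob_space M \<Longrightarrow> sets M = sets borel \<Longrightarrow>
      \<bar>(LINT x|M. LINT y|gauss. f (x + s *\<^sub>R y)) - (LINT x|M. f x)\<bar> \<le> r / 4"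
      using approx[of "r / 4"] by auto
    obtain N where N: "\<And>n. n \<ge> N \<Longrightarrow>
      norm ((LINT x|\<mu>n n. LINT y|gauss. f (x + s *\<^sub>R y)) - (LINT x|\<mu>. LINT y|gauss. f (x + s *\<^sub>R y))) < r / 4"
      using LIMSEQ_D[OF scaled[OF s], of "r / 4"] r by auto
    show "\<exists>N. \<forall>n\<ge>N. norm ((LINT x|\<mu>n n. f x) - (LINT x|\<mu>. f x)) < r"
    proof (intro exI[of _ N] allI impI)
      fix n assume "n \<ge> N"
      then show "norm ((LINT x|\<mu>n n. f x) - (LINT x|\<mu>. f x)) < r"
        using N[OF \<open>n \<ge> N\<close>] ap[OF \<mu>n[of n] \<mu>nS[of n]] ap[OF \<mu> \<mu>S] r unfolding real_norm_def by linarith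
    qed
  qed
qed

section \<open>Sums of independent identically distributed vectors\<close>

text \<open>Convolving one summand at a time makes induction on \<open>k\<close> the same as
  conditioning on all summands but the last; no underlying probability space has to be
  constructed.\<close>

primrec iid_sum :: "'a::euclidean_space measure \<Rightarrow> 'a \<Rightarrow> nat \<Rightarrow> 'a measure" where
  "iid_sum Q b 0 = return borel b"
| "iid_sum Q b (Suc k) = distr (iid_sum Q b k \<Otimes>\<^sub>M Q) borel (\<lambda>(x, u). x + u)"

lemma sets_iid_sum [simp, measurable_cong]: "sets (iid_sum Q b k) = sets borel"
  by (induction k) auto

lemma space_iid_sum [simp]: "space (iid_sum Q b k) = UNIV"
  using sets_eq_imp_space_eq[OF sets_iid_sum] by simp

lemma prob_space_iid_sum:
  assumes "prob_space Q" and [measurable_cong]: "sets Q = sets borel"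
  shows "prob_space (iid_sum Q b k)"
proof (induction k)
  case 0
  show ?case by (auto intro: prob_space_return)
next
  case (Suc k)
  interpret S: prob_space "iid_sum Q b k" by fact
  interpret Q: prob_space Q by fact
  interpret pair_prob_space "iid_sum Q b k" Q ..
  have "(\<lambda>(x, u). x + u) \<in> borel_measurable (iid_sum Q b k \<Otimes>\<^sub>M Q)" by measurable
  then show ?case by (simp add: prob_space_distr)
qed

lemma nn_integral_iid_sum_Suc:
  assumes "prob_space Q" and [measurable_cong]: "sets Q = sets borel"
    and [measurable]: "f \<in> borel_measurable borel"
  shows "(\<integral>\<^sup>+x. f x \<partial>iid_sum Q b (Suc k)) = (\<integral>\<^sup>+x. \<integral>\<^sup>+u. f (x + u) \<partial>Q \<partial>iid_sum Q b k)"
proof -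
  interpret Q: prob_space Q by fact
  show ?thesis
    by (simp add: nn_integral_distr split_beta' Q.nn_integral_fst[symmetric])
qed

lemma integral_iid_sum_Suc:
  fixes f :: "'a::euclidean_space \<Rightarrow> 'b::{banach, second_countable_topology}"
  assumes Q: "prob_space Q" and [measurable_cong]: "sets Q = sets borel"
    and [measurable]: "f \<in> borel_measurable borel" and B: "\<And>x. norm (f x) \<le> B"
  shows "(LINT x|iid_sum Q b (Suc k). f x) = (LINT x|iid_sum Q b k. LINT u|Q. f (x + u))"
proof -
  interpret Q: prob_space Q by fact
  interpret S: prob_space "iid_sum Q b k" using prob_space_iid_sum assms by blast
  interpret P: pair_prob_space "iid_sum Q b k" Q ..
  have "(LINT x|iid_sum Q b (Suc k). f x) = (LINT p|(iid_sum Q b k \<Otimes>\<^sub>M Q). f (fst p + snd p))"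
    by (simp add: integral_distr split_beta')
  also have "\<dots> = (LINT x|iid_sum Q b k. LINT u|Q. f (x + u))"
    by (subst P.integral_fst'[symmetric])
      (auto intro!: integrable_bounded_prob[of _ _ B] simp: P.prob_space_axioms B)
  finally show ?thesis .
qed

lemma char_iid_sum:
  fixes t :: "'a::euclidean_space"
  assumes "prob_space Q" "sets Q = sets borel"
  shows "(LINT x|iid_sum Q b k. iexp (t \<bullet> x)) = iexp (t \<bullet> b) * (LINT u|Q. iexp (t \<bullet> u)) ^ k"
proof (induction k)
  case 0
  show ?case by (simp add: integral_return)
next
  case (Suc k)
  have "(LINT x|iid_sum Q b (Suc k). iexp (t \<bullet> x)) =
      (LINT x|iid_sum Q b k. LINT u|Q. iexp (t \<bullet> x) * iexp (t \<bullet> u))"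
    by (subst integral_iid_sum_Suc[OF assms, of _ 1])
      (auto simp: inner_add_right distrib_left exp_add)
  also have "\<dots> = (LINT x|iid_sum Q b k. iexp (t \<bullet> x)) * (LINT u|Q. iexp (t \<bullet> u))"
    by simp
  finally show ?case by (simp add: Suc mult_ac)
qed

section \<open>Exponential moments of Lipschitz functions of a sum\<close>

definition exp_rem :: "real \<Rightarrow> real" where
  "exp_rem x = exp x - 1 - x"

lemma exp_rem_nonneg [simp]: "0 \<le> exp_rem x"
  unfolding exp_rem_def using exp_ge_add_one_self[of x] by linarith

lemma exp_rem_0 [simp]: "exp_rem 0 = 0"
  by (simp add: exp_rem_def)

lemma exp_rem_measurable [measurable]: "exp_rem \<in> borel_measurable borel"
  unfolding exp_rem_def[abs_def] by measurable

text \<open>\<open>exp_rem z - exp_rem (- z) = 2 * (sinh z - z)\<close> is nonnegative for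
  \<open>z \<ge> 0\<close>, and \<open>exp_rem\<close> increases on the nonnegative half-line. This
  allows a signed increment of \<open>f\<close> to be replaced by the length of the jump.\<close>

lemma exp_rem_mono_abs:
  assumes "\<bar>x\<bar> \<le> y"
  shows "exp_rem x \<le> exp_rem y"
proof -
  have "exp_rem (- z) \<le> exp_rem z" if "0 \<le> z" for z
  proof -
    have "(\<lambda>x::real. exp x - exp (- x) - 2 * x) 0 \<le> (\<lambda>x. exp x - exp (- x) - 2 * x) z"
    proof (rule DERIV_nonneg_imp_nondecreasing[OF that])
      fix x :: real
      have "0 \<le> (exp (x/2) - exp (- x/2))\<^sup>2" by simp
      also have "\<dots> = exp x + exp (- x) - 2"
        by (simp add: power2_diff flip: exp_double exp_add)
      finally show "\<exists>y. ((\<lambda>x. exp x - exp (- x) - 2 * x) has_real_derivative y) (at x) \<and> 0 \<le> y"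
        by (intro exI[of _ "exp x + exp (- x) - 2"] conjI) (auto intro!: derivative_eq_intros)
    qed
    then show ?thesis by (simp add: exp_rem_def)
  qed
  from this[of "- x"] have "exp_rem x \<le> exp_rem \<bar>x\<bar>" by (cases "0 \<le> x") auto
  also have "exp_rem \<bar>x\<bar> \<le> exp_rem y"
  proof -
    have "y - \<bar>x\<bar> \<le> exp (y - \<bar>x\<bar>) - 1"
      using exp_ge_add_one_self[of "y - \<bar>x\<bar>"] by linarith
    then have "1 * (y - \<bar>x\<bar>) \<le> exp \<bar>x\<bar> * (exp (y - \<bar>x\<bar>) - 1)"
      using assms by (intro mult_mono) auto
    also have "\<dots> = exp y - exp \<bar>x\<bar>" by (simp add: algebra_simps flip: exp_add)
    finally show ?thesis by (simp add: exp_rem_def)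
  qed
  finally show ?thesis .
qed

text \<open>Subtracting the value of \<open>g\<close> at the base point, rather than its mean, is what makes the
  exponent linear in the law of the jump.\<close>
lemma mgf_shift_le:
  fixes g :: "'a::euclidean_space \<Rightarrow> real"
  assumes Q: "prob_space Q" and [measurable_cong]: "sets Q = sets borel"
    and [measurable]: "g \<in> borel_measurable borel" and B: "\<And>x. \<bar>g x\<bar> \<le> B"
    and lip: "\<And>x y. \<bar>g x - g y\<bar> \<le> norm (x - y)"
    and s: "0 \<le> s" and \<psi>: "(\<integral>\<^sup>+u. ennreal (exp_rem (s * norm u)) \<partial>Q) \<le> ennreal \<psi>" "0 \<le> \<psi>"
  shows "(LINT u|Q. exp (s * g (x + u))) \<le> exp (s * (LINT u|Q. g (x + u)) + \<psi>)"
proof -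
  interpret Q: prob_space Q by fact
  define D where "D u = g (x + u) - g x" for u
  have [measurable]: "D \<in> borel_measurable borel" unfolding D_def by measurable
  have DB: "\<bar>D u\<bar> \<le> 2 * B" for u using B[of x] B[of "x + u"] by (simp add: D_def)
  have Dn: "\<bar>D u\<bar> \<le> norm u" for u using lip[of "x + u" x] by (simp add: D_def)
  have iD: "integrable Q D" using DB by (intro integrable_bounded_prob[OF Q, of _ "2 * B"]) auto
  have "exp (s * D u) \<le> exp (s * (2 * B))" for u
    using DB[of u] s by (auto intro!: mult_left_mono)
  then have ie: "integrable Q (\<lambda>u. exp (s * D u))"
    by (intro integrable_bounded_prob[OF Q, of _ "exp (s * (2 * B))"]) auto
  have "\<bar>g (x + u)\<bar> \<le> B" for u by (rule B)
  then have ig: "integrable Q (\<lambda>u. g (x + u))"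
    by (intro integrable_bounded_prob[OF Q, of _ B]) auto
  have ir: "integrable Q (\<lambda>u. exp_rem (s * D u))"
    using iD ie by (simp add: exp_rem_def)
  have "ennreal (LINT u|Q. exp_rem (s * D u)) = (\<integral>\<^sup>+u. ennreal (exp_rem (s * D u)) \<partial>Q)"
    using ir by (intro nn_integral_eq_integral[symmetric]) auto
  also have "\<dots> \<le> (\<integral>\<^sup>+u. ennreal (exp_rem (s * norm u)) \<partial>Q)"
    using Dn s by (intro nn_integral_mono ennreal_leI exp_rem_mono_abs) (auto simp: abs_mult intro!: mult_left_mono)
  also note \<psi>(1)
  finally have r: "(LINT u|Q. exp_rem (s * D u)) \<le> \<psi>"
    using \<psi>(2) by (simp add: ennreal_le_iff)
  have "(LINT u|Q. exp (s * g (x + u))) = (LINT u|Q. exp (s * g x) * exp (s * D u))"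
    by (simp add: D_def algebra_simps flip: exp_add)
  also have "\<dots> = exp (s * g x) * (LINT u|Q. exp_rem (s * D u) + 1 + s * D u)"
    by (simp add: exp_rem_def)
  also have "(LINT u|Q. exp_rem (s * D u) + 1 + s * D u) = (LINT u|Q. exp_rem (s * D u)) + 1 + s * (LINT u|Q. D u)"
    using ir iD by (simp add: Q.prob_space)
  \<comment> \<open>By \<open>1 + x \<le> exp x\<close>, once the mean of the remainder has been
    replaced by \<open>\<psi>\<close>.\<close>
  also have "exp (s * g x) * \<dots> \<le> exp (s * g x) * exp (\<psi> + s * (LINT u|Q. D u))"
  proof (rule mult_left_mono)
    show "(LINT u|Q. exp_rem (s * D u)) + 1 + s * (LINT u|Q. D u) \<le> exp (\<psi> + s * (LINT u|Q. D u))"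
      using r exp_ge_add_one_self[of "\<psi> + s * (LINT u|Q. D u)"] by linarith
  qed simp
  also have "\<dots> = exp (s * (LINT u|Q. g (x + u)) + \<psi>)"
    using ig by (simp add: D_def Q.prob_space algebra_simps flip: exp_add)
  finally show ?thesis .
qed

text \<open>Averaging out the last summand replaces \<open>g\<close> by \<open>G\<close>, which is
  again bounded by \<open>B\<close> and 1-Lipschitz, has under the shorter sum the mean that
  \<open>g\<close> has under the longer one, and costs a factor \<open>exp \<psi>\<close>. Hence
  \<open>g\<close> must vary in the induction.\<close>

lemma mgf_iid_sum_le:
  fixes g :: "'a::euclidean_space \<Rightarrow> real"
  assumes Q: "prob_space Q" and QS [measurable_cong]: "sets Q = sets borel"
    and g: "\<And>x. \<bar>g x\<bar> \<le> B" "\<And>x y. \<bar>g x - g y\<bar> \<le> norm (x - y)"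
    and s: "0 \<le> s" and \<psi>: "(\<integral>\<^sup>+u. ennreal (exp_rem (s * norm u)) \<partial>Q) \<le> ennreal \<psi>" "0 \<le> \<psi>"
  shows "(LINT x|iid_sum Q b k. exp (s * g x)) \<le> exp (s * (LINT x|iid_sum Q b k. g x) + real k * \<psi>)"
  using g
proof (induction k arbitrary: g)
  case 0
  have [measurable]: "g \<in> borel_measurable borel"
    using "0.prems"(2) by (intro borel_measurable_continuous_onI lipschitz_on_continuous_on[of 1] lipschitz_onI)
      (auto simp: dist_norm)
  show ?case by (simp add: integral_return)
next
  case (Suc k)
  interpret Q: prob_space Q by fact
  interpret S: prob_space "iid_sum Q b k" using prob_space_iid_sum[OF Q QS] .
  note B = Suc.prems(1) and lip = Suc.prems(2)
  have gm [measurable]: "g \<in> borel_measurable borel"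
    using lip by (intro borel_measurable_continuous_onI lipschitz_on_continuous_on[of 1] lipschitz_onI)
      (auto simp: dist_norm)
  have B0: "0 \<le> B" using B[of 0] by linarith
  have ig: "integrable Q (\<lambda>u. g (x + u))" for x
    using B by (intro integrable_bounded_prob[OF Q, of _ B]) auto
  define G where "G x = (LINT u|Q. g (x + u))" for x
  have GB: "\<bar>G x\<bar> \<le> B" for x
  proof -
    have "\<bar>G x\<bar> \<le> (LINT u|Q. \<bar>g (x + u)\<bar>)"
      using integral_norm_bound[of Q "\<lambda>u. g (x + u)"] by (simp add: G_def)
    also have "\<dots> \<le> (LINT u|Q. B)" using ig B by (intro integral_mono) auto
    finally show ?thesis by (simp add: Q.prob_space)
  qed
  have Glip: "\<bar>G x - G y\<bar> \<le> norm (x - y)" for x y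
  proof -
    have "G x - G y = (LINT u|Q. g (x + u) - g (y + u))" using ig by (simp add: G_def)
    also have "\<bar>\<dots>\<bar> \<le> (LINT u|Q. \<bar>g (x + u) - g (y + u)\<bar>)"
      using integral_norm_bound[of Q "\<lambda>u. g (x + u) - g (y + u)"] by simp
    also have "\<dots> \<le> (LINT u|Q. norm (x - y))"
    proof (rule integral_mono)
      show "\<bar>g (x + u) - g (y + u)\<bar> \<le> norm (x - y)" for u
        using lip[of "x + u" "y + u"] by simp
    qed (use ig in auto)
    finally show ?thesis by (simp add: Q.prob_space)
  qed
  have [measurable]: "G \<in> borel_measurable borel"
    using Glip by (intro borel_measurable_continuous_onI lipschitz_on_continuous_on[of 1] lipschitz_onI)
      (auto simp: dist_norm)
  have eB: "exp (s * g x) \<le> exp (s * B)" for x using B[of x] s by (auto intro!: mult_left_mono)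
  have eG: "exp (s * G x) \<le> exp (s * B)" for x using GB[of x] s by (auto intro!: mult_left_mono)
  have ieG: "integrable (iid_sum Q b k) (\<lambda>x. exp (s * G x))"
    using eG by (intro integrable_bounded_prob[OF S.prob_space_axioms, of _ "exp (s * B)"]) auto
  have shift: "(LINT u|Q. exp (s * g (x + u))) \<le> exp \<psi> * exp (s * G x)" for x
    using mgf_shift_le[OF Q QS gm B lip s \<psi>, of x] by (simp add: G_def exp_add mult.commute)
  have "(LINT x|iid_sum Q b (Suc k). exp (s * g x)) = (LINT x|iid_sum Q b k. LINT u|Q. exp (s * g (x + u)))"
    using eB by (intro integral_iid_sum_Suc[OF Q QS, of _ "exp (s * B)"]) auto
  also have "\<dots> \<le> (LINT x|iid_sum Q b k. exp \<psi> * exp (s * G x))"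
  proof (rule integral_mono)
    have "norm (LINT u|Q. exp (s * g (x + u))) \<le> exp \<psi> * exp (s * B)" for x
    proof -
      have "0 \<le> (LINT u|Q. exp (s * g (x + u)))" by (intro integral_nonneg_AE) auto
      then have "norm (LINT u|Q. exp (s * g (x + u))) \<le> exp \<psi> * exp (s * G x)" using shift[of x] by simp
      also have "\<dots> \<le> exp \<psi> * exp (s * B)" using eG by (intro mult_left_mono) auto
      finally show ?thesis .
    qed
    then show "integrable (iid_sum Q b k) (\<lambda>x. LINT u|Q. exp (s * g (x + u)))"
      by (intro integrable_bounded_prob[OF S.prob_space_axioms, of _ "exp \<psi> * exp (s * B)"]) auto
  qed (use ieG shift in auto)
  also have "\<dots> \<le> exp \<psi> * exp (s * (LINT x|iid_sum Q b k. G x) + real k * \<psi>)"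
    using Suc.IH[OF GB Glip] by simp
  also have "(LINT x|iid_sum Q b k. G x) = (LINT x|iid_sum Q b (Suc k). g x)"
    unfolding G_def using B by (intro integral_iid_sum_Suc[OF Q QS, of _ B, symmetric]) auto
  finally show ?case by (simp add: algebra_simps flip: exp_add)
qed

section \<open>Discarding long jumps\<close>

definition truncate :: "real \<Rightarrow> 'a::euclidean_space \<Rightarrow> 'a" where
  "truncate R u = (if norm u \<le> R then u else 0)"

lemma truncate_measurable [measurable]: "truncate R \<in> borel_measurable borel"
  unfolding truncate_def[abs_def] by measurable

text \<open>A union bound, one summand per induction step: truncation changes a summand only when it
  is longer than \<open>R\<close>, and then \<open>f\<close> loses at most 1.\<close>

lemma nn_integral_iid_sum_truncate:
  assumes Q: "prob_space Q" and QS [measurable_cong]: "sets Q = sets borel"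
    and "f \<in> borel_measurable borel" "\<And>x. f x \<le> 1"
  shows "(\<integral>\<^sup>+x. f x \<partial>iid_sum Q b k) \<le>
    (\<integral>\<^sup>+x. f x \<partial>iid_sum (distr Q borel (truncate R)) b k) + of_nat k * emeasure Q {u. R < norm u}"
  using assms(3,4)
proof (induction k arbitrary: f)
  case (Suc k)
  note [measurable] = Suc.prems(1)
  define Q' where "Q' = distr Q borel (truncate R)"
  have [simp, measurable_cong]: "sets Q' = sets borel" by (simp add: Q'_def)
  have tm: "truncate R \<in> borel_measurable Q" by measurable
  interpret Q: prob_space Q by fact
  have Q': "prob_space Q'" unfolding Q'_def by (rule Q.prob_space_distr[OF tm])
  interpret Q': prob_space Q' by fact
  interpret S': prob_space "iid_sum Q' b k" by (rule prob_space_iid_sum[OF Q']) simp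
  define q where "q = emeasure Q {u. R < norm u}"
  define F where "F x = (\<integral>\<^sup>+u. f (x + u) \<partial>Q)" for x
  have [measurable]: "F \<in> borel_measurable borel" unfolding F_def by measurable
  have F1: "F x \<le> 1" for x
  proof -
    have "F x \<le> (\<integral>\<^sup>+u. 1 \<partial>Q)" unfolding F_def using Suc.prems(2) by (intro nn_integral_mono) auto
    then show ?thesis by (simp add: Q.emeasure_space_1)
  qed
  have Fle: "F x \<le> (\<integral>\<^sup>+u. f (x + u) \<partial>Q') + q" for x
  proof -
    have "F x \<le> (\<integral>\<^sup>+u. f (x + truncate R u) + indicator {u. R < norm u} u \<partial>Q)"
      unfolding F_def using Suc.prems(2)
      by (intro nn_integral_mono)
        (auto simp: truncate_def indicator_def intro: add_increasing)
    also have "\<dots> = (\<integral>\<^sup>+u. f (x + truncate R u) \<partial>Q) + q"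
      by (subst nn_integral_add) (auto simp: q_def)
    also have "(\<integral>\<^sup>+u. f (x + truncate R u) \<partial>Q) = (\<integral>\<^sup>+u. f (x + u) \<partial>Q')"
      unfolding Q'_def by (subst nn_integral_distr[OF tm]) auto
    finally show ?thesis .
  qed
  have "(\<integral>\<^sup>+x. f x \<partial>iid_sum Q b (Suc k)) = (\<integral>\<^sup>+x. F x \<partial>iid_sum Q b k)"
    unfolding F_def by (rule nn_integral_iid_sum_Suc[OF Q QS]) measurable
  also have "\<dots> \<le> (\<integral>\<^sup>+x. F x \<partial>iid_sum Q' b k) + of_nat k * q"
    unfolding Q'_def q_def by (rule Suc.IH) (use F1 in auto)
  also have "(\<integral>\<^sup>+x. F x \<partial>iid_sum Q' b k) \<le> (\<integral>\<^sup>+x. (\<integral>\<^sup>+u. f (x + u) \<partial>Q') + q \<partial>iid_sum Q' b k)"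
    by (intro nn_integral_mono Fle)
  also have "\<dots> = (\<integral>\<^sup>+x. \<integral>\<^sup>+u. f (x + u) \<partial>Q' \<partial>iid_sum Q' b k) + q"
    using S'.emeasure_space_1 by (subst nn_integral_add) auto
  also have "(\<integral>\<^sup>+x. \<integral>\<^sup>+u. f (x + u) \<partial>Q' \<partial>iid_sum Q' b k) = (\<integral>\<^sup>+x. f x \<partial>iid_sum Q' b (Suc k))"
    by (rule nn_integral_iid_sum_Suc[OF Q', symmetric]) auto
  finally show ?case
    unfolding Q'_def[symmetric] q_def[symmetric]
    by (simp add: distrib_right add_ac del: iid_sum.simps)
qed simp

text \<open>A binomial number of jumps in place of a Poisson one: the sum of \<open>m\<close>
  independent draws approximates the compound Poisson law with jump measure
  \<open>\<rho>\<close>.\<close>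

definition thin :: "'a::euclidean_space measure \<Rightarrow> nat \<Rightarrow> 'a measure" where
  "thin \<rho> m = measure_pmf (bernoulli_pmf (measure \<rho> UNIV / m)) \<bind>
     (\<lambda>c. if c then scale_measure (ennreal (1 / measure \<rho> UNIV)) \<rho> else return borel 0)"

context
  fixes \<rho> :: "'a::euclidean_space measure" and m :: nat
  assumes \<rho>: "finite_measure \<rho>" and \<rho>S: "sets \<rho> = sets borel"
    and pos: "0 < measure \<rho> UNIV" and le: "measure \<rho> UNIV \<le> real m"
begin

lemma thin_kernel:
  "(\<lambda>c. if c then scale_measure (ennreal (1 / measure \<rho> UNIV)) \<rho> else return borel 0)
    \<in> measure_pmf p \<rightarrow>\<^sub>M subprob_algebra (borel :: 'a measure)"
proof -
  interpret finite_measure \<rho> by (rule \<rho>)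
  have sp: "space \<rho> = UNIV" using sets_eq_imp_space_eq[OF \<rho>S] by simp
  have "prob_space (scale_measure (ennreal (1 / measure \<rho> UNIV)) \<rho>)"
  proof
    show "emeasure (scale_measure (ennreal (1 / measure \<rho> UNIV)) \<rho>)
        (space (scale_measure (ennreal (1 / measure \<rho> UNIV)) \<rho>)) = 1"
      using pos by (simp add: space_scale_measure sp emeasure_eq_measure flip: ennreal_mult)
  qed
  moreover have "prob_space (return borel (0::'a))" by (rule prob_space_return) simp
  ultimately show ?thesis
    by (auto simp: space_subprob_algebra \<rho>S intro: prob_space_imp_subprob_space split: if_splits)
qed

lemma sets_thin [simp, measurable_cong]: "sets (thin \<rho> m) = sets borel"
  unfolding thin_def by (subst sets_bind) (auto simp: \<rho>S)

text \<open>For \<open>f 0 = 0\<close> only the first term survives, so \<open>m\<close> times the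
  integral is exactly the one against \<open>\<rho>\<close>. This is why the exponents do not depend
  on \<open>m\<close>.\<close>

lemma nn_integral_thin:
  assumes [measurable]: "f \<in> borel_measurable borel"
  shows "(\<integral>\<^sup>+u. f u \<partial>thin \<rho> m) = ennreal (1 / m) * (\<integral>\<^sup>+u. f u \<partial>\<rho>) + ennreal (1 - measure \<rho> UNIV / m) * f 0"
proof -
  have m: "0 < real m" using pos le by linarith
  have p: "0 \<le> measure \<rho> UNIV / m" "measure \<rho> UNIV / m \<le> 1" using pos le m by auto
  have f\<rho>: "f \<in> borel_measurable \<rho>" using assms by (simp add: measurable_cong_sets[OF \<rho>S refl])
  have "(\<integral>\<^sup>+u. f u \<partial>thin \<rho> m) = (\<integral>\<^sup>+c. (\<integral>\<^sup>+u. f u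
     \<partial>(if c then scale_measure (ennreal (1 / measure \<rho> UNIV)) \<rho> else return borel 0))
      \<partial>bernoulli_pmf (measure \<rho> UNIV / m))"
    unfolding thin_def by (rule nn_integral_bind[OF assms thin_kernel])
  also have "\<dots> = (\<Sum>c\<in>UNIV. (\<integral>\<^sup>+u. f u
     \<partial>(if c then scale_measure (ennreal (1 / measure \<rho> UNIV)) \<rho> else return borel 0)) *
      ennreal (pmf (bernoulli_pmf (measure \<rho> UNIV / m)) c))"
    by (rule nn_integral_measure_pmf_support) auto
  also have "\<dots> = ennreal (1 / measure \<rho> UNIV) * (\<integral>\<^sup>+u. f u \<partial>\<rho>) * ennreal (measure \<rho> UNIV / m) +
      f 0 * ennreal (1 - measure \<rho> UNIV / m)"
    using p f\<rho> by (simp add: UNIV_bool nn_integral_scale_measure nn_integral_return add.commute)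
  also have "ennreal (1 / measure \<rho> UNIV) * (\<integral>\<^sup>+u. f u \<partial>\<rho>) * ennreal (measure \<rho> UNIV / m) =
      (ennreal (1 / measure \<rho> UNIV) * ennreal (measure \<rho> UNIV / m)) * (\<integral>\<^sup>+u. f u \<partial>\<rho>)"
    by (simp add: mult_ac)
  also have "ennreal (1 / measure \<rho> UNIV) * ennreal (measure \<rho> UNIV / m) = ennreal (1 / m)"
    using pos m by (subst ennreal_mult[symmetric]) auto
  finally show ?thesis by (simp add: mult.commute)
qed

lemma prob_space_thin: "prob_space (thin \<rho> m)"
proof
  interpret finite_measure \<rho> by (rule \<rho>)
  have m: "0 < real m" using pos le by linarith
  have sp: "space \<rho> = UNIV" "space (thin \<rho> m) = UNIV"
    using sets_eq_imp_space_eq[OF \<rho>S] sets_eq_imp_space_eq[OF sets_thin] by auto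
  have "emeasure (thin \<rho> m) UNIV = (\<integral>\<^sup>+u. 1 \<partial>thin \<rho> m)" by (simp add: sp)
  also have "\<dots> = ennreal (1 / m) * ennreal (measure \<rho> UNIV) + ennreal (1 - measure \<rho> UNIV / m)"
    by (subst nn_integral_thin) (auto simp: sp emeasure_eq_measure)
  also have "\<dots> = ennreal (1 / m * measure \<rho> UNIV + (1 - measure \<rho> UNIV / m))"
    using m le by (subst ennreal_plus) (auto simp: ennreal_mult[symmetric])
  finally show "emeasure (thin \<rho> m) (space (thin \<rho> m)) = 1" by (simp add: sp)
qed

lemma integral_thin:
  fixes f :: "'a \<Rightarrow> real"
  assumes [measurable]: "f \<in> borel_measurable borel" and B: "\<And>x. \<bar>f x\<bar> \<le> B"
  shows "(LINT u|thin \<rho> m. f u) = f 0 + (LINT u|\<rho>. f u - f 0) / m"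
proof -
  interpret finite_measure \<rho> by (rule \<rho>)
  interpret T: prob_space "thin \<rho> m" by (rule prob_space_thin)
  note [measurable_cong] = \<rho>S
  have m: "0 < real m" using pos le by linarith
  have sp: "space \<rho> = UNIV" using sets_eq_imp_space_eq[OF \<rho>S] by simp
  have l: "measure \<rho> UNIV / m \<le> 1" using le m by simp
  have B0: "0 \<le> B" using B[of 0] by linarith
  define g where "g x = f x + B" for x
  have g: "0 \<le> g x" "g x \<le> 2 * B" for x using B[of x] by (auto simp: g_def)
  have [measurable]: "g \<in> borel_measurable borel" unfolding g_def by measurable
  have fB: "\<bar>f x\<bar> \<le> 2 * B" for x using B[of x] B0 by linarith
  have ifT: "integrable (thin \<rho> m) f" and igT: "integrable (thin \<rho> m) g"
    using fB g by (auto intro!: integrable_bounded_prob[OF T.prob_space_axioms, of _ "2 * B"])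
  have if\<rho>: "integrable \<rho> f" and ig\<rho>: "integrable \<rho> g"
    using fB g by (auto intro!: integrable_const_bound[of _ "2 * B"])
  have "ennreal (LINT u|thin \<rho> m. g u) = (\<integral>\<^sup>+u. ennreal (g u) \<partial>thin \<rho> m)"
    using igT g by (intro nn_integral_eq_integral[symmetric]) auto
  also have "\<dots> = ennreal (1 / m) * (\<integral>\<^sup>+u. ennreal (g u) \<partial>\<rho>) + ennreal (1 - measure \<rho> UNIV / m) * ennreal (g 0)"
    by (rule nn_integral_thin) measurable
  also have "(\<integral>\<^sup>+u. ennreal (g u) \<partial>\<rho>) = ennreal (LINT u|\<rho>. g u)"
    using ig\<rho> g by (intro nn_integral_eq_integral) auto
  also have "ennreal (1 / m) * ennreal (LINT u|\<rho>. g u) + ennreal (1 - measure \<rho> UNIV / m) * ennreal (g 0) =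
      ennreal (1 / m * (LINT u|\<rho>. g u) + (1 - measure \<rho> UNIV / m) * g 0)"
  proof -
    have "0 \<le> (LINT u|\<rho>. g u)" using g by (intro integral_nonneg_AE) auto
    then show ?thesis
      using g l m by (subst ennreal_plus) (auto simp: ennreal_mult[symmetric])
  qed
  finally have "(LINT u|thin \<rho> m. g u) = 1 / m * (LINT u|\<rho>. g u) + (1 - measure \<rho> UNIV / m) * g 0"
    using g l m by (subst (asm) ennreal_inj) (auto intro!: integral_nonneg_AE add_nonneg_nonneg)
  moreover have "(LINT u|thin \<rho> m. g u) = (LINT u|thin \<rho> m. f u) + B"
    using ifT T.prob_space by (simp add: g_def)
  moreover have "(LINT u|\<rho>. g u) = (LINT u|\<rho>. f u) + measure \<rho> UNIV * B"
    using if\<rho> by (simp add: g_def sp)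
  moreover have "(LINT u|\<rho>. f u - f 0) = (LINT u|\<rho>. f u) - measure \<rho> UNIV * f 0"
    using if\<rho> by (simp add: sp)
  ultimately show ?thesis
    using m by (simp add: g_def field_simps)
qed

lemma char_thin: "(LINT u|thin \<rho> m. iexp (t \<bullet> u)) = 1 + (LINT u|\<rho>. iexp (t \<bullet> u) - 1) / m"
proof -
  interpret finite_measure \<rho> by (rule \<rho>)
  note [measurable_cong] = \<rho>S
  interpret T: prob_space "thin \<rho> m" by (rule prob_space_thin)
  have iT: "integrable (thin \<rho> m) (\<lambda>u. iexp (t \<bullet> u))"
    by (rule integrable_bounded_prob[OF T.prob_space_axioms, of _ 1]) auto
  have i\<rho>: "integrable \<rho> (\<lambda>u. iexp (t \<bullet> u) - 1)"
    by (rule integrable_const_bound[of _ 2]) (auto intro!: order_trans[OF norm_triangle_ineq4])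
  show ?thesis
  proof (rule complex_eqI)
    have "Re (LINT u|thin \<rho> m. iexp (t \<bullet> u)) = (LINT u|thin \<rho> m. cos (t \<bullet> u))"
      by (subst integral_Re[OF iT, symmetric]) (simp add: Re_exp)
    also have "\<dots> = 1 + (LINT u|\<rho>. cos (t \<bullet> u) - 1) / m"
      by (subst integral_thin[of _ 1]) auto
    also have "(LINT u|\<rho>. cos (t \<bullet> u) - 1) = Re (LINT u|\<rho>. iexp (t \<bullet> u) - 1)"
      by (subst integral_Re[OF i\<rho>, symmetric]) (simp add: Re_exp)
    finally show "Re (LINT u|thin \<rho> m. iexp (t \<bullet> u)) = Re (1 + (LINT u|\<rho>. iexp (t \<bullet> u) - 1) / m)"
      by simp
    have "Im (LINT u|thin \<rho> m. iexp (t \<bullet> u)) = (LINT u|thin \<rho> m. sin (t \<bullet> u))"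
      by (subst integral_Im[OF iT, symmetric]) (simp add: Im_exp)
    also have "\<dots> = (LINT u|\<rho>. sin (t \<bullet> u)) / m"
      by (subst integral_thin[of _ 1]) auto
    also have "(LINT u|\<rho>. sin (t \<bullet> u)) = Im (LINT u|\<rho>. iexp (t \<bullet> u) - 1)"
      by (subst integral_Im[OF i\<rho>, symmetric]) (simp add: Im_exp)
    finally show "Im (LINT u|thin \<rho> m. iexp (t \<bullet> u)) = Im (1 + (LINT u|\<rho>. iexp (t \<bullet> u) - 1) / m)"
      by simp
  qed
qed

end

section \<open>Approximation of infinitely divisible laws\<close>

text \<open>Second-order Taylor on the unit ball, where the compensator is present, and the trivial
  bound 2 outside. The right-hand side is integrable for a \<open>levy_measure\<close>, so it serves
  as dominating function.\<close>

lemma norm_iexp_compensated_le: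
  fixes t u :: "'a::euclidean_space"
  shows "norm (iexp (t \<bullet> u) - 1 - \<i> * complex_of_real (t \<bullet> u * indicator (cball 0 1) u))
    \<le> (2 + (norm t)\<^sup>2) * min 1 ((norm u)\<^sup>2)"
proof (cases "norm u \<le> 1")
  case True
  have "norm (iexp (t \<bullet> u) - (\<Sum>k\<le>1. (\<i> * complex_of_real (t \<bullet> u)) ^ k / fact k)) \<le> \<bar>t \<bullet> u\<bar>\<^sup>2 / 2"
    using iexp_approx1[of "t \<bullet> u" 1] by (simp add: numeral_2_eq_2)
  also have "iexp (t \<bullet> u) - (\<Sum>k\<le>1. (\<i> * complex_of_real (t \<bullet> u)) ^ k / fact k) =
      iexp (t \<bullet> u) - 1 - \<i> * complex_of_real (t \<bullet> u * indicator (cball 0 1) u)"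
    using True by simp
  also have "\<bar>t \<bullet> u\<bar>\<^sup>2 / 2 \<le> (norm t)\<^sup>2 * (norm u)\<^sup>2"
  proof -
    have "\<bar>t \<bullet> u\<bar>\<^sup>2 \<le> (norm t * norm u)\<^sup>2" by (intro power_mono Cauchy_Schwarz_ineq2) simp
    moreover have "0 \<le> (norm t)\<^sup>2 * (norm u)\<^sup>2" by simp
    ultimately show ?thesis unfolding power_mult_distrib by linarith
  qed
  also have "\<dots> \<le> (2 + (norm t)\<^sup>2) * (norm u)\<^sup>2" by (simp add: distrib_right)
  also have "(norm u)\<^sup>2 = min 1 ((norm u)\<^sup>2)" using True by (simp add: power_le_one min_absorb2)
  finally show ?thesis .
next
  case False
  then have "1 \<le> (norm u)\<^sup>2" by (simp add: one_le_power)
  moreover have "norm (iexp (t \<bullet> u) - 1) \<le> 2"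
    by (rule order_trans[OF norm_triangle_ineq4]) simp
  ultimately show ?thesis using False by (simp add: min_absorb1) (smt (verit) zero_le_power2)
qed

text \<open>For \<open>a\<close>, \<open>b\<close> in the closed unit disc the \<open>m\<close>-th
  powers differ by at most \<open>m * norm (a - b)\<close>; here \<open>a = 1 + w\<close> and
  \<open>b = exp w\<close> differ to second order in \<open>w = z / m\<close>. The condition
  \<open>l \<le> m\<close> keeps \<open>w\<close> bounded, whence the factor
  \<open>exp 2\<close>.\<close>

lemma binomial_exp_error:
  fixes z :: complex
  assumes m: "0 < m" and z: "norm (1 + z / of_nat m) \<le> 1" "Re z \<le> 0"
    and l: "norm z \<le> 2 * l" "l \<le> real m"
  shows "norm ((1 + z / of_nat m) ^ m - exp z) \<le> 4 * exp 2 * l\<^sup>2 / real m"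
proof -
  define w where "w = z / of_nat m"
  have m': "0 < real m" using m by simp
  have nw: "norm w \<le> 2 * l / m" "norm w = norm z / m" using l m' by (auto simp: w_def norm_divide divide_right_mono)
  have "norm w \<le> 2" using l m' by (simp add: nw(2) divide_le_eq)
  then have "\<bar>Re w\<bar> \<le> 2" using abs_Re_le_cmod[of w] by linarith
  have "exp z = exp w ^ m" using m by (simp add: w_def flip: exp_of_nat_mult)
  then have "norm ((1 + w) ^ m - exp z) \<le> m * norm ((1 + w) - exp w)"
    using z m' by (auto intro!: norm_power_diff simp: w_def divide_nonpos_pos Re_divide_of_nat)
  also have "norm ((1 + w) - exp w) = norm (exp w - (\<Sum>k\<le>1. w ^ k / fact k))"
    by (simp add: norm_minus_commute algebra_simps)
  also have "\<dots> \<le> exp \<bar>Re w\<bar> * norm w ^ Suc 1 / fact 1" by (rule Taylor_exp)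
  also have "\<dots> \<le> exp 2 * (2 * l / m)\<^sup>2"
    using \<open>\<bar>Re w\<bar> \<le> 2\<close> nw by (auto simp: numeral_2_eq_2[symmetric] intro!: mult_mono power_mono)
  also have "m * (exp 2 * (2 * l / m)\<^sup>2) = 4 * exp 2 * l\<^sup>2 / real m"
    using m' by (simp add: power2_eq_square field_simps)
  finally show ?thesis by (simp add: w_def mult_left_mono)
qed

text \<open>The cut-off \<open>eps n\<close> and the number of summands \<open>m n\<close> are
  coupled along one sequence: \<open>m n\<close> is so large, compared with the mass
  \<open>l n\<close> of the jumps kept, that the binomial error vanishes. The comparison with
  \<open>\<nu>\<close> holds at every \<open>n\<close>, so bounds derived from it are
  uniform.\<close>

lemma has_ID_law_approx:
  fixes \<mu> \<nu> :: "'a::euclidean_space measure"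
  assumes \<mu>: "prob_space \<mu>" "sets \<mu> = sets borel" and ID: "has_ID_law \<mu> \<beta> \<nu>"
  obtains Q m b where
    "\<forall>n::nat. prob_space (Q n) \<and> sets (Q n) = sets borel \<and> 0 < m n"
    "\<forall>n f. f \<in> borel_measurable borel \<and> f 0 = 0 \<longrightarrow>
      of_nat (m n) * (\<integral>\<^sup>+u. f u \<partial>Q n) \<le> (\<integral>\<^sup>+u. f u \<partial>\<nu>)"
    "\<forall>f B. uniformly_continuous_on UNIV f \<and> (\<forall>x. \<bar>f x\<bar> \<le> B) \<longrightarrow>
      (\<lambda>n. LINT x|iid_sum (Q n) (b n) (m n). f x) \<longlonglongrightarrow> (LINT x|\<mu>. f x :: real)"
proof -
  have \<nu>S [measurable_cong]: "sets \<nu> = sets borel" and \<nu>0: "emeasure \<nu> UNIV \<noteq> 0" "emeasure \<nu> {0} = 0"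
    and \<nu>fin: "(\<integral>\<^sup>+u. ennreal (min 1 ((norm u)\<^sup>2)) \<partial>\<nu>) < \<infinity>"
    and char: "\<And>t. (LINT x|\<mu>. iexp (t \<bullet> x)) =
        exp (\<i> * complex_of_real (t \<bullet> \<beta>) +
          (LINT u|\<nu>. iexp (t \<bullet> u) - 1 - \<i> * complex_of_real (t \<bullet> u * indicator (cball 0 1) u)))"
    using ID by (auto simp: has_ID_law_def levy_measure_def)
  have sp\<nu>: "space \<nu> = UNIV" using sets_eq_imp_space_eq[OF \<nu>S] by simp
  have imin: "integrable \<nu> (\<lambda>u. min 1 ((norm u)\<^sup>2))"
    using \<nu>fin by (intro integrableI_bounded) auto
  have fin: "emeasure \<nu> {u. e \<le> norm u} < \<infinity>" if "0 < e" for e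
  proof -
    define c where "c = min 1 (e\<^sup>2)"
    have c: "0 < c" using that by (simp add: c_def)
    have "ennreal c * emeasure \<nu> {u. e \<le> norm u} = (\<integral>\<^sup>+u. ennreal c * indicator {u. e \<le> norm u} u \<partial>\<nu>)"
      by (simp add: nn_integral_cmult)
    also have "\<dots> \<le> (\<integral>\<^sup>+u. ennreal (min 1 ((norm u)\<^sup>2)) \<partial>\<nu>)"
      using that by (intro nn_integral_mono) (auto simp: c_def indicator_def intro!: ennreal_leI min.coboundedI2 power_mono)
    also note \<nu>fin
    finally show ?thesis using c by (auto simp: ennreal_mult_less_top)
  qed
  \<comment> \<open>\<open>\<nu>\<close> is nonzero without an atom at 0, so it charges the
    complement of some ball around 0. All cut-offs are at most \<open>e0\<close>, so that the
    restrictions of \<open>\<nu>\<close> have positive mass and can be normalised.\<close>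
  obtain e0 where e0: "0 < e0" "emeasure \<nu> {u. e0 \<le> norm u} \<noteq> 0"
  proof (rule ccontr)
    assume "\<not> thesis"
    with that have z: "emeasure \<nu> {u. e \<le> norm u} = 0" if "0 < e" for e using \<open>0 < e\<close> by blast
    have "(\<Union>n. {u::'a. 1 / real (Suc n) \<le> norm u}) = UNIV - {0}"
    proof (intro equalityI subsetI)
      fix u :: 'a assume "u \<in> UNIV - {0}"
      then show "u \<in> (\<Union>n. {u. 1 / real (Suc n) \<le> norm u})"
        using reals_Archimedean[of "norm u"] by (auto simp: inverse_eq_divide intro: less_imp_le)
    next
      fix u :: 'a assume "u \<in> (\<Union>n. {u. 1 / real (Suc n) \<le> norm u})"
      then obtain n where "1 / real (Suc n) \<le> norm u" by blast
      moreover have "0 < 1 / real (Suc n)" by simp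
      ultimately show "u \<in> UNIV - {0}" by (metis DiffI UNIV_I norm_zero not_less singletonD)
    qed
    moreover have "emeasure \<nu> (\<Union>n. {u::'a. 1 / real (Suc n) \<le> norm u}) = 0"
      using z by (intro emeasure_UN_eq_0) auto
    ultimately have "emeasure \<nu> (UNIV - {0}) = 0" by simp
    moreover have "emeasure \<nu> UNIV = emeasure \<nu> {0} + emeasure \<nu> (UNIV - {0})"
      by (subst plus_emeasure) auto
    ultimately show False using \<nu>0 by simp
  qed
  define eps where "eps n = e0 / real (Suc n)" for n :: nat
  have eps: "0 < eps n" "eps n \<le> e0" for n using e0 by (auto simp: eps_def field_simps)
  define J where "J n = {u::'a. eps n \<le> norm u}" for n
  have [measurable]: "J n \<in> sets borel" for n by (simp add: J_def)
  define \<rho> where "\<rho> n = density \<nu> (\<lambda>u. ennreal (indicator (J n) u))" for n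
  have \<rho>S [simp, measurable_cong]: "sets (\<rho> n) = sets borel" for n by (simp add: \<rho>_def \<nu>S)
  have e\<rho>: "emeasure (\<rho> n) UNIV = emeasure \<nu> (J n)" for n
    unfolding \<rho>_def by (subst emeasure_density) (auto simp: sp\<nu> ennreal_indicator)
  have fin\<rho>: "finite_measure (\<rho> n)" for n
  proof
    have "space (\<rho> n) = UNIV" by (simp add: \<rho>_def sp\<nu>)
    then show "emeasure (\<rho> n) (space (\<rho> n)) \<noteq> \<infinity>"
      using fin[OF eps(1)[of n]] by (simp add: e\<rho>) (simp add: J_def)
  qed
  define l where "l n = measure (\<rho> n) UNIV" for n
  have l: "0 < l n" for n
  proof -
    have "emeasure \<nu> {u. e0 \<le> norm u} \<le> emeasure \<nu> (J n)"
      using eps(2)[of n] by (intro emeasure_mono) (auto simp: J_def)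
    then have "emeasure (\<rho> n) UNIV \<noteq> 0" using e0(2) e\<rho> by auto
    then show ?thesis
      using finite_measure.emeasure_eq_measure[OF fin\<rho>, of n UNIV] by (simp add: l_def zero_less_measure_iff)
  qed
  \<comment> \<open>The first term makes \<open>l n / m n\<close> a probability, the second makes
    the error \<open>(l n)\<^sup>2 / m n\<close> at most \<open>1 / (n + 1)\<close>.\<close>
  define m where "m n = nat \<lceil>l n + (real (Suc n)) * (l n)\<^sup>2\<rceil>" for n
  have m: "l n + (real (Suc n)) * (l n)\<^sup>2 \<le> real (m n)" for n unfolding m_def by linarith
  have lm: "l n \<le> real (m n)" for n using m[of n] by (smt (verit) of_nat_0_le_iff zero_le_mult_iff zero_le_power2)
  have m0: "0 < m n" for n using lm[of n] l[of n] by (metis less_le_trans of_nat_0_less_iff)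
  have lm2: "(l n)\<^sup>2 / real (m n) \<le> 1 / real (Suc n)" for n
    using m[of n] l[of n] m0[of n] by (simp add: field_simps)
  define Q where "Q n = thin (\<rho> n) (m n)" for n
  note thin_facts = fin\<rho> \<rho>S l[unfolded l_def] lm[unfolded l_def]
  have Q: "prob_space (Q n)" for n unfolding Q_def by (rule prob_space_thin[OF thin_facts])
  have QS [simp, measurable_cong]: "sets (Q n) = sets borel" for n unfolding Q_def by (rule sets_thin[OF thin_facts])
  \<comment> \<open>The thinned sums are not compensated, so the compensator of the jumps kept
    inside the unit ball is moved into the drift \<open>b n\<close>. It may diverge as
    \<open>n\<close> grows; what converges is \<open>z n t\<close> together with the drift.\<close>
  define c where "c n = (LINT u|\<nu>. indicator (J n \<inter> cball 0 1) u *\<^sub>R u)" for n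
  define b where "b n = \<beta> - c n" for n
  have iJ: "integrable \<nu> (\<lambda>u. indicator (J n) u *\<^sub>R f u)"
    if [measurable]: "f \<in> borel_measurable borel" and f: "\<And>u. norm (f u) \<le> B"
    for n and f :: "'a \<Rightarrow> 'b::{banach, second_countable_topology}" and B
  proof -
    have "integrable \<nu> (\<lambda>u. B *\<^sub>R indicator (J n) u :: real)"
      using fin[OF eps(1)[of n]] by (intro integrable_scaleR_right) (auto simp: integrable_indicator_iff J_def \<nu>S)
    then show ?thesis
      by (rule Bochner_Integration.integrable_bound) (auto simp: indicator_def f intro!: AE_I2 order_trans[OF f abs_ge_self])
  qed
  define K where "K t u = iexp (t \<bullet> u) - 1 - \<i> * complex_of_real (t \<bullet> u * indicator (cball 0 1) u)" for t u :: 'a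
  have [measurable]: "cball (0::'a) 1 \<in> sets borel" by (intro borel_closed closed_cball)
  have [measurable]: "K t \<in> borel_measurable borel" for t unfolding K_def by measurable
  define z where "z n t = (LINT u|\<rho> n. iexp (t \<bullet> u) - 1)" for n t
  have n2: "norm (iexp (t \<bullet> u) - 1) \<le> 2" for t u :: 'a
    by (rule order_trans[OF norm_triangle_ineq4]) simp
  have z_eq: "z n t = (LINT u|\<nu>. indicator (J n) u *\<^sub>R (iexp (t \<bullet> u) - 1))" for n t
    unfolding z_def \<rho>_def by (subst integral_density) auto
  have zK: "z n t + \<i> * complex_of_real (t \<bullet> b n) = \<i> * complex_of_real (t \<bullet> \<beta>) + (LINT u|\<nu>. indicator (J n) u *\<^sub>R K t u)" for n t
  proof -
    have ic: "integrable \<nu> (\<lambda>u. indicator (J n \<inter> cball 0 1) u *\<^sub>R u)"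
    proof -
      have "integrable \<nu> (\<lambda>u. indicator (J n) u *\<^sub>R (indicator (cball 0 1) u *\<^sub>R u))"
        by (rule iJ[of _ 1]) (auto simp: indicator_def)
      then show ?thesis by (simp add: indicator_inter_arith)
    qed
    have "complex_of_real (t \<bullet> c n) = (LINT u|\<nu>. complex_of_real (t \<bullet> (indicator (J n \<inter> cball 0 1) u *\<^sub>R u)))"
      unfolding c_def using ic by (simp add: integral_complex_of_real del: inner_scaleR_right)
    also have "\<i> * \<dots> = (LINT u|\<nu>. indicator (J n) u *\<^sub>R (\<i> * complex_of_real (t \<bullet> u * indicator (cball 0 1) u)))"
      by (subst integral_mult_right_zero[symmetric], intro Bochner_Integration.integral_cong refl)
        (auto simp: indicator_def)
    finally have c: "\<i> * complex_of_real (t \<bullet> c n) = (LINT u|\<nu>. indicator (J n) u *\<^sub>R (\<i> * complex_of_real (t \<bullet> u * indicator (cball 0 1) u)))" .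
    have i2: "integrable \<nu> (\<lambda>u. indicator (J n) u *\<^sub>R (\<i> * complex_of_real (t \<bullet> u * indicator (cball 0 1) u)))"
    proof (rule iJ)
      show "norm (\<i> * complex_of_real (t \<bullet> u * indicator (cball 0 1) u)) \<le> norm t" for u
        using order_trans[OF Cauchy_Schwarz_ineq2[of t u], of "norm t"]
        by (auto simp: norm_mult indicator_def abs_mult mult_left_le)
    qed measurable
    have i1: "integrable \<nu> (\<lambda>u. indicator (J n) u *\<^sub>R (iexp (t \<bullet> u) - 1))"
      by (rule iJ[OF _ n2]) measurable
    have "(LINT u|\<nu>. indicator (J n) u *\<^sub>R K t u) = z n t - \<i> * complex_of_real (t \<bullet> c n)"
      unfolding K_def z_eq c scaleR_diff_right[of _ "iexp _ - 1"] using i1 i2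
      by (rule Bochner_Integration.integral_diff)
    then show ?thesis by (simp add: b_def inner_diff_right algebra_simps)
  qed
  have lim: "(\<lambda>n. LINT u|\<nu>. indicator (J n) u *\<^sub>R K t u) \<longlonglongrightarrow> (LINT u|\<nu>. K t u)" for t
  proof (rule integral_dominated_convergence[where w = "\<lambda>u. (2 + (norm t)\<^sup>2) * min 1 ((norm u)\<^sup>2)"])
    show "integrable \<nu> (\<lambda>u. (2 + (norm t)\<^sup>2) * min 1 ((norm u)\<^sup>2))" using imin by simp
    show "AE u in \<nu>. (\<lambda>n. indicator (J n) u *\<^sub>R K t u) \<longlonglongrightarrow> K t u"
    proof (rule AE_I2)
      fix u :: 'a
      show "(\<lambda>n. indicator (J n) u *\<^sub>R K t u) \<longlonglongrightarrow> K t u"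
      proof (cases "u = 0")
        case True
        then show ?thesis by (simp add: K_def)
      next
        case False
        have "eps \<longlonglongrightarrow> 0" unfolding eps_def by (rule LIMSEQ_Suc[OF lim_const_over_n])
        then have "eventually (\<lambda>n. eps n < norm u) sequentially"
          using False by (intro order_tendstoD) auto
        then have "eventually (\<lambda>n. indicator (J n) u *\<^sub>R K t u = K t u) sequentially"
          by eventually_elim (simp add: J_def)
        then show ?thesis by (rule tendsto_eventually)
      qed
    qed
    show "AE u in \<nu>. norm (indicator (J n) u *\<^sub>R K t u) \<le> (2 + (norm t)\<^sup>2) * min 1 ((norm u)\<^sup>2)" for n
      using norm_iexp_compensated_le[of t]
      by (intro AE_I2) (auto simp: K_def indicator_def intro: order_trans[OF norm_ge_zero])
  qed measurable
  have znorm: "norm (z n t) \<le> 2 * l n" for n t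
  proof -
    interpret finite_measure "\<rho> n" by (rule fin\<rho>)
    have sp: "space (\<rho> n) = UNIV" by (simp add: \<rho>_def sp\<nu>)
    have "norm (z n t) \<le> (LINT u|\<rho> n. norm (iexp (t \<bullet> u) - 1))"
      unfolding z_def by (rule integral_norm_bound)
    also have "\<dots> \<le> (LINT u|\<rho> n. 2)"
    proof (rule integral_mono)
      show "integrable (\<rho> n) (\<lambda>u. norm (iexp (t \<bullet> u) - 1))"
        using n2 by (intro integrable_const_bound[of _ 2]) auto
    qed (use n2 in auto)
    also have "\<dots> = 2 * l n" by (simp add: l_def sp)
    finally show ?thesis .
  qed
  have zRe: "Re (z n t) \<le> 0" for n t
  proof -
    interpret finite_measure "\<rho> n" by (rule fin\<rho>)
    have "integrable (\<rho> n) (\<lambda>u. iexp (t \<bullet> u) - 1)"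
      using n2 by (intro integrable_const_bound[of _ 2]) auto
    then have "Re (z n t) = (LINT u|\<rho> n. cos (t \<bullet> u) - 1)"
      unfolding z_def by (subst integral_Re[symmetric]) (auto simp: Re_exp)
    also have "\<dots> = - (LINT u|\<rho> n. 1 - cos (t \<bullet> u))"
      by (subst Bochner_Integration.integral_minus[symmetric]) simp
    also have "\<dots> \<le> 0" by (simp add: integral_nonneg_AE)
    finally show ?thesis .
  qed
  have charQ: "(LINT u|Q n. iexp (t \<bullet> u)) = 1 + z n t / of_nat (m n)" for n t
    unfolding Q_def z_def by (rule char_thin[OF thin_facts, simplified])
  have Qn1: "norm (1 + z n t / of_nat (m n)) \<le> 1" for n t
  proof -
    interpret prob_space "Q n" by (rule Q)
    have "norm (LINT u|Q n. iexp (t \<bullet> u)) \<le> (LINT u|Q n. norm (iexp (t \<bullet> u)))"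
      by (rule integral_norm_bound)
    then show ?thesis by (simp add: charQ prob_space)
  qed
  have conv: "(\<lambda>n. LINT x|iid_sum (Q n) (b n) (m n). iexp (t \<bullet> x)) \<longlonglongrightarrow> (LINT x|\<mu>. iexp (t \<bullet> x))" for t
  proof -
    have "(\<lambda>n. exp (\<i> * complex_of_real (t \<bullet> \<beta>) + (LINT u|\<nu>. indicator (J n) u *\<^sub>R K t u))) \<longlonglongrightarrow>
        exp (\<i> * complex_of_real (t \<bullet> \<beta>) + (LINT u|\<nu>. K t u))"
      by (intro tendsto_intros lim)
    then have 1: "(\<lambda>n. iexp (t \<bullet> b n) * exp (z n t)) \<longlonglongrightarrow> (LINT x|\<mu>. iexp (t \<bullet> x))"
      unfolding char K_def[symmetric] zK[symmetric] by (simp add: exp_add mult.commute)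
    have 2: "(\<lambda>n. (LINT x|iid_sum (Q n) (b n) (m n). iexp (t \<bullet> x)) - iexp (t \<bullet> b n) * exp (z n t)) \<longlonglongrightarrow> 0"
    proof (rule Lim_null_comparison[where g = "\<lambda>n. 4 * exp 2 * (1 / real (Suc n))"])
      show "eventually (\<lambda>n. norm ((LINT x|iid_sum (Q n) (b n) (m n). iexp (t \<bullet> x)) - iexp (t \<bullet> b n) * exp (z n t))
          \<le> 4 * exp 2 * (1 / real (Suc n))) sequentially"
      proof (intro always_eventually allI)
        fix n
        have "norm ((LINT x|iid_sum (Q n) (b n) (m n). iexp (t \<bullet> x)) - iexp (t \<bullet> b n) * exp (z n t)) =
            norm (iexp (t \<bullet> b n) * ((1 + z n t / of_nat (m n)) ^ m n - exp (z n t)))"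
          by (subst char_iid_sum[OF Q QS]) (simp add: charQ right_diff_distrib)
        also have "\<dots> = norm ((1 + z n t / of_nat (m n)) ^ m n - exp (z n t))"
          by (simp add: norm_mult)
        also have "\<dots> \<le> 4 * exp 2 * (l n)\<^sup>2 / real (m n)"
          by (rule binomial_exp_error[OF m0 Qn1 zRe znorm lm])
        also have "\<dots> \<le> 4 * exp 2 * (1 / real (Suc n))"
          using lm2[of n] by (simp only: times_divide_eq_right[symmetric] mult.assoc) (intro mult_left_mono, auto)
        finally show "norm ((LINT x|iid_sum (Q n) (b n) (m n). iexp (t \<bullet> x)) - iexp (t \<bullet> b n) * exp (z n t))
          \<le> 4 * exp 2 * (1 / real (Suc n))" .
      qed
      have "(\<lambda>n. 4 * exp 2 * (1 / real (Suc n))) \<longlonglongrightarrow> 4 * exp 2 * 0"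
        by (intro tendsto_mult_left LIMSEQ_Suc[OF lim_const_over_n])
      then show "(\<lambda>n. 4 * exp 2 * (1 / real (Suc n))) \<longlonglongrightarrow> 0" by simp
    qed
    show ?thesis using tendsto_add[OF 1 2] by simp
  qed
  show thesis
  proof (rule that[of Q m b]; intro allI impI; (elim conjE)?)
    show "of_nat (m n) * (\<integral>\<^sup>+u. f u \<partial>Q n) \<le> (\<integral>\<^sup>+u. f u \<partial>\<nu>)"
      if [measurable]: "f \<in> borel_measurable borel" and "f 0 = 0" for n f
    proof -
      have "of_nat (m n) * (\<integral>\<^sup>+u. f u \<partial>Q n) = (of_nat (m n) * ennreal (1 / m n)) * (\<integral>\<^sup>+u. f u \<partial>\<rho> n)"
        unfolding Q_def by (subst nn_integral_thin[OF thin_facts]) (auto simp: \<open>f 0 = 0\<close> mult.assoc)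
      also have "of_nat (m n) * ennreal (1 / m n) = 1"
        using m0[of n] by (simp add: ennreal_of_nat_eq_real_of_nat flip: ennreal_mult)
      also have "(\<integral>\<^sup>+u. f u \<partial>\<rho> n) \<le> (\<integral>\<^sup>+u. f u \<partial>\<nu>)"
        unfolding \<rho>_def by (subst nn_integral_density) (auto simp: indicator_def intro!: nn_integral_mono)
      finally show ?thesis by simp
    qed
    show "(\<lambda>n. LINT x|iid_sum (Q n) (b n) (m n). f x) \<longlonglongrightarrow> (LINT x|\<mu>. f x)"
      if "uniformly_continuous_on UNIV f" "\<forall>x. \<bar>f x\<bar> \<le> B" for f :: "'a \<Rightarrow> real" and B
      using that by (intro levy_continuity_euclidean[OF \<mu> prob_space_iid_sum[OF Q QS] sets_iid_sum conv, of f B]) auto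
  qed (auto simp: Q m0)
qed

section \<open>Exponential moments of Lipschitz functions\<close>

lemma lipschitz_imp_uniformly_continuous:
  fixes f :: "'a::real_normed_vector \<Rightarrow> real"
  assumes "\<And>x y. \<bar>f x - f y\<bar> \<le> C * norm (x - y)" and "0 \<le> C"
  shows "uniformly_continuous_on UNIV f"
  using assms
  by (intro lipschitz_on_uniformly_continuous[of C] lipschitz_onI) (auto simp: dist_norm)

lemma exp_diff_le:
  fixes x y M :: real
  assumes "x \<le> M" "y \<le> M"
  shows "\<bar>exp x - exp y\<bar> \<le> exp M * \<bar>x - y\<bar>"
proof -
  have *: "exp x - exp y \<le> exp M * (x - y)" if "y \<le> x" "x \<le> M" for x y :: real
  proof -
    have "exp x - exp y = exp x * (1 - exp (y - x))" by (simp add: algebra_simps flip: exp_add)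
    also have "\<dots> \<le> exp M * (x - y)"
    proof (rule mult_mono)
      show "1 - exp (y - x) \<le> x - y" using exp_ge_add_one_self[of "y - x"] by linarith
    qed (use that in auto)
    finally show ?thesis .
  qed
  show ?thesis
  proof (cases "x \<le> y")
    case True
    then have "\<bar>exp x - exp y\<bar> = exp y - exp x" "\<bar>x - y\<bar> = y - x" by auto
    then show ?thesis using *[OF True assms(2)] by simp
  next
    case False
    then have "\<bar>exp x - exp y\<bar> = exp x - exp y" "\<bar>x - y\<bar> = x - y" by auto
    then show ?thesis using *[of y x] False assms(1) by simp
  qed
qed

text \<open>Boundedness of \<open>g\<close> makes \<open>exp (s * g x)\<close> bounded and
  Lipschitz, hence an admissible test function for the weak convergence; both sides of the bound for
  the sums then pass to the limit.\<close>

lemma mgf_ID_bounded: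
  fixes \<mu> \<nu> :: "'a::euclidean_space measure" and g :: "'a \<Rightarrow> real"
  assumes \<mu>: "prob_space \<mu>" "sets \<mu> = sets borel" and ID: "has_ID_law \<mu> \<beta> \<nu>"
    and B: "\<And>x. \<bar>g x\<bar> \<le> B" and lip: "\<And>x y. \<bar>g x - g y\<bar> \<le> norm (x - y)"
    and s: "0 \<le> s" and H: "(\<integral>\<^sup>+u. ennreal (exp_rem (s * norm u)) \<partial>\<nu>) \<le> ennreal H" "0 \<le> H"
  shows "(LINT x|\<mu>. exp (s * g x)) \<le> exp (s * (LINT x|\<mu>. g x) + H)"
proof -
  obtain Q m b where *: "\<forall>n::nat. prob_space (Q n) \<and> sets (Q n) = sets borel \<and> 0 < m n"
    "\<forall>n f. f \<in> borel_measurable borel \<and> f 0 = 0 \<longrightarrow>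
      of_nat (m n) * (\<integral>\<^sup>+u. f u \<partial>Q n) \<le> (\<integral>\<^sup>+u. f u \<partial>\<nu>)"
    "\<forall>f B. uniformly_continuous_on UNIV f \<and> (\<forall>x. \<bar>f x\<bar> \<le> B) \<longrightarrow>
      (\<lambda>n. LINT x|iid_sum (Q n) (b n) (m n). f x) \<longlonglongrightarrow> (LINT x|\<mu>. f x :: real)"
    using has_ID_law_approx[OF \<mu> ID] by blast
  then have Q: "\<And>n. prob_space (Q n)" "\<And>n. sets (Q n) = sets borel" and m: "\<And>n. 0 < m n"
    and weak: "\<And>f B. uniformly_continuous_on UNIV f \<Longrightarrow> (\<And>x. \<bar>f x\<bar> \<le> B) \<Longrightarrow>
      (\<lambda>n. LINT x|iid_sum (Q n) (b n) (m n). f x) \<longlonglongrightarrow> (LINT x|\<mu>. f x :: real)"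
    by blast+
  have bound: "(LINT x|iid_sum (Q n) (b n) (m n). exp (s * g x)) \<le>
      exp (s * (LINT x|iid_sum (Q n) (b n) (m n). g x) + H)" for n
  proof -
    have m': "0 < real (m n)" using m by simp
    \<comment> \<open>Each summand is allowed \<open>\<psi> = H / m n\<close>, and
      \<open>m n\<close> of them add up to \<open>H\<close>.\<close>
    have "of_nat (m n) * (\<integral>\<^sup>+u. ennreal (exp_rem (s * norm u)) \<partial>Q n) \<le> ennreal H"
      by (rule order_trans[OF *(2)[rule_format] H(1)]) auto
    then have "ennreal (1 / m n) * (ennreal (m n) * (\<integral>\<^sup>+u. ennreal (exp_rem (s * norm u)) \<partial>Q n)) \<le> ennreal (1 / m n) * ennreal H"
      by (intro mult_left_mono) (auto simp: ennreal_of_nat_eq_real_of_nat)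
    then have "(\<integral>\<^sup>+u. ennreal (exp_rem (s * norm u)) \<partial>Q n) \<le> ennreal (H / m n)"
      using m' H(2) by (simp add: mult.assoc[symmetric] flip: ennreal_mult)
    from mgf_iid_sum_le[OF Q B lip s this, of "b n" "m n"] show ?thesis
      using m' H(2) by simp
  qed
  have uc: "uniformly_continuous_on UNIV g"
    using lip by (intro lipschitz_imp_uniformly_continuous[of _ 1]) auto
  have "uniformly_continuous_on UNIV (\<lambda>x. exp (s * g x))"
  proof (rule lipschitz_imp_uniformly_continuous)
    fix x y
    have "s * g x \<le> s * B" for x using B[of x] s by (intro mult_left_mono) auto
    then have "\<bar>exp (s * g x) - exp (s * g y)\<bar> \<le> exp (s * B) * \<bar>s * g x - s * g y\<bar>"
      by (intro exp_diff_le)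
    also have "\<dots> = exp (s * B) * s * \<bar>g x - g y\<bar>"
      using s by (simp add: abs_mult flip: right_diff_distrib)
    also have "\<dots> \<le> exp (s * B) * s * norm (x - y)"
      using s lip by (intro mult_left_mono) auto
    finally show "\<bar>exp (s * g x) - exp (s * g y)\<bar> \<le> exp (s * B) * s * norm (x - y)" .
  qed (use s in auto)
  then have "(\<lambda>n. LINT x|iid_sum (Q n) (b n) (m n). exp (s * g x)) \<longlonglongrightarrow> (LINT x|\<mu>. exp (s * g x))"
  proof (rule weak)
    show "\<bar>exp (s * g x)\<bar> \<le> exp (s * B)" for x
      using B[of x] s by (auto intro!: mult_left_mono)
  qed
  moreover have "(\<lambda>n. exp (s * (LINT x|iid_sum (Q n) (b n) (m n). g x) + H)) \<longlonglongrightarrow> exp (s * (LINT x|\<mu>. g x) + H)"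
    by (intro tendsto_intros weak[OF uc B])
  ultimately show ?thesis using bound by (intro LIMSEQ_le) auto
qed

text \<open>Clamping \<open>f\<close> to \<open>[-n, n]\<close> keeps it 1-Lipschitz. The means
  converge by dominated convergence and Fatou's lemma handles the exponential moments, so finiteness
  of the exponential moment is part of the conclusion.\<close>

lemma mgf_ID:
  fixes \<mu> \<nu> :: "'a::euclidean_space measure" and f :: "'a \<Rightarrow> real"
  assumes \<mu>: "prob_space \<mu>" and \<mu>S [measurable_cong]: "sets \<mu> = sets borel" and ID: "has_ID_law \<mu> \<beta> \<nu>"
    and lip: "\<And>x y. \<bar>f x - f y\<bar> \<le> norm (x - y)" and int: "integrable \<mu> f"
    and s: "0 \<le> s" and H: "(\<integral>\<^sup>+u. ennreal (exp_rem (s * norm u)) \<partial>\<nu>) \<le> ennreal H" "0 \<le> H"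
  shows "(\<integral>\<^sup>+x. ennreal (exp (s * f x)) \<partial>\<mu>) \<le> ennreal (exp (s * (LINT x|\<mu>. f x) + H))"
proof -
  interpret prob_space \<mu> by fact
  have [measurable]: "f \<in> borel_measurable borel"
    using lip by (intro borel_measurable_continuous_onI uniformly_continuous_imp_continuous
        lipschitz_imp_uniformly_continuous[of _ 1]) auto
  define g where "g n x = max (- real n) (min (real n) (f x))" for n x
  have g: "\<bar>g n x\<bar> \<le> real n" "\<bar>g n x\<bar> \<le> \<bar>f x\<bar>" "\<bar>g n x - g n y\<bar> \<le> norm (x - y)" for n x y
    using lip[of x y] by (auto simp: g_def min_def max_def)
  have [measurable]: "g n \<in> borel_measurable borel" for n unfolding g_def by measurable
  have glim: "(\<lambda>n. g n x) \<longlonglongrightarrow> f x" for x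
  proof (rule tendsto_eventually)
    obtain N :: nat where "\<bar>f x\<bar> \<le> N" using real_arch_simple by blast
    then have "g n x = f x" if "N \<le> n" for n using that by (simp add: g_def)
    then show "eventually (\<lambda>n. g n x = f x) sequentially"
      unfolding eventually_sequentially by blast
  qed
  have gint: "(\<lambda>n. LINT x|\<mu>. g n x) \<longlonglongrightarrow> (LINT x|\<mu>. f x)"
    by (rule integral_dominated_convergence[where w = "\<lambda>x. \<bar>f x\<bar>"]) (auto simp: int glim g)
  have le: "(\<integral>\<^sup>+x. ennreal (exp (s * g n x)) \<partial>\<mu>) \<le> ennreal (exp (s * (LINT x|\<mu>. g n x) + H))" for n
  proof -
    have "integrable \<mu> (\<lambda>x. exp (s * g n x))"
      using g(1)[of n] s by (intro integrable_bounded_prob[OF \<mu>, of _ "exp (s * real n)"])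
        (auto intro!: mult_left_mono intro: order_trans[OF abs_ge_self])
    then have "(\<integral>\<^sup>+x. ennreal (exp (s * g n x)) \<partial>\<mu>) = ennreal (LINT x|\<mu>. exp (s * g n x))"
      by (intro nn_integral_eq_integral) auto
    then show ?thesis
      using mgf_ID_bounded[OF \<mu> \<mu>S ID g(1) g(3) s H, of n] by (simp add: ennreal_leI)
  qed
  have "(\<integral>\<^sup>+x. ennreal (exp (s * f x)) \<partial>\<mu>) = (\<integral>\<^sup>+x. liminf (\<lambda>n. ennreal (exp (s * g n x))) \<partial>\<mu>)"
  proof (rule nn_integral_cong)
    fix x
    have "(\<lambda>n. ennreal (exp (s * g n x))) \<longlonglongrightarrow> ennreal (exp (s * f x))"
      by (intro tendsto_intros glim)
    then show "ennreal (exp (s * f x)) = liminf (\<lambda>n. ennreal (exp (s * g n x)))"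
      by (rule lim_imp_Liminf[OF sequentially_bot, symmetric])
  qed
  also have "\<dots> \<le> liminf (\<lambda>n. \<integral>\<^sup>+x. ennreal (exp (s * g n x)) \<partial>\<mu>)"
    by (rule nn_integral_liminf) measurable
  also have "\<dots> \<le> liminf (\<lambda>n. ennreal (exp (s * (LINT x|\<mu>. g n x) + H)))"
    by (intro Liminf_mono always_eventually allI le)
  also have "\<dots> = ennreal (exp (s * (LINT x|\<mu>. f x) + H))"
  proof -
    have "(\<lambda>n. ennreal (exp (s * (LINT x|\<mu>. g n x) + H))) \<longlonglongrightarrow> ennreal (exp (s * (LINT x|\<mu>. f x) + H))"
      by (intro tendsto_intros gint)
    then show ?thesis by (rule lim_imp_Liminf[OF sequentially_bot])
  qed
  finally show ?thesis .
qed

lemma chernoff_bound: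
  fixes f :: "'a \<Rightarrow> real"
  assumes "prob_space M" and [measurable]: "f \<in> borel_measurable M"
    and mgf: "(\<integral>\<^sup>+x. ennreal (exp (s * f x)) \<partial>M) \<le> ennreal (exp (s * e + H))" and s: "0 < s"
  shows "measure M {x \<in> space M. \<delta> \<le> f x - e} \<le> exp (H - s * \<delta>)"
proof -
  interpret prob_space M by fact
  have "emeasure M {x \<in> space M. \<delta> \<le> f x - e} \<le> (\<integral>\<^sup>+x. ennreal (exp (- s * (e + \<delta>))) * ennreal (exp (s * f x)) \<partial>M)"
  proof -
    have "emeasure M {x \<in> space M. \<delta> \<le> f x - e} = (\<integral>\<^sup>+x. indicator {x \<in> space M. \<delta> \<le> f x - e} x \<partial>M)"
      by (rule nn_integral_indicator[symmetric]) measurable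
    also have "\<dots> \<le> (\<integral>\<^sup>+x. ennreal (exp (- s * (e + \<delta>))) * ennreal (exp (s * f x)) \<partial>M)"
    proof (intro nn_integral_mono)
      fix x
      have "1 \<le> exp (- s * (e + \<delta>)) * exp (s * f x)" if "\<delta> \<le> f x - e"
      proof -
        have "0 \<le> s * (f x - e - \<delta>)" using that s by (intro mult_nonneg_nonneg) auto
        then show ?thesis by (simp add: algebra_simps flip: exp_add)
      qed
      then show "indicator {x \<in> space M. \<delta> \<le> f x - e} x \<le> ennreal (exp (- s * (e + \<delta>))) * ennreal (exp (s * f x))"
        using ennreal_leI[of 1 "exp (- s * (e + \<delta>)) * exp (s * f x)"]
        by (auto simp: indicator_def ennreal_mult)
    qed
    finally show ?thesis .
  qed
  also have "\<dots> = ennreal (exp (- s * (e + \<delta>))) * (\<integral>\<^sup>+x. ennreal (exp (s * f x)) \<partial>M)"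
    by (rule nn_integral_cmult) measurable
  also have "\<dots> \<le> ennreal (exp (- s * (e + \<delta>))) * ennreal (exp (s * e + H))"
    by (intro mult_left_mono mgf) simp
  also have "\<dots> = ennreal (exp (H - s * \<delta>))"
    by (simp add: algebra_simps flip: ennreal_mult exp_add)
  finally show ?thesis by (simp add: emeasure_eq_measure)
qed

section \<open>The Legendre transform of the exponent\<close>

text \<open>The tangent of the convex \<open>exp_rem\<close> at \<open>x\<close>, read at 0. It
  carries integrability over from \<open>levy_h\<close> to the exponent.\<close>

lemma exp_rem_le: "exp_rem x \<le> x * (exp x - 1)"
proof -
  have "exp x * (1 - x) \<le> exp x * exp (- x)"
    using exp_ge_add_one_self[of "- x"] by (intro mult_left_mono) auto
  then show ?thesis by (simp add: exp_rem_def algebra_simps flip: exp_add)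
qed

lemma exp_rem_tangent: "exp_rem x + (exp x - 1) * (y - x) \<le> exp_rem y"
proof -
  have "exp x * (1 + (y - x)) \<le> exp x * exp (y - x)"
    using exp_ge_add_one_self[of "y - x"] by (intro mult_left_mono) auto
  then show ?thesis by (simp add: exp_rem_def algebra_simps flip: exp_add)
qed

lemma at_left_ereal_neq_bot:
  fixes T :: ereal
  assumes "0 < T"
  shows "at_left T \<noteq> bot"
proof
  assume bot: "at_left T = bot"
  have "eventually (\<lambda>_. False) (at_left T)" unfolding bot by simp
  then obtain b where "b < T" "\<forall>y>b. y < T \<longrightarrow> False"
    unfolding eventually_at_left[OF assms] by (elim exE conjE)
  then show False using dense[of b T] by metis
qed

lemma eventually_at_left_ereal:
  assumes "ereal a < T" and "\<And>s. a < s \<Longrightarrow> ereal s < T \<Longrightarrow> P (ereal s)"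
  shows "eventually P (at_left T)"
  unfolding eventually_at_left[OF assms(1)]
proof (intro exI[of _ "ereal a"] conjI allI impI)
  fix y assume "ereal a < y" "y < T"
  then obtain s where "y = ereal s" by (cases y) auto
  then show "P y" using assms(2) \<open>ereal a < y\<close> \<open>y < T\<close> by simp
qed (rule assms)

text \<open>The integrability assumption makes \<open>levy_h\<close> a genuine integral on all of
  \<open>(0, T)\<close>, as opposed to the default value 0 for a non-integrable function.
  \<open>levy_tilt_if_left_limit_pos\<close> supplies it.\<close>

locale levy_tilt =
  fixes \<nu> :: "'a::euclidean_space measure" and T :: ereal
  assumes \<nu>: "levy_measure \<nu>" and T: "0 < T"
    and int: "\<And>s. 0 < s \<Longrightarrow> ereal s < T \<Longrightarrow> integrable \<nu> (\<lambda>u. norm u * (exp (s * norm u) - 1))"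
begin

definition "S = {s. 0 < s \<and> ereal s < T}"
definition "S0 = {s. 0 \<le> s \<and> ereal s < T}"
definition "\<Phi> s = (LINT u|\<nu>. exp_rem (s * norm u))"

abbreviation "h \<equiv> levy_h \<nu>"

lemma \<nu>S [measurable_cong]: "sets \<nu> = sets borel" using \<nu> by (simp add: levy_measure_def)

lemma S_S0: "S0 = insert 0 S" using T by (auto simp: S_def S0_def zero_ereal_def[symmetric])

lemma int0: "s \<in> S0 \<Longrightarrow> integrable \<nu> (\<lambda>u. norm u * (exp (s * norm u) - 1))"
  using int by (auto simp: S_S0 S_def)

lemma int_rem: "s \<in> S0 \<Longrightarrow> integrable \<nu> (\<lambda>u. exp_rem (s * norm u))"
proof -
  assume s: "s \<in> S0"
  have "integrable \<nu> (\<lambda>u. s * (norm u * (exp (s * norm u) - 1)))"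
    using int0[OF s] by simp
  then show ?thesis
  proof (rule Bochner_Integration.integrable_bound)
    have "norm (exp_rem (s * norm u)) \<le> norm (s * (norm u * (exp (s * norm u) - 1)))" for u :: 'a
      using exp_rem_le[of "s * norm u"] by (simp add: mult.assoc)
    then show "AE u in \<nu>. norm (exp_rem (s * norm u)) \<le> norm (s * (norm u * (exp (s * norm u) - 1)))"
      by simp
  qed measurable
qed

lemma S_open: "open S"
proof -
  have "S = {0<..} \<inter> ereal -` {..<T}" by (auto simp: S_def)
  moreover have "open (ereal -` {..<T})"
    by (rule open_vimage[OF open_lessThan continuous_on_ereal[OF continuous_on_id]])
  ultimately show ?thesis by (simp add: open_Int)
qed

lemma S_interval: "a \<in> S \<Longrightarrow> 0 < s \<Longrightarrow> s \<le> a \<Longrightarrow> s \<in> S"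
  unfolding S_def using order_le_less_trans[of "ereal s" "ereal a" T] by auto

lemma S0_convex: "convex S0"
  unfolding is_interval_convex_1[symmetric] is_interval_1
proof (intro ballI allI impI)
  fix a b x assume "a \<in> S0" "b \<in> S0" "a \<le> x \<and> x \<le> b"
  then show "x \<in> S0"
    using order_le_less_trans[of "ereal x" "ereal b" T] by (auto simp: S0_def)
qed

lemma S_convex: "convex S"
proof -
  have "S = S0 \<inter> {0<..}" by (auto simp: S_def S0_def)
  then show ?thesis using S0_convex by (simp add: convex_Int)
qed

lemma h_0: "h 0 = 0" by (simp add: levy_h_def)

lemma \<Phi>_0: "\<Phi> 0 = 0" by (simp add: \<Phi>_def)

text \<open>Inherited from \<open>exp\<close>, convexity yields two things: continuity on the open
  interval \<open>S\<close>, and, with \<open>h 0 = 0\<close>, the bound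
  \<open>h (t * b) \<le> t * h b\<close>, which controls \<open>h\<close> near 0.\<close>

lemma h_convex: "convex_on S0 h"
proof (rule convex_onI[OF _ S0_convex])
  fix t x y :: real
  assume t: "0 < t" "t < 1" and xy: "x \<in> S0" "y \<in> S0"
  have m: "(1 - t) *\<^sub>R x + t *\<^sub>R y \<in> S0"
    using convexD[OF S0_convex xy, of "1 - t" t] t by simp
  have "h ((1 - t) *\<^sub>R x + t *\<^sub>R y) \<le> (LINT u|\<nu>. (1 - t) * (norm u * (exp (x * norm u) - 1)) + t * (norm u * (exp (y * norm u) - 1)))"
    unfolding levy_h_def
  proof (rule integral_mono)
    fix u :: 'a
    have "exp (((1 - t) *\<^sub>R x + t *\<^sub>R y) * norm u) \<le> (1 - t) * exp (x * norm u) + t * exp (y * norm u)"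
      using convex_onD[OF exp_convex, of t "x * norm u" "y * norm u"] t by (simp add: algebra_simps)
    then have "norm u * (exp (((1 - t) *\<^sub>R x + t *\<^sub>R y) * norm u) - 1) \<le>
        norm u * ((1 - t) * exp (x * norm u) + t * exp (y * norm u) - 1)"
      by (intro mult_left_mono) auto
    then show "norm u * (exp (((1 - t) *\<^sub>R x + t *\<^sub>R y) * norm u) - 1) \<le>
        (1 - t) * (norm u * (exp (x * norm u) - 1)) + t * (norm u * (exp (y * norm u) - 1))"
      by (simp add: algebra_simps)
  qed (use int0[OF m] int0 xy in auto)
  also have "\<dots> = (1 - t) * h x + t * h y"
    using int0 xy by (simp add: levy_h_def)
  finally show "h ((1 - t) *\<^sub>R x + t *\<^sub>R y) \<le> (1 - t) * h x + t * h y" .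
qed

lemma h_continuous: "continuous_on S h"
  using convex_on_continuous[OF S_open] convex_on_subset[OF h_convex _ S_convex] by (auto simp: S_S0)

lemma h_isCont: "s \<in> S \<Longrightarrow> isCont h s"
  using h_continuous S_open by (simp add: continuous_on_eq_continuous_at)

text \<open>For \<open>u \<noteq> 0\<close> the integrand is strictly increasing in
  \<open>s\<close>, so equality would confine \<open>\<nu>\<close> to the origin, where it has no
  mass, although \<open>\<nu>\<close> is not the zero measure.\<close>

lemma h_less:
  assumes "x \<in> S0" "y \<in> S0" "x < y"
  shows "h x < h y"
proof -
  have i: "integrable \<nu> (\<lambda>u. norm u * (exp (y * norm u) - 1) - norm u * (exp (x * norm u) - 1))"
    using int0 assms by (intro Bochner_Integration.integrable_diff) auto
  have pos: "0 \<le> norm u * (exp (y * norm u) - 1) - norm u * (exp (x * norm u) - 1)" for u :: 'a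
    using assms(3) by (auto simp flip: right_diff_distrib intro!: mult_nonneg_nonneg mult_right_mono)
  have "0 \<le> (LINT u|\<nu>. norm u * (exp (y * norm u) - 1) - norm u * (exp (x * norm u) - 1))"
    using pos by (intro integral_nonneg_AE) auto
  moreover have "(LINT u|\<nu>. norm u * (exp (y * norm u) - 1) - norm u * (exp (x * norm u) - 1)) \<noteq> 0"
  proof
    assume "(LINT u|\<nu>. norm u * (exp (y * norm u) - 1) - norm u * (exp (x * norm u) - 1)) = 0"
    then have "AE u in \<nu>. norm u * (exp (y * norm u) - 1) - norm u * (exp (x * norm u) - 1) = 0"
      using integral_nonneg_eq_0_iff_AE[OF i] pos by auto
    then have "AE u in \<nu>. u = 0"
      by eventually_elim (use assms(3) in \<open>auto simp flip: right_diff_distrib\<close>)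
    moreover have "AE u in \<nu>. u \<noteq> 0"
      by (rule AE_I[of _ _ "{0}"]) (use \<nu> \<nu>S in \<open>auto simp: levy_measure_def\<close>)
    ultimately have "AE u in \<nu>. False" by eventually_elim simp
    moreover have "space \<nu> = UNIV" using sets_eq_imp_space_eq[OF \<nu>S] by simp
    ultimately have "emeasure \<nu> UNIV = 0" by (simp add: AE_iff_measurable[OF _ refl])
    then show False using \<nu> by (simp add: levy_measure_def)
  qed
  ultimately show ?thesis using int0 assms by (simp add: levy_h_def)
qed

lemma h_inj: "inj_on h S"
  by (rule linorder_inj_onI') (use h_less S_S0 in \<open>auto simp: less_le\<close>)

lemma h_le: "x \<in> S0 \<Longrightarrow> y \<in> S0 \<Longrightarrow> x \<le> y \<Longrightarrow> h x \<le> h y"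
  using h_less[of x y] by (cases "x = y") auto

text \<open>\<open>h\<close> is a subgradient of \<open>\<Phi>\<close>. The convexity inequality is
  integrated as it stands, so \<open>\<Phi>\<close> is never differentiated under the
  integral.\<close>

lemma \<Phi>_tangent:
  assumes "x \<in> S0" "y \<in> S0"
  shows "\<Phi> x + h x * (y - x) \<le> \<Phi> y"
proof -
  have "\<Phi> x + h x * (y - x) = (LINT u|\<nu>. exp_rem (x * norm u) + norm u * (exp (x * norm u) - 1) * (y - x))"
    using int_rem[OF assms(1)] int0[OF assms(1)] by (simp add: \<Phi>_def levy_h_def)
  also have "\<dots> \<le> \<Phi> y"
    unfolding \<Phi>_def
  proof (rule integral_mono)
    show "exp_rem (x * norm u) + norm u * (exp (x * norm u) - 1) * (y - x) \<le> exp_rem (y * norm u)" for u :: 'a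
      using exp_rem_tangent[of "x * norm u" "y * norm u"] by (simp add: algebra_simps)
  qed (use int_rem int0 assms in auto)
  finally show ?thesis .
qed

text \<open>\<open>h\<close> is monotone, so its left limit is a supremum, finite or not. A level
  below the limit is therefore exceeded at some point of \<open>S\<close>.\<close>

lemma left_limit_eq: "left_limit h T = (SUP s\<in>S. ereal (h s))"
  unfolding left_limit_def
proof (rule tendsto_Lim[OF at_left_ereal_neq_bot[OF T] order_tendstoI])
  fix a assume "a < (SUP s\<in>S. ereal (h s))"
  then obtain s where s: "s \<in> S" "a < ereal (h s)" by (auto simp: less_SUP_iff)
  show "eventually (\<lambda>x. a < ereal (h (real_of_ereal x))) (at_left T)"
  proof (rule eventually_at_left_ereal)
    show "ereal s < T" using s by (simp add: S_def)
    fix r assume r: "s < r" "ereal r < T"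
    then have "h s \<le> h r" using s by (intro h_le) (auto simp: S_def S0_def)
    then show "a < ereal (h (real_of_ereal (ereal r)))" using s by (simp add: order_less_le_trans)
  qed
next
  fix a assume a: "(SUP s\<in>S. ereal (h s)) < a"
  show "eventually (\<lambda>x. ereal (h (real_of_ereal x)) < a) (at_left T)"
  proof (rule eventually_at_left_ereal)
    show "ereal 0 < T" using T by (simp add: zero_ereal_def)
    fix r assume "0 < r" "ereal r < T"
    then have "ereal (h r) \<le> (SUP s\<in>S. ereal (h s))" by (intro SUP_upper) (auto simp: S_def)
    then show "ereal (h (real_of_ereal (ereal r))) < a" using a by simp
  qed
qed

definition "k = levy_h_inv \<nu> T"

lemma k_h: "s \<in> S \<Longrightarrow> k (h s) = s"
  using the_inv_into_f_f[OF h_inj] by (simp add: k_def levy_h_inv_def S_def)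

lemma h_surj:
  assumes y: "0 < y" "ereal y < left_limit h T"
  obtains s where "s \<in> S" "h s = y"
proof -
  obtain b where b: "b \<in> S" "y < h b"
    using y(2) by (auto simp: left_limit_eq less_SUP_iff)
  have b0: "0 < b" using b by (simp add: S_def)
  \<comment> \<open>Convexity and \<open>h 0 = 0\<close> give
    \<open>h (t * b) \<le> t * h b \<le> y / 2\<close>, a starting point below the level
    \<open>y\<close> for the intermediate value theorem.\<close>
  define t where "t = min (1/2) (y / (2 * h b))"
  have hb: "0 < h b" using b y by linarith
  have t: "0 < t" "t < 1" "t * h b \<le> y / 2"
  proof -
    have "t * h b \<le> y / (2 * h b) * h b" using hb by (intro mult_right_mono) (auto simp: t_def)
    then show "t * h b \<le> y / 2" using hb by simp
  qed (use y hb in \<open>auto simp: t_def\<close>)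
  have "h ((1 - t) *\<^sub>R 0 + t *\<^sub>R b) \<le> (1 - t) * h 0 + t * h b"
    using t b by (intro convex_onD[OF h_convex]) (auto simp: S_S0)
  then have low: "h (t * b) \<le> y" using t(3) y(1) by (simp add: h_0)
  have tb: "0 < t * b" "t * b \<le> b" using t b0 by auto
  have "\<exists>x\<ge>t * b. x \<le> b \<and> h x = y"
  proof (rule IVT)
    show "\<forall>x. t * b \<le> x \<and> x \<le> b \<longrightarrow> isCont h x"
      using h_isCont S_interval[OF b(1)] tb by auto
  qed (use low b tb in auto)
  then obtain x where "t * b \<le> x" "x \<le> b" "h x = y" by blast
  then show thesis using that S_interval[OF b(1), of x] tb by auto
qed

lemma k_props:
  assumes "0 < y" "ereal y < left_limit h T"
  shows "k y \<in> S" "h (k y) = y"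
  using h_surj[OF assms] k_h by metis+

lemma k_less:
  assumes "0 < x" "x < y" "ereal y < left_limit h T"
  shows "k x < k y"
proof -
  have x: "ereal x < left_limit h T" using assms by (metis ereal_less_eq(3) less_imp_le order_le_less_trans)
  show ?thesis
  proof (rule ccontr)
    assume "\<not> ?thesis"
    then have "h (k y) \<le> h (k x)"
      using k_props[of x] k_props[of y] assms x by (intro h_le) (auto simp: S_S0)
    then show False using k_props[of x] k_props[of y] assms x by simp
  qed
qed

lemma k_isCont:
  assumes y: "0 < y" "ereal y < left_limit h T"
  shows "isCont k y"
proof -
  note ky = k_props[OF y]
  have "\<exists>e>0. ball (k y) e \<subseteq> S" using S_open ky open_contains_ball by blast
  then obtain e where e: "e > 0" "ball (k y) e \<subseteq> S" by blast
  have sub: "z \<in> S" if "k y - e/2 \<le> z" "z \<le> k y + e/2" for z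
    using that e by (intro subsetD[OF e(2)]) (auto simp: dist_real_def abs_if)
  have "isCont k (h (k y))"
    by (rule isCont_inverse_function2[of "k y - e/2" _ "k y + e/2"]) (use e sub k_h h_isCont in auto)
  then show ?thesis by (simp add: ky)
qed

text \<open>The Legendre transform of \<open>\<Phi>\<close>: by \<open>F_ge\<close> the supremum of
  \<open>y * s - \<Phi> s\<close> over \<open>s\<close> is attained at
  \<open>s = k y\<close>.\<close>

definition "F y = y * k y - \<Phi> (k y)"

lemma F_ge:
  assumes "0 < y" "ereal y < left_limit h T" and "s \<in> S0"
  shows "y * s - \<Phi> s \<le> F y"
  using \<Phi>_tangent[of "k y" s] k_props[OF assms(1,2)] assms(3) by (simp add: F_def S_S0 algebra_simps)

text \<open>Envelope argument: testing the supremum for \<open>z\<close> with the maximiser for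
  \<open>y\<close>, and conversely, puts the difference quotient of \<open>F\<close> between
  \<open>k y\<close> and \<open>k z\<close>; continuity of \<open>k\<close> finishes.\<close>

lemma F_deriv:
  assumes y: "0 < y" "ereal y < left_limit h T"
  shows "DERIV F y :> k y"
proof -
  obtain b where b: "b \<in> S" "y < h b" using y(2) by (auto simp: left_limit_eq less_SUP_iff)
  have ub: "ereal z < left_limit h T" if "z < h b" for z
    using b that by (auto simp: left_limit_eq less_SUP_iff)
  have D: "k y * (z - y) \<le> F z - F y" "F z - F y \<le> k z * (z - y)" if "0 < z" "z < h b" for z
    using F_ge[of z "k y"] F_ge[of y "k z"] k_props[of z] k_props[of y] that y ub[OF that(2)]
    by (auto simp: F_def S_S0 algebra_simps)
  have close: "\<bar>(F z - F y) / (z - y) - k y\<bar> \<le> \<bar>k z - k y\<bar>" if "0 < z" "z < h b" "z \<noteq> y" for z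
  proof (cases "y < z")
    case True
    then have "k y \<le> (F z - F y) / (z - y)" "(F z - F y) / (z - y) \<le> k z"
      using D[OF that(1,2)] by (auto simp: le_divide_eq divide_le_eq)
    then show ?thesis by auto
  next
    case False
    then have "(F z - F y) / (z - y) \<le> k y" "k z \<le> (F z - F y) / (z - y)"
      using D[OF that(1,2)] that(3) by (auto simp: le_divide_eq divide_le_eq)
    then show ?thesis by auto
  qed
  have "((\<lambda>z. (F z - F y) / (z - y) - k y) \<longlongrightarrow> 0) (at y)"
  proof (rule Lim_null_comparison)
    have "eventually (\<lambda>z. z \<in> {0<..<h b}) (at y)"
      using y b by (intro eventually_at_in_open') auto
    then show "eventually (\<lambda>z. norm ((F z - F y) / (z - y) - k y) \<le> \<bar>k z - k y\<bar>) (at y)"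
      using eventually_neq_at_within[of y y UNIV] by eventually_elim (use close in auto)
    have "((\<lambda>z. k z - k y) \<longlongrightarrow> k y - k y) (at y)"
      using k_isCont[OF y] by (intro tendsto_intros) (simp add: isCont_def)
    then show "((\<lambda>z. \<bar>k z - k y\<bar>) \<longlongrightarrow> 0) (at y)" by (simp add: tendsto_rabs_zero)
  qed
  then show ?thesis
    unfolding has_field_derivative_iff by (rule LIM_zero_cancel)
qed

text \<open>\<open>F\<close> is an antiderivative of the inverse. At the endpoint 0 the inverse is
  unspecified, so only a one-sided limit is available there; it comes from
  \<open>0 \<le> F y \<le> y * k d\<close>.\<close>

lemma LBINT_k:
  assumes d: "0 < d" "ereal d < left_limit h T"
  shows "(LBINT y=0..ereal d. levy_h_inv \<nu> T y) = F d"
proof -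
  have ub: "ereal z < left_limit h T" if "z \<le> d" for z
    using d(2) that by (metis ereal_less_eq(3) order_le_less_trans)
  have kd: "0 < k z" if "0 < z" "z \<le> d" for z using k_props[OF that(1) ub[OF that(2)]] by (simp add: S_def)
  have "(LBINT y=ereal 0..ereal d. k y) = F d - 0"
  proof (rule interval_integral_FTC_nonneg(2))
    show "AE x in lborel. ereal 0 < ereal x \<longrightarrow> ereal x < ereal d \<longrightarrow> 0 \<le> k x"
      using kd by (auto simp: less_imp_le)
    have "(F \<longlongrightarrow> 0) (at_right 0)"
    proof (rule tendsto_sandwich[where f = "\<lambda>_. 0" and h = "\<lambda>y. y * k d"])
      have ev: "eventually (\<lambda>y. y \<in> {0<..<d}) (at_right 0)"
        using d by (auto simp: eventually_at_right_field intro: exI[of _ d])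
      then show "eventually (\<lambda>y. 0 \<le> F y) (at_right 0)"
      proof eventually_elim
        case (elim y)
        then show ?case using F_ge[of y 0] ub[of y] by (simp add: \<Phi>_0 S_S0)
      qed
      show "eventually (\<lambda>y. F y \<le> y * k d) (at_right 0)"
        using ev
      proof eventually_elim
        case (elim y)
        have "0 \<le> \<Phi> (k y)" unfolding \<Phi>_def by (intro integral_nonneg_AE) simp
        moreover have "y * k y \<le> y * k d" using k_less[of y d] elim d by (intro mult_left_mono) auto
        ultimately show ?case by (simp add: F_def)
      qed
      have "((\<lambda>y. y * k d) \<longlongrightarrow> 0 * k d) (at_right 0)" by (intro tendsto_intros)
      then show "((\<lambda>y. y * k d) \<longlongrightarrow> 0) (at_right 0)" by simp
    qed simp
    then show "((F \<circ> real_of_ereal) \<longlongrightarrow> 0) (at_right (ereal 0))"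
      by (simp only: ereal_tendsto_simps1)
    have "isCont F d" using F_deriv[OF d] by (rule DERIV_isCont)
    then have "(F \<longlongrightarrow> F d) (at_left d)" by (simp add: isCont_def filterlim_at_split)
    then show "((F \<circ> real_of_ereal) \<longlongrightarrow> F d) (at_left (ereal d))"
      by (simp only: ereal_tendsto_simps1)
  qed (use d F_deriv k_isCont ub in \<open>auto simp: less_imp_le\<close>)
  then show ?thesis by (simp add: k_def zero_ereal_def)
qed

text \<open>Two levels are kept: the integral stops at \<open>d\<close>, while the Chernoff bound is
  to be run at \<open>e\<close>. Since \<open>F d \<le> e * k d - \<Phi> (k d) \<le> F e\<close>,
  the tilt \<open>s = k e\<close> that is optimal for \<open>e\<close> serves both.\<close>

lemma levy_h_inv_integral_le:
  assumes d: "0 < d" "d \<le> e" "ereal e < left_limit h T"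
  obtains s where "0 < s" "ereal s < T" "integrable \<nu> (\<lambda>u. exp_rem (s * norm u))"
    "(LBINT y=0..ereal d. levy_h_inv \<nu> T y) \<le> s * e - (LINT u|\<nu>. exp_rem (s * norm u))"
proof -
  have d': "ereal d < left_limit h T" using d by (metis ereal_less_eq(3) order_le_less_trans)
  have ke: "k e \<in> S" and kd: "k d \<in> S" using k_props[of e] k_props[of d] d d' by auto
  show thesis
  proof (rule that[of "k e"])
    show "0 < k e" "ereal (k e) < T" using ke by (auto simp: S_def)
    show "integrable \<nu> (\<lambda>u. exp_rem (k e * norm u))" using int_rem ke by (simp add: S_S0)
    have "(LBINT y=0..ereal d. levy_h_inv \<nu> T y) = d * k d - \<Phi> (k d)"
      using LBINT_k[OF d(1) d'] by (simp add: F_def)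
    also have "\<dots> \<le> e * k d - \<Phi> (k d)" using d kd by (auto simp: S_def intro!: mult_right_mono)
    also have "\<dots> \<le> F e" using F_ge[of e "k d"] d kd by (auto simp: S_S0)
    finally show "(LBINT y=0..ereal d. levy_h_inv \<nu> T y) \<le> k e * e - (LINT u|\<nu>. exp_rem (k e * norm u))"
      by (simp add: F_def \<Phi>_def mult.commute)
  qed
qed

end

text \<open>If the integral defining \<open>h\<close> diverges at some \<open>s < T\<close> then it does so on all of \<open>(s, T)\<close>,
  where \<open>levy_h\<close> takes the junk value \<open>0\<close>; so a positive left limit excludes divergence.\<close>
lemma levy_tilt_if_left_limit_pos:
  assumes \<nu>: "levy_measure \<nu>" and T: "0 < T" and pos: "0 < left_limit (levy_h \<nu>) T"
  shows "levy_tilt \<nu> T"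
proof (unfold_locales; (fact \<nu> T)?)
  fix s assume s: "0 < s" "ereal s < T"
  note [measurable_cong] = \<nu>[unfolded levy_measure_def, THEN conjunct1]
  show "integrable \<nu> (\<lambda>u. norm u * (exp (s * norm u) - 1))"
  proof (rule ccontr)
    assume n: "\<not> ?thesis"
    have z: "levy_h \<nu> r = 0" if "s < r" for r
    proof -
      have "\<not> integrable \<nu> (\<lambda>u. norm u * (exp (r * norm u) - 1))"
      proof
        assume "integrable \<nu> (\<lambda>u. norm u * (exp (r * norm u) - 1))"
        then have "integrable \<nu> (\<lambda>u. norm u * (exp (s * norm u) - 1))"
          by (rule Bochner_Integration.integrable_bound)
            (use that s in \<open>auto simp: abs_mult intro!: AE_I2 mult_left_mono mult_right_mono\<close>)
        with n show False by simp
      qed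
      then show ?thesis by (simp add: levy_h_def not_integrable_integral_eq)
    qed
    have "left_limit (levy_h \<nu>) T = 0"
      unfolding left_limit_def
    proof (rule tendsto_Lim[OF at_left_ereal_neq_bot[OF T] tendsto_eventually])
      show "eventually (\<lambda>x. ereal (levy_h \<nu> (real_of_ereal x)) = 0) (at_left T)"
        by (rule eventually_at_left_ereal[OF s(2)]) (simp add: z)
    qed
    with pos show False by simp
  qed
qed

text \<open>The full deviation \<open>\<delta>\<close> goes into the Chernoff bound;
  \<open>d\<close> enters only as the end of the integral. That \<open>\<delta>\<close> lies below
  the left limit does double duty: it forces the integral defining \<open>levy_h\<close> to converge
  on \<open>(0, T)\<close>, and it places \<open>\<delta>\<close> in the range of
  \<open>levy_h\<close>.\<close>

theorem ID_concentration:
  fixes \<mu> \<nu> :: "'a::euclidean_space measure" and f :: "'a \<Rightarrow> real"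
  assumes \<mu>: "prob_space \<mu>" and \<mu>S [measurable_cong]: "sets \<mu> = sets borel" and ID: "has_ID_law \<mu> \<beta> \<nu>"
    and mom: "0 < t" "exp_moment \<mu> t < \<infinity>"
    and lip: "\<And>x y. \<bar>f x - f y\<bar> \<le> norm (x - y)"
    and d: "0 < d" "d \<le> \<delta>" "ereal \<delta> < left_limit (levy_h \<nu>) (exp_moment_sup \<mu>)"
  shows "measure \<mu> {x. \<delta> \<le> f x - (LINT x|\<mu>. f x)} \<le>
    exp (- (LBINT s=0..ereal d. levy_h_inv \<nu> (exp_moment_sup \<mu>) s))"
proof -
  interpret prob_space \<mu> by fact
  have sp: "space \<mu> = UNIV" using sets_eq_imp_space_eq[OF \<mu>S] by simp
  have [measurable]: "f \<in> borel_measurable borel"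
    using lip by (intro borel_measurable_continuous_onI uniformly_continuous_imp_continuous
        lipschitz_imp_uniformly_continuous[of _ 1]) auto
  \<comment> \<open>One finite exponential moment dominates \<open>norm x\<close>, and
    \<open>f\<close> grows at most linearly.\<close>
  have intf: "integrable \<mu> f"
  proof (rule Bochner_Integration.integrable_bound)
    have "integrable \<mu> (\<lambda>x. exp (t * norm x))"
      using mom by (intro integrableI_bounded) (auto simp: exp_moment_def)
    then show "integrable \<mu> (\<lambda>x. \<bar>f 0\<bar> + exp (t * norm x) / t)" by simp
    have "norm (f x) \<le> norm (\<bar>f 0\<bar> + exp (t * norm x) / t)" for x
    proof -
      have "t * norm x \<le> exp (t * norm x)" using exp_ge_add_one_self[of "t * norm x"] by linarith
      then have "norm x \<le> exp (t * norm x) / t" using mom by (simp add: field_simps)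
      then show ?thesis using lip[of x 0] by simp
    qed
    then show "AE x in \<mu>. norm (f x) \<le> norm (\<bar>f 0\<bar> + exp (t * norm x) / t)" by simp
  qed simp
  have "ereal t \<le> exp_moment_sup \<mu>"
    unfolding exp_moment_sup_def using mom by (intro Sup_upper) auto
  then have T: "0 < exp_moment_sup \<mu>" using mom by (metis ereal_less(2) order_less_le_trans)
  have "0 < left_limit (levy_h \<nu>) (exp_moment_sup \<mu>)"
    using d by (metis ereal_less(2) order_less_le_trans order_less_trans)
  then interpret levy_tilt \<nu> "exp_moment_sup \<mu>"
    using ID T by (intro levy_tilt_if_left_limit_pos) (auto simp: has_ID_law_def)
  obtain s where s: "0 < s" "integrable \<nu> (\<lambda>u. exp_rem (s * norm u))"
    and le: "(LBINT y=0..ereal d. levy_h_inv \<nu> (exp_moment_sup \<mu>) y) \<le> s * \<delta> - (LINT u|\<nu>. exp_rem (s * norm u))"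
    using levy_h_inv_integral_le[OF d] by metis
  define H where "H = (LINT u|\<nu>. exp_rem (s * norm u))"
  have H: "(\<integral>\<^sup>+u. ennreal (exp_rem (s * norm u)) \<partial>\<nu>) \<le> ennreal H" "0 \<le> H"
    using s by (auto simp: H_def nn_integral_eq_integral intro!: integral_nonneg_AE)
  have "measure \<mu> {x. \<delta> \<le> f x - (LINT x|\<mu>. f x)} \<le> exp (H - s * \<delta>)"
    using chernoff_bound[OF \<mu> _ mgf_ID[OF \<mu> \<mu>S ID lip intf _ H] s(1), of \<delta>] s(1) by (simp add: sp)
  also have "\<dots> \<le> exp (- (LBINT y=0..ereal d. levy_h_inv \<nu> (exp_moment_sup \<mu>) y))"
    using le by (simp add: H_def)
  finally show ?thesis .
qed

section \<open>Stable laws\<close>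

text \<open>The power series of \<open>exp_rem\<close> starts in degree 2 with nonnegative
  coefficients, so each term shrinks at least by the factor \<open>\<theta>\<^sup>2\<close>.
  Exponential remainders of truncated jumps are thereby reduced to a second moment.\<close>

lemma exp_rem_scale_le:
  assumes "0 \<le> \<theta>" "\<theta> \<le> 1" "0 \<le> y"
  shows "exp_rem (\<theta> * y) \<le> \<theta>\<^sup>2 * exp_rem y"
proof -
  have series: "exp_rem x = (\<Sum>n. inverse (fact (n + 2)) *\<^sub>R (x ^ (n + 2)))" for x
    using exp_first_two_terms[of x] by (simp add: exp_rem_def)
  have sum: "summable (\<lambda>n. inverse (fact (n + 2)) *\<^sub>R (x ^ (n + 2)))" for x :: real
    using summable_ignore_initial_segment[OF summable_exp_generic[of x], of 2] by (simp add: scaleR_conv_of_real)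
  have "exp_rem (\<theta> * y) \<le> (\<Sum>n. \<theta>\<^sup>2 * (inverse (fact (n + 2)) *\<^sub>R (y ^ (n + 2))))"
    unfolding series
  proof (rule suminf_le)
    fix n
    have "\<theta> ^ (n + 2) \<le> \<theta>\<^sup>2" using assms by (intro power_decreasing) auto
    then have "\<theta> ^ (n + 2) * (y ^ (n + 2) / fact (n + 2)) \<le> \<theta>\<^sup>2 * (y ^ (n + 2) / fact (n + 2))"
      using assms by (intro mult_right_mono) auto
    then show "inverse (fact (n + 2)) *\<^sub>R ((\<theta> * y) ^ (n + 2)) \<le> \<theta>\<^sup>2 * (inverse (fact (n + 2)) *\<^sub>R (y ^ (n + 2)))"
      by (simp only: power_mult_distrib real_scaleR_def divide_inverse mult_ac)
  qed (use sum sum[of y, THEN summable_mult] in auto)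
  also have "\<dots> = \<theta>\<^sup>2 * exp_rem y" unfolding series by (rule suminf_mult[OF sum])
  finally show ?thesis .
qed

section \<open>Radial integrals of the stable Levy measure\<close>

lemma nn_integral_powr_at_top:
  fixes \<alpha> R :: real
  assumes "0 < \<alpha>" "0 < R"
  shows "(\<integral>\<^sup>+r. ennreal (1 / r powr (1 + \<alpha>)) * indicator {R<..} r \<partial>lborel) = ennreal (R powr (-\<alpha>) / \<alpha>)"
proof -
  let ?F = "\<lambda>r. - (r powr (-\<alpha>) / \<alpha>)"
  have pw: "r powr (-\<alpha> - 1) = 1 / r powr (1 + \<alpha>)" if "0 < r" for r
    using powr_minus_divide[of r "1 + \<alpha>"] by (simp add: minus_diff_commute)
  have D: "DERIV ?F r :> 1 / r powr (1 + \<alpha>)" if "0 < r" for r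
    using that assms by (auto intro!: derivative_eq_intros simp: pw)
  have eq: "einterval (ereal R) \<infinity> = {R<..}" by (auto simp: einterval_def)
  have lim: "((?F \<circ> real_of_ereal) \<longlongrightarrow> - (R powr (-\<alpha>) / \<alpha>)) (at_right (ereal R))"
    "((?F \<circ> real_of_ereal) \<longlongrightarrow> 0) (at_left \<infinity>)"
  proof -
    have "isCont ?F R" using D[OF assms(2)] by (rule DERIV_isCont)
    then show "((?F \<circ> real_of_ereal) \<longlongrightarrow> - (R powr (-\<alpha>) / \<alpha>)) (at_right (ereal R))"
      unfolding ereal_tendsto_simps1 by (simp add: isCont_def filterlim_at_split)
    have "((\<lambda>r. r powr (-\<alpha>)) \<longlongrightarrow> 0) at_top"
      using assms by (intro tendsto_neg_powr filterlim_ident) auto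
    then have "(?F \<longlongrightarrow> - (0 / \<alpha>)) at_top"
      using assms by (intro tendsto_intros) auto
    then show "((?F \<circ> real_of_ereal) \<longlongrightarrow> 0) (at_left \<infinity>)"
      unfolding ereal_tendsto_simps1 by simp
  qed
  have cont: "isCont (\<lambda>r. 1 / r powr (1 + \<alpha>)) r" if "0 < r" for r
    using that by (intro continuous_intros) auto
  note FTC = interval_integral_FTC_nonneg[where F = ?F and f = "\<lambda>r. 1 / r powr (1 + \<alpha>)", OF _ _ _ _ lim]
  have i: "set_integrable lborel {R<..} (\<lambda>r. 1 / r powr (1 + \<alpha>))"
    using FTC(1) D cont assms by (simp add: eq)
  have v: "(LBINT r=ereal R..\<infinity>. 1 / r powr (1 + \<alpha>)) = R powr (-\<alpha>) / \<alpha>"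
    using FTC(2) D cont assms by simp
  have "(\<integral>\<^sup>+r. ennreal (1 / r powr (1 + \<alpha>)) * indicator {R<..} r \<partial>lborel) =
      (\<integral>\<^sup>+r. ennreal (indicator {R<..} r *\<^sub>R (1 / r powr (1 + \<alpha>))) \<partial>lborel)"
    by (intro nn_integral_cong) (auto simp: indicator_def)
  also have "\<dots> = ennreal (LINT r|lborel. indicator {R<..} r *\<^sub>R (1 / r powr (1 + \<alpha>)))"
    using i unfolding set_integrable_def by (intro nn_integral_eq_integral) auto
  also have "(LINT r|lborel. indicator {R<..} r *\<^sub>R (1 / r powr (1 + \<alpha>))) = R powr (-\<alpha>) / \<alpha>"
    using v by (simp add: interval_lebesgue_integral_def set_lebesgue_integral_def eq)
  finally show ?thesis .
qed

lemma nn_integral_powr_at_0: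
  fixes \<alpha> R :: real
  assumes "\<alpha> < 2" "0 < R"
  shows "(\<integral>\<^sup>+r. ennreal (r\<^sup>2 * (1 / r powr (1 + \<alpha>))) * indicator {0<..R} r \<partial>lborel) = ennreal (R powr (2 - \<alpha>) / (2 - \<alpha>))"
proof -
  let ?F = "\<lambda>r. r powr (2 - \<alpha>) / (2 - \<alpha>)" and ?f = "\<lambda>r. r\<^sup>2 * (1 / r powr (1 + \<alpha>))"
  have pw: "r powr (1 - \<alpha>) = ?f r" if "0 < r" for r
  proof -
    have "?f r = r powr 2 / r powr (1 + \<alpha>)" using that by (simp add: powr_numeral)
    also have "\<dots> = r powr (2 - (1 + \<alpha>))" by (rule powr_diff[symmetric])
    finally show ?thesis by (simp add: algebra_simps)
  qed
  have D: "DERIV ?F r :> ?f r" if "0 < r" for r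
  proof -
    have "DERIV ?F r :> r powr (1 - \<alpha>)"
      using that assms by (auto intro!: derivative_eq_intros)
    then show ?thesis using pw[OF that] by simp
  qed
  have eq: "einterval (ereal 0) (ereal R) = {0<..<R}" by (auto simp: einterval_def)
  have lim: "((?F \<circ> real_of_ereal) \<longlongrightarrow> 0) (at_right (ereal 0))"
    "((?F \<circ> real_of_ereal) \<longlongrightarrow> R powr (2 - \<alpha>) / (2 - \<alpha>)) (at_left (ereal R))"
  proof -
    have "isCont ?F R" using D[OF assms(2)] by (rule DERIV_isCont)
    then show "((?F \<circ> real_of_ereal) \<longlongrightarrow> R powr (2 - \<alpha>) / (2 - \<alpha>)) (at_left (ereal R))"
      unfolding ereal_tendsto_simps1 by (simp add: isCont_def filterlim_at_split)
    have "((\<lambda>r::real. r powr (2 - \<alpha>)) \<longlongrightarrow> 0 powr (2 - \<alpha>)) (at_right 0)"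
      using assms eventually_at_right_less[of "0::real"]
      by (intro tendsto_powr' tendsto_intros) (auto elim: eventually_mono)
    then have "(?F \<longlongrightarrow> 0 / (2 - \<alpha>)) (at_right 0)"
      using assms by (intro tendsto_intros) auto
    then show "((?F \<circ> real_of_ereal) \<longlongrightarrow> 0) (at_right (ereal 0))"
      unfolding ereal_tendsto_simps1 by simp
  qed
  have cont: "isCont ?f r" if "0 < r" for r
    using that by (intro continuous_intros) auto
  note FTC = interval_integral_FTC_nonneg[where F = ?F and f = ?f, OF _ _ _ _ lim]
  have i: "set_integrable lborel {0<..<R} ?f"
    using FTC(1) D cont assms by (simp add: eq)
  have v: "(LBINT r=ereal 0..ereal R. ?f r) = R powr (2 - \<alpha>) / (2 - \<alpha>)"
    using FTC(2) D cont assms by simp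
  have "(\<integral>\<^sup>+r. ennreal (?f r) * indicator {0<..R} r \<partial>lborel) =
      (\<integral>\<^sup>+r. ennreal (indicator {0<..<R} r *\<^sub>R ?f r) \<partial>lborel)"
    by (intro nn_integral_cong_AE, rule AE_mp[OF AE_lborel_singleton[of R]]) (auto simp: indicator_def)
  also have "\<dots> = ennreal (LINT r|lborel. indicator {0<..<R} r *\<^sub>R ?f r)"
    using i unfolding set_integrable_def by (intro nn_integral_eq_integral) auto
  also have "(LINT r|lborel. indicator {0<..<R} r *\<^sub>R ?f r) = R powr (2 - \<alpha>) / (2 - \<alpha>)"
    using v assms unfolding interval_lebesgue_integral_def set_lebesgue_integral_def eq by simp
  finally show ?thesis .
qed

context
  fixes \<alpha> :: real and \<sigma> \<nu> :: "'a::euclidean_space measure"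
  assumes form: "stable_levy_form \<alpha> \<sigma> \<nu>" and \<nu>S: "sets \<nu> = sets borel"
begin

lemma sets_spherical: "sets \<sigma> = sets (restrict_space borel (sphere 0 1))"
  using form by (simp add: stable_levy_form_def)

lemma space_spherical: "space \<sigma> = sphere 0 1"
  using sets_eq_imp_space_eq[OF sets_spherical] by (simp add: space_restrict_space)

text \<open>The formula for sets says that \<open>\<nu>\<close> is the image of
  \<open>\<sigma>\<close> times \<open>dr / r^(1 + \<alpha>)\<close> under
  \<open>(\<xi>, r) \<mapsto> r \<xi>\<close>; as an equality of measures it extends from sets to
  functions.\<close>

lemma nn_integral_stable:
  assumes [measurable]: "f \<in> borel_measurable borel"
  shows "(\<integral>\<^sup>+u. f u \<partial>\<nu>) =
    (\<integral>\<^sup>+\<xi>. (\<integral>\<^sup>+r. f (r *\<^sub>R \<xi>) * ennreal (1 / r powr (1 + \<alpha>)) * indicator {0<..} r \<partial>lborel) \<partial>\<sigma>)"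
proof -
  have [measurable]: "(\<lambda>x. x) \<in> \<sigma> \<rightarrow>\<^sub>M borel"
    unfolding measurable_cong_sets[OF sets_spherical refl] by (rule measurable_restrict_space1) simp
  define w where "w p = ennreal (1 / snd p powr (1 + \<alpha>)) * indicator {0<..} (snd p)" for p :: "'a \<times> real"
  have [measurable]: "w \<in> borel_measurable (\<sigma> \<Otimes>\<^sub>M lborel)" unfolding w_def by measurable
  have [measurable]: "(\<lambda>p. snd p *\<^sub>R fst p) \<in> \<sigma> \<Otimes>\<^sub>M lborel \<rightarrow>\<^sub>M borel"
    by (intro borel_measurable_scaleR measurable_compose[OF measurable_fst]) measurable
  define M where "M = distr (density (\<sigma> \<Otimes>\<^sub>M lborel) w) borel (\<lambda>p. snd p *\<^sub>R fst p)"
  have M: "(\<integral>\<^sup>+u. g u \<partial>M) = (\<integral>\<^sup>+\<xi>. (\<integral>\<^sup>+r. g (r *\<^sub>R \<xi>) * ennreal (1 / r powr (1 + \<alpha>)) * indicator {0<..} r \<partial>lborel) \<partial>\<sigma>)"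
    if [measurable]: "g \<in> borel_measurable borel" for g
  proof -
    have "(\<integral>\<^sup>+u. g u \<partial>M) = (\<integral>\<^sup>+p. w p * g (snd p *\<^sub>R fst p) \<partial>(\<sigma> \<Otimes>\<^sub>M lborel))"
      unfolding M_def by (subst nn_integral_distr) (simp_all add: nn_integral_density)
    also have "\<dots> = (\<integral>\<^sup>+\<xi>. (\<integral>\<^sup>+r. w (\<xi>, r) * g (r *\<^sub>R \<xi>) \<partial>lborel) \<partial>\<sigma>)"
      by (subst lborel.nn_integral_fst[symmetric]) simp_all
    finally show ?thesis by (simp add: w_def mult_ac)
  qed
  have "\<nu> = M"
  proof (rule measure_eqI)
    show "sets \<nu> = sets M" by (simp add: M_def \<nu>S)
    fix A assume "A \<in> sets \<nu>"
    then have A [measurable]: "A \<in> sets borel" by (simp add: \<nu>S)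
    have "emeasure M A = (\<integral>\<^sup>+u. indicator A u \<partial>M)" by (simp add: M_def)
    also have "\<dots> = emeasure \<nu> A"
      using form A by (subst M) (auto simp: stable_levy_form_def)
    finally show "emeasure \<nu> A = emeasure M A" by simp
  qed
  then show ?thesis using M[OF assms] by simp
qed

lemma finite_measure_spherical: "finite_measure \<sigma>"
  using form by (simp add: stable_levy_form_def)

lemma stable_tail:
  assumes "0 < \<alpha>" "0 < R"
  shows "emeasure \<nu> {u. R < norm u} = ennreal (measure \<sigma> (sphere 0 1) * (R powr (-\<alpha>) / \<alpha>))"
proof -
  interpret finite_measure \<sigma> by (rule finite_measure_spherical)
  have [measurable]: "{u::'a. R < norm u} \<in> sets borel" by measurable
  have "emeasure \<nu> {u. R < norm u} = (\<integral>\<^sup>+u. indicator {u. R < norm u} u \<partial>\<nu>)"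
    by (simp add: \<nu>S)
  also have "\<dots> = (\<integral>\<^sup>+\<xi>. (\<integral>\<^sup>+r. indicator {u. R < norm u} (r *\<^sub>R \<xi>) * ennreal (1 / r powr (1 + \<alpha>)) * indicator {0<..} r \<partial>lborel) \<partial>\<sigma>)"
    by (rule nn_integral_stable) measurable
  also have "\<dots> = (\<integral>\<^sup>+\<xi>. ennreal (R powr (-\<alpha>) / \<alpha>) \<partial>\<sigma>)"
  proof (rule nn_integral_cong)
    fix \<xi> assume "\<xi> \<in> space \<sigma>"
    then have "norm \<xi> = 1" by (simp add: space_spherical)
    then have "(\<integral>\<^sup>+r. indicator {u. R < norm u} (r *\<^sub>R \<xi>) * ennreal (1 / r powr (1 + \<alpha>)) * indicator {0<..} r \<partial>lborel) =
        (\<integral>\<^sup>+r. ennreal (1 / r powr (1 + \<alpha>)) * indicator {R<..} r \<partial>lborel)"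
      using assms by (intro nn_integral_cong) (auto simp: indicator_def)
    also have "\<dots> = ennreal (R powr (-\<alpha>) / \<alpha>)" by (rule nn_integral_powr_at_top[OF assms])
    finally show "(\<integral>\<^sup>+r. indicator {u. R < norm u} (r *\<^sub>R \<xi>) * ennreal (1 / r powr (1 + \<alpha>)) * indicator {0<..} r \<partial>lborel) = ennreal (R powr (-\<alpha>) / \<alpha>)" .
  qed
  also have "\<dots> = ennreal (measure \<sigma> (sphere 0 1) * (R powr (-\<alpha>) / \<alpha>))"
    using assms by (simp add: space_spherical[symmetric] emeasure_eq_measure mult.commute flip: ennreal_mult)
  finally show ?thesis .
qed

text \<open>For a jump of length \<open>r \<le> R\<close>, \<open>exp_rem_scale_le\<close> with
  \<open>\<theta> = r / R\<close> gives
  \<open>exp_rem (s * r) \<le> (r / R)\<^sup>2 * exp_rem (s * R)\<close>. What remains is the second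
  moment of the jumps up to \<open>R\<close>, the source of
  \<open>1 / (2 - \<alpha>)\<close>.\<close>

lemma stable_truncated_rem:
  assumes "0 < \<alpha>" "\<alpha> < 2" "0 < R" "0 \<le> s"
  shows "(\<integral>\<^sup>+u. ennreal (exp_rem (s * norm (truncate R u))) \<partial>\<nu>) \<le>
    ennreal (measure \<sigma> (sphere 0 1) * (R powr (-\<alpha>) / (2 - \<alpha>)) * exp_rem (s * R))"
proof -
  interpret finite_measure \<sigma> by (rule finite_measure_spherical)
  define c where "c = exp_rem (s * R) / R\<^sup>2"
  have c: "0 \<le> c" by (simp add: c_def)
  have "(\<integral>\<^sup>+u. ennreal (exp_rem (s * norm (truncate R u))) \<partial>\<nu>) =
     (\<integral>\<^sup>+\<xi>. (\<integral>\<^sup>+r. ennreal (exp_rem (s * norm (truncate R (r *\<^sub>R \<xi>)))) * ennreal (1 / r powr (1 + \<alpha>)) * indicator {0<..} r \<partial>lborel) \<partial>\<sigma>)"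
    by (rule nn_integral_stable) measurable
  also have "\<dots> \<le> (\<integral>\<^sup>+\<xi>. ennreal (c * (R powr (2 - \<alpha>) / (2 - \<alpha>))) \<partial>\<sigma>)"
  proof (rule nn_integral_mono)
    fix \<xi> assume "\<xi> \<in> space \<sigma>"
    then have n: "norm \<xi> = 1" by (simp add: space_spherical)
    have "(\<integral>\<^sup>+r. ennreal (exp_rem (s * norm (truncate R (r *\<^sub>R \<xi>)))) * ennreal (1 / r powr (1 + \<alpha>)) * indicator {0<..} r \<partial>lborel) \<le>
        (\<integral>\<^sup>+r. ennreal c * (ennreal (r\<^sup>2 * (1 / r powr (1 + \<alpha>))) * indicator {0<..R} r) \<partial>lborel)"
    proof (rule nn_integral_mono)
      fix r :: real
      show "ennreal (exp_rem (s * norm (truncate R (r *\<^sub>R \<xi>)))) * ennreal (1 / r powr (1 + \<alpha>)) * indicator {0<..} r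
          \<le> ennreal c * (ennreal (r\<^sup>2 * (1 / r powr (1 + \<alpha>))) * indicator {0<..R} r)"
      proof (cases "0 < r \<and> r \<le> R")
        case True
        have "exp_rem ((r / R) * (s * R)) \<le> (r / R)\<^sup>2 * exp_rem (s * R)"
          using True assms by (intro exp_rem_scale_le) auto
        then have "exp_rem (s * r) \<le> c * r\<^sup>2"
          using assms by (simp add: c_def power_divide field_simps)
        then have "exp_rem (s * r) * (1 / r powr (1 + \<alpha>)) \<le> c * r\<^sup>2 * (1 / r powr (1 + \<alpha>))"
          by (intro mult_right_mono) auto
        then show ?thesis
          using True n c by (simp add: truncate_def mult.assoc flip: ennreal_mult)
      next
        case False
        then show ?thesis using n by (auto simp: truncate_def indicator_def)
      qed
    qed
    also have "\<dots> = ennreal c * ennreal (R powr (2 - \<alpha>) / (2 - \<alpha>))"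
      unfolding nn_integral_powr_at_0[OF assms(2,3), symmetric] by (rule nn_integral_cmult) measurable
    also have "ennreal c * ennreal (R powr (2 - \<alpha>) / (2 - \<alpha>)) = ennreal (c * (R powr (2 - \<alpha>) / (2 - \<alpha>)))"
      using c assms by (intro ennreal_mult[symmetric]) auto
    finally show "(\<integral>\<^sup>+r. ennreal (exp_rem (s * norm (truncate R (r *\<^sub>R \<xi>)))) * ennreal (1 / r powr (1 + \<alpha>)) * indicator {0<..} r \<partial>lborel)
        \<le> ennreal (c * (R powr (2 - \<alpha>) / (2 - \<alpha>)))" .
  qed
  also have "\<dots> = ennreal (measure \<sigma> (sphere 0 1) * (c * (R powr (2 - \<alpha>) / (2 - \<alpha>))))"
    using assms c by (simp add: space_spherical[symmetric] emeasure_eq_measure mult.commute flip: ennreal_mult)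
  also have "c * (R powr (2 - \<alpha>) / (2 - \<alpha>)) = R powr (-\<alpha>) / (2 - \<alpha>) * exp_rem (s * R)"
  proof -
    have "R powr (2 - \<alpha>) = R\<^sup>2 * R powr (-\<alpha>)"
      using assms powr_add[of R 2 "-\<alpha>"] by (simp add: powr_numeral)
    then show ?thesis using assms by (simp add: c_def)
  qed
  finally show ?thesis by (simp add: mult.assoc)
qed

end

text \<open>A Lipschitz substitute for an indicator, since the weak convergence of the sums tests
  only against uniformly continuous functions.\<close>

definition ramp :: "real \<Rightarrow> real" where
  "ramp x = max 0 (min 1 x)"

lemma ramp_bounds: "0 \<le> ramp x" "ramp x \<le> 1" "\<bar>ramp x\<bar> \<le> 1"
  by (auto simp: ramp_def)

lemma ramp_eq [simp]: "x \<le> 0 \<Longrightarrow> ramp x = 0" "1 \<le> x \<Longrightarrow> ramp x = 1"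
  by (auto simp: ramp_def)

lemma ramp_lipschitz: "\<bar>ramp x - ramp y\<bar> \<le> \<bar>x - y\<bar>"
  by (auto simp: ramp_def min_def max_def)

lemma uniformly_continuous_ramp:
  fixes f :: "'a::real_normed_vector \<Rightarrow> real"
  assumes "\<And>x y. \<bar>f x - f y\<bar> \<le> C * norm (x - y)" "0 \<le> C"
  shows "uniformly_continuous_on UNIV (\<lambda>x. ramp (f x))"
  using assms by (intro lipschitz_imp_uniformly_continuous[of _ C] order_trans[OF ramp_lipschitz]) auto

text \<open>With \<open>x = s * R\<close> the exact minimiser of \<open>v * exp_rem x - x\<close> is
  \<open>ln (1 + 1 / v)\<close>. The simpler \<open>ln (1 / v)\<close>, positive because
  \<open>v < 1\<close>, leaves at most \<open>1 + ln v\<close> and so produces the constant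
  \<open>e\<close>.\<close>

lemma bennett_exponent:
  fixes v R :: real
  assumes "0 < v" "v < 1" "0 < R"
  defines "s \<equiv> ln (1 / v) / R"
  shows "0 < s" "exp (v * exp_rem (s * R) - s * R) \<le> exp 1 * v"
proof -
  show "0 < s" using assms by (auto simp: s_def ln_div intro: divide_neg_pos)
  have sR: "s * R = - ln v" using assms by (simp add: s_def ln_div)
  have "v * exp_rem (s * R) - s * R = 1 + ln v + v * ln v - v"
    unfolding sR exp_rem_def using assms(1) by (simp add: exp_minus algebra_simps)
  also have "\<dots> \<le> 1 + ln v"
    using assms(1,2) mult_pos_neg[of v "ln v"] ln_less_zero[of v] by linarith
  finally have "exp (v * exp_rem (s * R) - s * R) \<le> exp (1 + ln v)" by simp
  then show "exp (v * exp_rem (s * R) - s * R) \<le> exp 1 * v" using assms by (simp add: exp_add)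
qed

text \<open>The jumps longer than \<open>R\<close> are discarded at the cost \<open>p\<close>, and the remaining sum satisfies
  Bennett's inequality at level \<open>R\<close> with variance proxy \<open>v * R\<^sup>2\<close>.\<close>
lemma iid_sum_deviation:
  fixes Q :: "'a::euclidean_space measure" and f :: "'a \<Rightarrow> real"
  assumes Q: "prob_space Q" and QS [measurable_cong]: "sets Q = sets borel" and m: "0 < m"
    and B: "\<And>x. \<bar>f x\<bar> \<le> B" and lip: "\<And>x y. \<bar>f x - f y\<bar> \<le> norm (x - y)"
    and R: "0 < R" and v: "0 < v" "v < 1" and p0: "0 \<le> p"
    and rem: "\<And>s. 0 \<le> s \<Longrightarrow>
      of_nat m * (\<integral>\<^sup>+u. ennreal (exp_rem (s * norm (truncate R u))) \<partial>Q) \<le> ennreal (v * exp_rem (s * R))"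
    and tail: "of_nat m * emeasure Q {u. R < norm u} \<le> ennreal p"
  shows "measure (iid_sum Q b m) {x. R \<le> f x - (LINT x|iid_sum (distr Q borel (truncate R)) b m. f x)}
    \<le> p + exp 1 * v"
proof -
  define Q' where "Q' = distr Q borel (truncate R)"
  have Q'S [simp, measurable_cong]: "sets Q' = sets borel" by (simp add: Q'_def)
  have tm [measurable]: "truncate R \<in> borel_measurable Q" by measurable
  have Q': "prob_space Q'" unfolding Q'_def by (rule prob_space.prob_space_distr[OF Q tm])
  interpret S: prob_space "iid_sum Q b m" by (rule prob_space_iid_sum[OF Q QS])
  interpret S': prob_space "iid_sum Q' b m" by (rule prob_space_iid_sum[OF Q' Q'S])
  have [measurable]: "f \<in> borel_measurable borel"
    using lip by (intro borel_measurable_continuous_onI uniformly_continuous_imp_continuous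
        lipschitz_imp_uniformly_continuous[of _ 1]) auto
  define s where "s = ln (1 / v) / R"
  note s = bennett_exponent[OF v R, folded s_def]
  define \<psi> where "\<psi> = v * exp_rem (s * R) / m"
  have \<psi>0: "0 \<le> \<psi>" using v by (simp add: \<psi>_def)
  have m': "0 < real m" using m by simp
  have "ennreal (1 / m) * (of_nat m * (\<integral>\<^sup>+u. ennreal (exp_rem (s * norm (truncate R u))) \<partial>Q))
      \<le> ennreal (1 / m) * ennreal (v * exp_rem (s * R))"
    using s by (intro mult_left_mono rem) auto
  moreover have "(\<integral>\<^sup>+u. ennreal (exp_rem (s * norm u)) \<partial>Q') = (\<integral>\<^sup>+u. ennreal (exp_rem (s * norm (truncate R u))) \<partial>Q)"
    unfolding Q'_def by (rule nn_integral_distr[OF tm]) measurable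
  ultimately have \<psi>: "(\<integral>\<^sup>+u. ennreal (exp_rem (s * norm u)) \<partial>Q') \<le> ennreal \<psi>"
    using m' v by (simp add: \<psi>_def ennreal_of_nat_eq_real_of_nat mult.assoc[symmetric] flip: ennreal_mult)
  define E where "E = (LINT x|iid_sum Q' b m. f x)"
  define A where "A = {x. R \<le> f x - E}"
  have [measurable]: "A \<in> sets borel" unfolding A_def by measurable
  have "measure (iid_sum Q' b m) A \<le> exp (v * exp_rem (s * R) - s * R)"
  proof -
    have "s * f x \<le> s * B" for x using B[of x] s by (intro mult_left_mono) auto
    then have "integrable (iid_sum Q' b m) (\<lambda>x. exp (s * f x))"
      by (intro integrable_bounded_prob[OF S'.prob_space_axioms, of _ "exp (s * B)"]) auto
    then have "(\<integral>\<^sup>+x. ennreal (exp (s * f x)) \<partial>iid_sum Q' b m) = ennreal (LINT x|iid_sum Q' b m. exp (s * f x))"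
      by (intro nn_integral_eq_integral) auto
    also have "\<dots> \<le> ennreal (exp (s * E + real m * \<psi>))"
      unfolding E_def using s by (intro ennreal_leI mgf_iid_sum_le[OF Q' Q'S B lip _ \<psi> \<psi>0]) auto
    finally show ?thesis
      using chernoff_bound[OF S'.prob_space_axioms, of f s E "real m * \<psi>" R] s m'
      by (simp add: A_def \<psi>_def)
  qed
  then have A': "measure (iid_sum Q' b m) A \<le> exp 1 * v" using s by linarith
  have "ennreal (measure (iid_sum Q b m) A) = (\<integral>\<^sup>+x. indicator A x \<partial>iid_sum Q b m)"
    by (simp add: S.emeasure_eq_measure)
  also have "\<dots> \<le> (\<integral>\<^sup>+x. indicator A x \<partial>iid_sum Q' b m) + of_nat m * emeasure Q {u. R < norm u}"
    unfolding Q'_def by (rule nn_integral_iid_sum_truncate[OF Q QS]) (auto simp: indicator_def)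
  also have "\<dots> \<le> ennreal (exp 1 * v) + ennreal p"
    using A' by (intro add_mono tail) (simp add: S'.emeasure_eq_measure ennreal_leI)
  also have "\<dots> = ennreal (p + exp 1 * v)"
    using v p0 by (subst ennreal_plus[symmetric]) (auto simp: add.commute)
  finally have "measure (iid_sum Q b m) A \<le> p + exp 1 * v"
    using v p0 by (subst (asm) ennreal_le_iff) auto
  then show ?thesis by (simp add: A_def E_def Q'_def)
qed

text \<open>Under each approximating sum, \<open>f\<close> deviates from its truncated mean
  \<open>e n\<close> by \<open>R\<close>, to either side, with probability at most
  \<open>\<tau> < 1/2\<close>, whereas \<open>{f \<le> M}\<close> has mass at least 1/2 under
  \<open>\<mu>\<close>. So for large \<open>n\<close> the mean \<open>e n\<close> cannot lie far
  above \<open>M\<close>, and a deviation of \<open>f\<close> from \<open>M\<close> by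
  \<open>\<delta>\<close> forces one from \<open>e n\<close> by \<open>R\<close>.\<close>

lemma stable_concentration_bounded:
  fixes \<mu> \<sigma> :: "'a::euclidean_space measure" and f :: "'a \<Rightarrow> real"
  assumes \<mu>: "prob_space \<mu>" and \<mu>S [measurable_cong]: "sets \<mu> = sets borel"
    and \<alpha>: "0 < \<alpha>" "\<alpha> < 2" and stable: "has_stable_law \<mu> \<alpha> \<sigma>"
    and B: "\<And>x. \<bar>f x\<bar> \<le> B" and lip: "\<And>x y. \<bar>f x - f y\<bar> \<le> norm (x - y)"
    and R: "0 < R" "3 * R \<le> \<delta>"
    and med: "1 / 2 \<le> measure \<mu> {x. f x \<le> M}"
  defines "\<tau> \<equiv> measure \<sigma> (sphere 0 1) * R powr (-\<alpha>) * (1 / \<alpha> + exp 1 / (2 - \<alpha>))"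
  assumes \<tau>: "\<tau> < 1 / 2"
  shows "measure \<mu> {x. \<delta> \<le> f x - M} \<le> \<tau>"
proof -
  interpret prob_space \<mu> by fact
  obtain \<beta> \<nu> where ID: "has_ID_law \<mu> \<beta> \<nu>" and form: "stable_levy_form \<alpha> \<sigma> \<nu>"
    using stable by (auto simp: has_stable_law_def)
  have \<nu>S [measurable_cong]: "sets \<nu> = sets borel" and \<nu>0: "emeasure \<nu> UNIV \<noteq> 0"
    using ID by (auto simp: has_ID_law_def levy_measure_def)
  define \<Sigma> where "\<Sigma> = measure \<sigma> (sphere 0 1)"
  \<comment> \<open>Otherwise \<open>\<nu>\<close> would vanish. Positivity of \<open>v\<close>,
    needed for the tilt \<open>ln (1 / v) / R\<close>, rests on this.\<close>
  have "\<Sigma> \<noteq> 0"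
  proof
    assume "\<Sigma> = 0"
    interpret finite_measure \<sigma> by (rule finite_measure_spherical[OF form \<nu>S])
    have "emeasure \<sigma> (space \<sigma>) = 0"
      using \<open>\<Sigma> = 0\<close> by (simp add: \<Sigma>_def emeasure_eq_measure space_spherical[OF form \<nu>S])
    then have "(\<integral>\<^sup>+u. 1 \<partial>\<nu>) = 0"
      using nn_integral_stable[OF form \<nu>S, of "\<lambda>_. 1"] by (simp add: nn_integral_const)
    moreover have "space \<nu> = UNIV" using sets_eq_imp_space_eq[OF \<nu>S] by simp
    ultimately show False using \<nu>0 by simp
  qed
  then have \<Sigma>: "0 < \<Sigma>" by (simp add: \<Sigma>_def zero_less_measure_iff)
  define p where "p = \<Sigma> * (R powr (-\<alpha>) / \<alpha>)"
  define v where "v = \<Sigma> * (R powr (-\<alpha>) / (2 - \<alpha>))"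
  have pv: "0 < p" "0 < v" using \<Sigma> \<alpha> R by (auto simp: p_def v_def)
  have \<tau>_eq: "\<tau> = p + exp 1 * v" by (simp add: \<tau>_def p_def v_def \<Sigma>_def algebra_simps)
  have "1 * v \<le> exp 1 * v" using pv by (intro mult_right_mono) auto
  then have v1: "v < 1" using \<tau> pv unfolding \<tau>_eq by linarith
  obtain Q m b where *: "\<forall>n::nat. prob_space (Q n) \<and> sets (Q n) = sets borel \<and> 0 < m n"
    "\<forall>n f. f \<in> borel_measurable borel \<and> f 0 = 0 \<longrightarrow>
      of_nat (m n) * (\<integral>\<^sup>+u. f u \<partial>Q n) \<le> (\<integral>\<^sup>+u. f u \<partial>\<nu>)"
    "\<forall>f B. uniformly_continuous_on UNIV f \<and> (\<forall>x. \<bar>f x\<bar> \<le> B) \<longrightarrow>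
      (\<lambda>n. LINT x|iid_sum (Q n) (b n) (m n). f x) \<longlonglongrightarrow> (LINT x|\<mu>. f x :: real)"
    using has_ID_law_approx[OF \<mu> \<mu>S ID] by blast
  then have Q: "\<And>n. prob_space (Q n)" and QS [measurable_cong]: "\<And>n. sets (Q n) = sets borel" and m: "\<And>n. 0 < m n"
    and weak: "\<And>f B. uniformly_continuous_on UNIV f \<Longrightarrow> (\<And>x. \<bar>f x\<bar> \<le> B) \<Longrightarrow>
      (\<lambda>n. LINT x|iid_sum (Q n) (b n) (m n). f x) \<longlonglongrightarrow> (LINT x|\<mu>. f x :: real)"
    by blast+
  define S where "S n = iid_sum (Q n) (b n) (m n)" for n
  have S: "prob_space (S n)" and SS [simp, measurable_cong]: "sets (S n) = sets borel" for n
    unfolding S_def using prob_space_iid_sum[OF Q QS] by auto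
  define e where "e n = (LINT x|iid_sum (distr (Q n) borel (truncate R)) (b n) (m n). f x)" for n
  have [measurable]: "f \<in> borel_measurable borel"
    using lip by (intro borel_measurable_continuous_onI uniformly_continuous_imp_continuous
        lipschitz_imp_uniformly_continuous[of _ 1]) auto
  have rem: "of_nat (m n) * (\<integral>\<^sup>+u. ennreal (exp_rem (s * norm (truncate R u))) \<partial>Q n) \<le> ennreal (v * exp_rem (s * R))"
    if "0 \<le> s" for n s
  proof -
    have "of_nat (m n) * (\<integral>\<^sup>+u. ennreal (exp_rem (s * norm (truncate R u))) \<partial>Q n) \<le>
        (\<integral>\<^sup>+u. ennreal (exp_rem (s * norm (truncate R u))) \<partial>\<nu>)"
      by (rule *(2)[rule_format]) (simp add: truncate_def)
    also have "\<dots> \<le> ennreal (v * exp_rem (s * R))"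
      unfolding v_def \<Sigma>_def by (rule stable_truncated_rem[OF form \<nu>S \<alpha> R(1) that])
    finally show ?thesis .
  qed
  have tail: "of_nat (m n) * emeasure (Q n) {u. R < norm u} \<le> ennreal p" for n
  proof -
    have "of_nat (m n) * emeasure (Q n) {u. R < norm u} = of_nat (m n) * (\<integral>\<^sup>+u. indicator {u. R < norm u} u \<partial>Q n)"
      by (simp add: QS)
    also have "\<dots> \<le> (\<integral>\<^sup>+u. indicator {u. R < norm u} u \<partial>\<nu>)"
      using R by (intro *(2)[rule_format]) simp
    also have "\<dots> = ennreal p"
      using stable_tail[OF form \<nu>S \<alpha>(1) R(1)] by (simp add: \<nu>S p_def \<Sigma>_def)
    finally show ?thesis .
  qed
  have up: "measure (S n) {x. R \<le> f x - e n} \<le> \<tau>" for n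
    unfolding S_def e_def \<tau>_eq
    by (rule iid_sum_deviation[OF Q QS m B lip R(1) pv(2) v1 _ rem tail]) (use pv in auto)
  have down: "measure (S n) {x. R \<le> e n - f x} \<le> \<tau>" for n
  proof -
    have "measure (S n) {x. R \<le> - f x - (LINT x|iid_sum (distr (Q n) borel (truncate R)) (b n) (m n). - f x)} \<le> \<tau>"
      unfolding S_def \<tau>_eq
      by (rule iid_sum_deviation[OF Q QS m _ _ R(1) pv(2) v1 _ rem tail])
        (use pv B lip in \<open>auto simp: abs_minus_commute\<close>)
    then show ?thesis by (simp add: e_def algebra_simps)
  qed
  \<comment> \<open>The width of both ramps. The budget \<open>3 * R \<le> \<delta>\<close> is spent
    on \<open>\<eta> + R\<close> to place \<open>e n\<close> below \<open>M + \<eta> + R\<close>, on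
    \<open>\<eta>\<close> for the ramp that starts below \<open>M + \<delta>\<close>, and on
    \<open>R\<close> for the deviation of \<open>f\<close> from \<open>e n\<close>.\<close>
  define \<eta> where "\<eta> = R / 2"
  have \<eta>: "0 < \<eta>" using R by (simp add: \<eta>_def)
  have lipd: "\<bar>f x / \<eta> - f y / \<eta>\<bar> \<le> (1 / \<eta>) * norm (x - y)" for x y
    using lip[of x y] \<eta> by (simp add: abs_divide divide_right_mono flip: diff_divide_distrib)
  have int: "integrable N (\<lambda>x. ramp (g x))" if "prob_space N" "g \<in> borel_measurable N" for N and g :: "'a \<Rightarrow> real"
    using that by (intro integrable_bounded_prob[of _ _ 1]) (auto simp: ramp_bounds ramp_def)
  have dom1: "measure N {x. P x} \<le> (LINT x|N. ramp (g x))"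
    if N: "prob_space N" and NS: "sets N = sets borel" and [measurable]: "g \<in> borel_measurable borel" "Measurable.pred borel P"
      and le: "\<And>x. P x \<Longrightarrow> 1 \<le> g x" for N P and g :: "'a \<Rightarrow> real"
  proof -
    interpret N: prob_space N by fact
    note [measurable_cong] = NS
    have sp: "space N = UNIV" using sets_eq_imp_space_eq[OF NS] by simp
    have "measure N {x. P x} = (LINT x|N. indicator {x. P x} x)"
      by (simp add: sp)
    also have "\<dots> \<le> (LINT x|N. ramp (g x))"
      using le by (intro integral_mono int N integrable_bounded_prob[OF N, of _ 1])
        (auto simp: indicator_def ramp_bounds)
    finally show ?thesis .
  qed
  have dom2: "(LINT x|N. ramp (g x)) \<le> measure N {x. P x}"
    if N: "prob_space N" and NS: "sets N = sets borel" and [measurable]: "g \<in> borel_measurable borel" "Measurable.pred borel P"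
      and le: "\<And>x. \<not> P x \<Longrightarrow> g x \<le> 0" for N P and g :: "'a \<Rightarrow> real"
  proof -
    interpret N: prob_space N by fact
    note [measurable_cong] = NS
    have sp: "space N = UNIV" using sets_eq_imp_space_eq[OF NS] by simp
    have "(LINT x|N. ramp (g x)) \<le> (LINT x|N. indicator {x. P x} x)"
      using le by (intro integral_mono int N integrable_bounded_prob[OF N, of _ 1])
        (auto simp: indicator_def ramp_bounds)
    also have "\<dots> = measure N {x. P x}" by (simp add: sp)
    finally show ?thesis .
  qed
  have "(\<lambda>n. LINT x|S n. ramp ((M + \<eta> - f x) / \<eta>)) \<longlonglongrightarrow> (LINT x|\<mu>. ramp ((M + \<eta> - f x) / \<eta>))"
    unfolding S_def using lipd \<eta>
    by (intro weak[of _ 1] uniformly_continuous_ramp[where C = "1 / \<eta>"])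
      (auto simp: ramp_bounds diff_divide_distrib abs_minus_commute)
  moreover have "\<tau> < (LINT x|\<mu>. ramp ((M + \<eta> - f x) / \<eta>))"
  proof -
    have "measure \<mu> {x. f x \<le> M} \<le> (LINT x|\<mu>. ramp ((M + \<eta> - f x) / \<eta>))"
      using \<eta> by (intro dom1[OF \<mu> \<mu>S]) (auto simp: field_simps)
    then show ?thesis using med \<tau> by linarith
  qed
  ultimately have "eventually (\<lambda>n. \<tau> < (LINT x|S n. ramp ((M + \<eta> - f x) / \<eta>))) sequentially"
    by (rule order_tendstoD)
  \<comment> \<open>If \<open>e n\<close> were at least \<open>M + \<eta> + R\<close>, the ramp
    would be nonzero only where \<open>f\<close> lies at least \<open>R\<close> below
    \<open>e n\<close>, an event of mass at most \<open>\<tau>\<close>.\<close>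
  then have en: "eventually (\<lambda>n. e n < M + \<eta> + R) sequentially"
  proof eventually_elim
    case (elim n)
    show ?case
    proof (rule ccontr)
      assume ge: "\<not> e n < M + \<eta> + R"
      interpret Sn: prob_space "S n" by (rule S)
      have "(LINT x|S n. ramp ((M + \<eta> - f x) / \<eta>)) \<le> measure (S n) {x. R \<le> e n - f x}"
        using \<eta> ge by (intro dom2[OF S SS]) (auto simp: divide_le_0_iff)
      then show False using elim down[of n] by linarith
    qed
  qed
  have "(\<lambda>n. LINT x|S n. ramp ((f x - (M + \<delta> - \<eta>)) / \<eta>)) \<longlonglongrightarrow> (LINT x|\<mu>. ramp ((f x - (M + \<delta> - \<eta>)) / \<eta>))"
    unfolding S_def using lipd \<eta>
    by (intro weak[of _ 1] uniformly_continuous_ramp[where C = "1 / \<eta>"])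
      (auto simp: ramp_bounds diff_divide_distrib)
  moreover have "eventually (\<lambda>n. (LINT x|S n. ramp ((f x - (M + \<delta> - \<eta>)) / \<eta>)) \<le> \<tau>) sequentially"
    using en
  proof eventually_elim
    case (elim n)
    have "(LINT x|S n. ramp ((f x - (M + \<delta> - \<eta>)) / \<eta>)) \<le> measure (S n) {x. R \<le> f x - e n}"
    proof (intro dom2[OF S SS])
      fix x assume "\<not> R \<le> f x - e n"
      then have "f x - (M + \<delta> - \<eta>) \<le> 0" using elim R unfolding \<eta>_def by linarith
      then show "(f x - (M + \<delta> - \<eta>)) / \<eta> \<le> 0" using \<eta> by (simp add: divide_le_0_iff)
    qed auto
    then show ?case using up[of n] by linarith
  qed
  ultimately have "(LINT x|\<mu>. ramp ((f x - (M + \<delta> - \<eta>)) / \<eta>)) \<le> \<tau>"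
    by (intro tendsto_upperbound) auto
  moreover have "measure \<mu> {x. \<delta> \<le> f x - M} \<le> (LINT x|\<mu>. ramp ((f x - (M + \<delta> - \<eta>)) / \<eta>))"
    using \<eta> by (intro dom1[OF \<mu> \<mu>S]) (auto simp: field_simps)
  ultimately show ?thesis by linarith
qed

theorem stable_concentration:
  fixes \<mu> \<sigma> :: "'a::euclidean_space measure" and f :: "'a \<Rightarrow> real"
  assumes \<mu>: "prob_space \<mu>" "sets \<mu> = sets borel"
    and \<alpha>: "0 < \<alpha>" "\<alpha> < 2" and stable: "has_stable_law \<mu> \<alpha> \<sigma>"
    and lip: "\<And>x y. \<bar>f x - f y\<bar> \<le> norm (x - y)"
    and med: "1 / 2 \<le> measure \<mu> {x. f x \<le> M}"
    and \<delta>: "\<delta> > sqrt 2 * (2 * measure \<sigma> (sphere 0 1) * stable_const \<alpha>) powr (1 / \<alpha>)"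
  shows "measure \<mu> {x. \<delta> \<le> f x - M} \<le> stable_const \<alpha> * sqrt 2 powr \<alpha> * measure \<sigma> (sphere 0 1) / \<delta> powr \<alpha>"
proof -
  define \<Sigma> where "\<Sigma> = measure \<sigma> (sphere 0 1)"
  define C where "C = stable_const \<alpha>"
  define \<kappa> where "\<kappa> = 1 / \<alpha> + exp 1 / (2 - \<alpha>)"
  have \<kappa>: "0 < \<kappa>" using \<alpha> by (simp add: \<kappa>_def add_pos_pos)
  \<comment> \<open>Partial fractions split the given constant: \<open>1 / \<alpha>\<close> belongs
    to the discarded jumps, \<open>exp 1 / (2 - \<alpha>)\<close> to the truncated sum.\<close>
  have C: "C = 4 powr \<alpha> * \<kappa>"
    using \<alpha> by (simp add: C_def stable_const_def \<kappa>_def divide_simps)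
  have \<Sigma>: "0 \<le> \<Sigma>" by (simp add: \<Sigma>_def)
  have "0 \<le> sqrt 2 * (2 * \<Sigma> * C) powr (1 / \<alpha>)" by simp
  then have \<delta>0: "0 < \<delta>" using \<delta> unfolding \<Sigma>_def C_def by linarith
  define R where "R = \<delta> / (4 * sqrt 2)"
  have R: "0 < R" using \<delta>0 by (simp add: R_def)
  have "3 * R \<le> \<delta>"
  proof -
    have "1 \<le> sqrt 2" by simp
    then have "3 \<le> 4 * sqrt 2" by linarith
    then have "3 * \<delta> \<le> (4 * sqrt 2) * \<delta>" using \<delta>0 by (intro mult_right_mono) auto
    then show ?thesis by (simp add: R_def divide_le_eq mult.commute)
  qed
  have Rp: "R powr (-\<alpha>) = 4 powr \<alpha> * sqrt 2 powr \<alpha> / \<delta> powr \<alpha>"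
    using \<delta>0 by (simp add: R_def powr_minus powr_divide powr_mult)
  have \<tau>_eq: "\<Sigma> * R powr (-\<alpha>) * \<kappa> = C * sqrt 2 powr \<alpha> * \<Sigma> / \<delta> powr \<alpha>"
    by (simp add: Rp C)
  have "\<Sigma> * R powr (-\<alpha>) * \<kappa> < 1 / 2"
  proof -
    have "(2 * \<Sigma> * C) powr (1 / \<alpha>) < \<delta> / sqrt 2"
      using \<delta> by (simp add: \<Sigma>_def C_def less_divide_eq mult.commute)
    then have "((2 * \<Sigma> * C) powr (1 / \<alpha>)) powr \<alpha> < (\<delta> / sqrt 2) powr \<alpha>"
      using \<alpha> by (intro powr_less_mono2) auto
    then have "2 * \<Sigma> * C < \<delta> powr \<alpha> / sqrt 2 powr \<alpha>"
      using \<alpha> \<Sigma> \<kappa> \<delta>0 by (simp add: powr_powr C powr_divide)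
    then show ?thesis
      unfolding \<tau>_eq using \<delta>0 by (simp add: field_simps)
  qed
  note bounded = stable_concentration_bounded[OF \<mu> \<alpha> stable _ _ R \<open>3 * R \<le> \<delta>\<close> _ this[unfolded \<Sigma>_def \<kappa>_def]]
  \<comment> \<open>Large enough that the levels \<open>M\<close> and \<open>M + \<delta>\<close>
    lie in \<open>[-N, N]\<close>, so that clamping \<open>f\<close> changes neither of the two
    events.\<close>
  define N where "N = \<bar>M\<bar> + \<delta>"
  define g where "g x = max (- N) (min N (f x))" for x
  have sets: "{x. g x \<le> M} = {x. f x \<le> M}" "{x. \<delta> \<le> g x - M} = {x. \<delta> \<le> f x - M}"
    using \<delta>0 by (auto simp: g_def N_def)
  have "measure \<mu> {x. \<delta> \<le> g x - M} \<le> \<Sigma> * R powr (-\<alpha>) * \<kappa>"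
    unfolding \<Sigma>_def \<kappa>_def
  proof (rule bounded)
    show "\<bar>g x\<bar> \<le> N" for x using \<delta>0 by (auto simp: g_def N_def)
    show "\<bar>g x - g y\<bar> \<le> norm (x - y)" for x y using lip[of x y] by (auto simp: g_def min_def max_def)
  qed (use med sets in simp)
  then show ?thesis unfolding \<tau>_eq by (simp add: sets \<Sigma>_def C_def)
qed

theorem corollary1p14:
  fixes \<Omega> :: "'w measure"
    and Y :: "'w \<Rightarrow> complex ^ 'n ^ 'k"
    and X :: "'w \<Rightarrow> real ^ ('k \<times> 'n + 'k \<times> 'n)"
    and L :: "'w \<Rightarrow> real"
    and \<mu> :: "(real ^ ('k \<times> 'n + 'k \<times> 'n)) measure"
  assumes "prob_space \<Omega>"
    and "CARD('k) > CARD('n)"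
    and "Y \<in> borel_measurable \<Omega>"
    and X: "\<And>\<omega>. X \<omega> = entry_vector (Y \<omega>)"
    and L: "\<And>\<omega>. L \<omega> = lambda_max (mat_sqrt (gram (Y \<omega>)))"
    and law: "\<mu> = distr \<Omega> borel X"
  shows "(\<forall>\<beta> \<nu>. has_ID_law \<mu> \<beta> \<nu> \<and> (\<exists>t>0. exp_moment \<mu> t < \<infinity>) \<longrightarrow>
           (let T = exp_moment_sup \<mu> in
             \<forall>\<delta>>0. ereal \<delta> < left_limit (levy_h \<nu>) T \<longrightarrow>
               measure \<Omega> {\<omega> \<in> space \<Omega>. L \<omega> - (LINT \<omega>'|\<Omega>. L \<omega>') \<ge> \<delta>}
                 \<le> exp (- (LBINT s=0..ereal (\<delta> / sqrt 2). levy_h_inv \<nu> T s)))) \<and>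
         (\<forall>\<alpha> \<sigma>. 0 < \<alpha> \<and> \<alpha> < 2 \<and> has_stable_law \<mu> \<alpha> \<sigma> \<longrightarrow>
           (\<forall>m. is_median \<Omega> L m \<longrightarrow>
             (\<forall>\<delta>. \<delta> > sqrt 2 * (2 * measure \<sigma> (sphere 0 1) * stable_const \<alpha>) powr (1 / \<alpha>) \<longrightarrow>
               measure \<Omega> {\<omega> \<in> space \<Omega>. L \<omega> - m \<ge> \<delta>}
                 \<le> stable_const \<alpha> * sqrt 2 powr \<alpha> * measure \<sigma> (sphere 0 1) / \<delta> powr \<alpha>)))"
proof -
  interpret \<Omega>: prob_space \<Omega> by fact
  obtain f :: "real ^ ('k \<times> 'n + 'k \<times> 'n) \<Rightarrow> real" where
    f: "\<And>Y :: complex ^ 'n ^ 'k. lambda_max (mat_sqrt (gram Y)) = f (entry_vector Y)"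
    and lip: "\<And>x y. \<bar>f x - f y\<bar> \<le> norm (x - y)"
    using lambda_max_lipschitz_entry_vector by blast
  have Lf: "L \<omega> = f (X \<omega>)" for \<omega> by (simp add: L f X)
  have "continuous_on UNIV (entry_vector :: complex ^ 'n ^ 'k \<Rightarrow> _)"
    by (rule lipschitz_on_continuous_on[of 1])
      (auto intro!: lipschitz_onI simp: dist_norm norm_entry_vector simp flip: entry_vector_diff)
  then have "entry_vector \<in> borel_measurable (borel :: (complex ^ 'n ^ 'k) measure)"
    by (rule borel_measurable_continuous_onI)
  from measurable_compose[OF assms(3) this] have Xm [measurable]: "X \<in> borel_measurable \<Omega>"
    using X by (simp cong: measurable_cong)
  have [measurable]: "f \<in> borel_measurable borel"
    using lip by (intro borel_measurable_continuous_onI uniformly_continuous_imp_continuous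
        lipschitz_imp_uniformly_continuous[of _ 1]) auto
  have \<mu>: "prob_space \<mu>" "sets \<mu> = sets borel"
    unfolding law by (auto intro: \<Omega>.prob_space_distr Xm)
  have mean: "(LINT \<omega>|\<Omega>. L \<omega>) = (LINT x|\<mu>. f x)"
    unfolding law Lf by (rule integral_distr[symmetric]) measurable
  have meas: "measure \<Omega> {\<omega> \<in> space \<Omega>. P (L \<omega>)} = measure \<mu> {x. P (f x)}"
    if [measurable]: "Measurable.pred borel P" for P
    unfolding law Lf by (subst measure_distr) (auto intro!: arg_cong[of _ _ "measure \<Omega>"])
  show ?thesis
  proof (intro conjI allI impI; (elim conjE exE)?)
    fix \<beta> \<nu> t assume "has_ID_law \<mu> \<beta> \<nu>" "0 < t" "exp_moment \<mu> t < \<infinity>"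
    note conc = ID_concentration[OF \<mu> this lip]
    show "let T = exp_moment_sup \<mu> in
        \<forall>\<delta>>0. ereal \<delta> < left_limit (levy_h \<nu>) T \<longrightarrow>
          measure \<Omega> {\<omega> \<in> space \<Omega>. L \<omega> - (LINT \<omega>'|\<Omega>. L \<omega>') \<ge> \<delta>}
            \<le> exp (- (LBINT s=0..ereal (\<delta> / sqrt 2). levy_h_inv \<nu> T s))"
      unfolding Let_def
    proof (intro allI impI)
      fix \<delta> :: real assume \<delta>: "0 < \<delta>" "ereal \<delta> < left_limit (levy_h \<nu>) (exp_moment_sup \<mu>)"
      \<comment> \<open>The Chernoff bound is run at \<open>\<delta>\<close> itself; ending the
        integral at the smaller \<open>\<delta> / sqrt 2\<close> is where the slack is given
        away.\<close>
      have "\<delta> * 1 \<le> \<delta> * sqrt 2" using \<delta>(1) by (intro mult_left_mono) auto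
      then have "\<delta> / sqrt 2 \<le> \<delta>" by (simp add: divide_le_eq)
      then show "measure \<Omega> {\<omega> \<in> space \<Omega>. L \<omega> - (LINT \<omega>'|\<Omega>. L \<omega>') \<ge> \<delta>}
          \<le> exp (- (LBINT s=0..ereal (\<delta> / sqrt 2). levy_h_inv \<nu> (exp_moment_sup \<mu>) s))"
        using conc[of "\<delta> / sqrt 2" \<delta>] \<delta> meas[of "\<lambda>l. \<delta> \<le> l - (LINT x|\<mu>. f x)"]
        by (simp add: mean)
    qed
  next
    fix \<alpha> m \<delta> and \<sigma> :: "(real ^ ('k \<times> 'n + 'k \<times> 'n)) measure"
    assume *: "0 < \<alpha>" "\<alpha> < 2" "has_stable_law \<mu> \<alpha> \<sigma>" "is_median \<Omega> L m"
      "\<delta> > sqrt 2 * (2 * measure \<sigma> (sphere 0 1) * stable_const \<alpha>) powr (1 / \<alpha>)"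
    have "1 / 2 \<le> measure \<mu> {x. f x \<le> m}"
      using *(4) meas[of "\<lambda>l. l \<le> m"] by (simp add: is_median_def)
    from stable_concentration[OF \<mu> *(1-3) lip this *(5)]
    show "measure \<Omega> {\<omega> \<in> space \<Omega>. L \<omega> - m \<ge> \<delta>}
        \<le> stable_const \<alpha> * sqrt 2 powr \<alpha> * measure \<sigma> (sphere 0 1) / \<delta> powr \<alpha>"
      using meas[of "\<lambda>l. \<delta> \<le> l - m"] by simp
  qed
qed

end
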